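(* Let $d\ge 1$ be an integer, let $r>d+1$ be real, and let $\boldsymbol\gamma_m=(\gamma_{m,1},\dots,\gamma_{m,m})$, $m=1,2,\dots$, be positive weights that are uniformly bounded, i.e. $\gamma^*:=\sup_{m\ge1}\max_{1\le j\le m}\gamma_{m,j}<\infty$. Consider multivariate integration $I_m$ over $(T^d)^m$ in the spaces $H_m=H_{m,\boldsymbol\gamma_m}^{(d,r)}$, $m=1,2,\dots$, by QMC rules (all notions as defined in the context). Then: 1. Multivariate integration is strongly polynomially tractable if and only if $$\limsup_{m\to\infty}\sum_{j=1}^m\gamma_{m,j}<\infty.$$ If this holds, then the $\epsilon$-exponent of strong polynomial tractability is at most $2$. 2. Multivariate integration is polynomially tractable if and only if $$\beta:=\limsup_{m\to\infty}\frac{\sum_{j=1}^m\gamma_{m,j}}{\log(m+1)}<\infty.$$ If this holds, then the $\epsilon$-exponent of polynomial tractability is at most $2$ and the $m$-exponent of polynomial tractability is at most $c_{d,r}\beta$. 3. Multivariate integration is weakly tractable if and only if $$\lim_{m\to\infty}\frac{\sum_{j=1}^m\gamma_{m,j}}{m}=0.$$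
   Context: Simplex and polynomials. $T^d=\{x\in\mathbb R^d: x_1\ge0,\dots,x_d\ge0,\ 1-(x_1+\cdots+x_d)\ge0\}$. $L_2(T^d)$ carries the inner product $\langle f,g\rangle=d!\int_{T^d}f(x)g(x)\,dx$. For $\ell\in\mathbb N_0$, $\mathcal V_\ell^d$ is the space of real polynomials in $d$ variables of degree at most $\ell$ that are orthogonal (for this inner product) to all polynomials of degree less than $\ell$; $r_\ell^d=\dim\mathcal V_\ell^d=\binom{\ell+d-1}{\ell}$; $\{P_{\ell,k}:1\le k\le r_\ell^d\}$ is a fixed orthonormal basis of $\mathcal V_\ell^d$, with $P_{0,1}=1$. Put $P_\ell(x,y)=\sum_{k=1}^{r_\ell^d}P_{\ell,k}(x)P_{\ell,k}(y)$ (independent of the choice of orthonormal basis). Let $M$ be a fixed constant depending only on $d$ such that $P_\ell(x,y)\le M\ell^{2d}$ for all $\ell\ge1$ and $x,y\in T^d$ (such a constant exists), and set $$c_{d,r}=M\sum_{\ell=1}^\infty\frac{\ell^{2d}}{[\ell(\ell+d)]^r},$$ which is finite for $r>d+1$. Function space. For $\gamma>0$ let $B_{d,r,\gamma}(0)=1$ and $B_{d,r,\gamma}(\ell)=\frac1\gamma[\ell(\ell+d)]^r$ for $\ell\ge1$. $H_{1,\gamma}^{(d,r)}\subseteq L_2(T^d)$ is the closure of the polynomials under the norm $\|f\|_1^2=\sum_{\ell=0}^\infty\sum_{k=1}^{r_\ell^d}B_{d,r,\gamma}(\ell)\,a_k^\ell(f)^2$, where $a_k^\ell(f)=d!\int_{T^d}f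 P_{\ell,k}\,dx$ (i.e. the $f\in L_2(T^d)$ for which this sum is finite). For $r>d+1$ its elements are continuous and it is a reproducing kernel Hilbert space. The space $H_m=H_{m,\boldsymbol\gamma_m}^{(d,r)}$ of functions on $(T^d)^m$ is the Hilbert space tensor product $H_{1,\gamma_{m,1}}^{(d,r)}\otimes\cdots\otimes H_{1,\gamma_{m,m}}^{(d,r)}$, with inner product $$\langle f,g\rangle_m=\sum_{\boldsymbol\ell\in\mathbb N_0^m}\ \sum_{\boldsymbol k:\,1\le k_j\le r_{\ell_j}^d}\Big(\prod_{j=1}^mB_{d,r,\gamma_{m,j}}(\ell_j)\Big)a_{\boldsymbol k}^{\boldsymbol\ell}(f)a_{\boldsymbol k}^{\boldsymbol\ell}(g),\qquad a_{\boldsymbol k}^{\boldsymbol\ell}(f)=(d!)^m\int_{(T^d)^m}f(\boldsymbol x)\prod_{j=1}^mP_{\ell_j,k_j}(x_j)\,d\boldsymbol x,$$ norm $\|\cdot\|_m$, and reproducing kernel $K_m(\boldsymbol x,\boldsymbol y)=\prod_{j=1}^m\Big(1+\gamma_{m,j}\sum_{\ell=1}^\infty\frac{P_\ell(x_j,y_j)}{[\ell(\ell+d)]^r}\Big)$. Integration and errors. $I_m(f)=(d!)^m\int_{(T^d)^m}f(\boldsymbol x)\,d\boldsymbol x$. For $n\ge1$ and points $\boldsymbol t_1,\dots,\boldsymbol t_n\in(T^d)^m$, the QMC rule is $Q_{n,m}(f)=\frac1n\sum_{i=1}^nf(\boldsymbol t_i)$; $Q_{0,m}=0$. The worst-case error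 is $e_{n,m}=\sup\{|I_m(f)-Q_{n,m}(f)|: f\in H_m,\ \|f\|_m\le1\}$, and $e_{0,m}=\sup\{|I_m(f)|:f\in H_m,\ \|f\|_m\le1\}$ is the initial error. Tractability. For $\epsilon\in(0,1)$ and $m\ge1$, $n(\epsilon,m)$ is the smallest $n$ for which there exist $\boldsymbol t_1,\dots,\boldsymbol t_n\in(T^d)^m$ with $e_{n,m}\le\epsilon\,e_{0,m}$. The problem is polynomially tractable iff there are non-negative $C,p,q$ with $$n(\epsilon,m)\le C\epsilon^{-p}m^q\quad\text{for all }m=1,2,\dots\text{ and all }\epsilon\in(0,1);$$ the infima of such $q$ and $p$ are the $m$-exponent and the $\epsilon$-exponent of tractability. It is strongly polynomially tractable iff the bound holds with $q=0$ (the $\epsilon$-exponent of strong polynomial tractability being the infimum of $p$ with $q=0$). It is weakly tractable iff $\lim_{\epsilon^{-1}+m\to\infty}\frac{\log n(\epsilon,m)}{\epsilon^{-1}+m}=0$. *)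

theory Defs
  imports "HOL-Analysis.Analysis"
begin

text \<open>The dimension \<open>d\<close> of the simplex is \<open>CARD('n)\<close>.\<close>

definition Td :: "(real ^ 'n) set" where
  "Td = {x. (\<forall>i. 0 \<le> x $ i) \<and> 0 \<le> 1 - (\<Sum>i\<in>UNIV. x $ i)}"

definition ip :: "(real ^ 'n \<Rightarrow> real) \<Rightarrow> (real ^ 'n \<Rightarrow> real) \<Rightarrow> real" where
  "ip f g = fact CARD('n) * (LINT x:Td|lborel. f x * g x)"


subsection \<open>Orthogonal polynomials on the simplex\<close>

definition poly_deg_le :: "nat \<Rightarrow> (real ^ 'n \<Rightarrow> real) set" where
  "poly_deg_le l = {f. \<exists>c :: ('n \<Rightarrow> nat) \<Rightarrow> real. f =
     (\<lambda>x. \<Sum>\<alpha> | (\<Sum>i\<in>UNIV. \<alpha> i) \<le> l. c \<alpha> * (\<Prod>i\<in>UNIV. (x $ i) ^ \<alpha> i))}"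

definition orth_poly_space :: "nat \<Rightarrow> (real ^ 'n \<Rightarrow> real) set" where
  "orth_poly_space l = {f \<in> poly_deg_le l. \<forall>l'<l. \<forall>g\<in>poly_deg_le l'. ip f g = 0}"

definition rdim :: "nat \<Rightarrow> nat \<Rightarrow> nat" where
  "rdim d l = (l + d - 1) choose l"

definition orthonormal_bases :: "(nat \<Rightarrow> nat \<Rightarrow> real ^ 'n \<Rightarrow> real) \<Rightarrow> bool" where
  "orthonormal_bases P \<longleftrightarrow>
     (\<forall>l. (\<forall>k\<in>{1..rdim CARD('n) l}. P l k \<in> orth_poly_space l) \<and>
          (\<forall>k\<in>{1..rdim CARD('n) l}. \<forall>k'\<in>{1..rdim CARD('n) l}.
             ip (P l k) (P l k') = (if k = k' then 1 else 0)) \<and>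
          (\<forall>f\<in>orth_poly_space l. \<exists>c. f = (\<lambda>x. \<Sum>k=1..rdim CARD('n) l. c k * P l k x))) \<and>
     P 0 1 = (\<lambda>x. 1)"

definition Pker :: "(nat \<Rightarrow> nat \<Rightarrow> real ^ 'n \<Rightarrow> real) \<Rightarrow> nat \<Rightarrow> real ^ 'n \<Rightarrow> real ^ 'n \<Rightarrow> real" where
  "Pker P l x y = (\<Sum>k=1..rdim CARD('n) l. P l k x * P l k y)"

definition cdr :: "nat \<Rightarrow> real \<Rightarrow> real \<Rightarrow> real" where
  "cdr d r M = M * (\<Sum>\<^sub>\<infinity>l\<in>{1..}. real l ^ (2 * d) / (real l * (real l + real d)) powr r)"


subsection \<open>Function spaces\<close>

definition Bcoef :: "nat \<Rightarrow> real \<Rightarrow> real \<Rightarrow> nat \<Rightarrow> real" where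
  "Bcoef d r g l = (if l = 0 then 1 else 1 / g * (real l * (real l + real d)) powr r)"

text \<open>
  Elements of the spaces are functions with point values, not equivalence classes: for
  \<open>r > d + 1\<close> every class in \<open>L\<^sub>2\<close> for which the defining sum is finite has exactly one
  continuous representative, and this is the one taken here. Square integrability follows
  from continuity on a compact set. Functions are total; only their values on the simplex
  (or on the product domain) matter.
\<close>

definition H1 :: "(nat \<Rightarrow> nat \<Rightarrow> real ^ 'n \<Rightarrow> real) \<Rightarrow> real \<Rightarrow> real \<Rightarrow> (real ^ 'n \<Rightarrow> real) set" where
  "H1 P r g = {f. continuous_on Td f \<and>
     summable (\<lambda>l. \<Sum>k=1..rdim CARD('n) l. Bcoef CARD('n) r g l * (ip f (P l k))\<^sup>2)}"

definition domain :: "nat \<Rightarrow> (nat \<Rightarrow> real ^ 'n) set" where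
  "domain m = PiE {1..m} (\<lambda>_. Td)"

definition integ :: "nat \<Rightarrow> ((nat \<Rightarrow> real ^ 'n) \<Rightarrow> real) \<Rightarrow> real" where
  "integ m f = fact CARD('n) ^ m * (LINT x:domain m|PiM {1..m} (\<lambda>_. lborel). f x)"

definition acoef :: "(nat \<Rightarrow> nat \<Rightarrow> real ^ 'n \<Rightarrow> real) \<Rightarrow> nat \<Rightarrow> (nat \<Rightarrow> nat) \<times> (nat \<Rightarrow> nat)
    \<Rightarrow> ((nat \<Rightarrow> real ^ 'n) \<Rightarrow> real) \<Rightarrow> real" where
  "acoef P m = (\<lambda>(l, k) f. fact CARD('n) ^ m *
     (LINT x:domain m|PiM {1..m} (\<lambda>_. lborel). f x * (\<Prod>j=1..m. P (l j) (k j) (x j))))"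

definition multi_idx :: "nat \<Rightarrow> nat \<Rightarrow> ((nat \<Rightarrow> nat) \<times> (nat \<Rightarrow> nat)) set" where
  "multi_idx d m = (SIGMA l : PiE {1..m} (\<lambda>_. UNIV). PiE {1..m} (\<lambda>j. {1..rdim d (l j)}))"

definition Bprod :: "nat \<Rightarrow> real \<Rightarrow> (nat \<Rightarrow> real) \<Rightarrow> nat \<Rightarrow> (nat \<Rightarrow> nat) \<Rightarrow> real" where
  "Bprod d r g m l = (\<Prod>j=1..m. Bcoef d r (g j) (l j))"

definition inner_H :: "(nat \<Rightarrow> nat \<Rightarrow> real ^ 'n \<Rightarrow> real) \<Rightarrow> real \<Rightarrow> (nat \<Rightarrow> real) \<Rightarrow> nat
    \<Rightarrow> ((nat \<Rightarrow> real ^ 'n) \<Rightarrow> real) \<Rightarrow> ((nat \<Rightarrow> real ^ 'n) \<Rightarrow> real) \<Rightarrow> real" where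
  "inner_H P r g m f h = (\<Sum>\<^sub>\<infinity>i\<in>multi_idx CARD('n) m.
     Bprod CARD('n) r g m (fst i) * acoef P m i f * acoef P m i h)"

definition norm_H :: "(nat \<Rightarrow> nat \<Rightarrow> real ^ 'n \<Rightarrow> real) \<Rightarrow> real \<Rightarrow> (nat \<Rightarrow> real) \<Rightarrow> nat
    \<Rightarrow> ((nat \<Rightarrow> real ^ 'n) \<Rightarrow> real) \<Rightarrow> real" where
  "norm_H P r g m f = sqrt (inner_H P r g m f f)"

definition alg_tensor :: "(nat \<Rightarrow> nat \<Rightarrow> real ^ 'n \<Rightarrow> real) \<Rightarrow> real \<Rightarrow> (nat \<Rightarrow> real) \<Rightarrow> nat
    \<Rightarrow> ((nat \<Rightarrow> real ^ 'n) \<Rightarrow> real) set" where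
  "alg_tensor P r g m = {f. \<exists>(N :: nat) h.
     (\<forall>i<N. \<forall>j\<in>{1..m}. h i j \<in> H1 P r (g j)) \<and>
     f = (\<lambda>x. \<Sum>i<N. \<Prod>j=1..m. h i j (x j))}"

text \<open>
  The Hilbert space tensor product: the closure of the algebraic tensor product under
  \<open>norm_H\<close>, realised inside the continuous functions for which the sum defining \<open>norm_H\<close>
  is finite.
\<close>

definition Hm :: "(nat \<Rightarrow> nat \<Rightarrow> real ^ 'n \<Rightarrow> real) \<Rightarrow> real \<Rightarrow> (nat \<Rightarrow> real) \<Rightarrow> nat
    \<Rightarrow> ((nat \<Rightarrow> real ^ 'n) \<Rightarrow> real) set" where
  "Hm P r g m = {f. continuous_on (domain m) f \<and>
     (\<lambda>i. Bprod CARD('n) r g m (fst i) * (acoef P m i f)\<^sup>2) summable_on multi_idx CARD('n) m \<and>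
     (\<forall>\<epsilon>>0. \<exists>h\<in>alg_tensor P r g m. norm_H P r g m (\<lambda>x. f x - h x) < \<epsilon>)}"


subsection \<open>Quasi-Monte Carlo rules and errors\<close>

definition qmc :: "nat \<Rightarrow> (nat \<Rightarrow> nat \<Rightarrow> real ^ 'n) \<Rightarrow> ((nat \<Rightarrow> real ^ 'n) \<Rightarrow> real) \<Rightarrow> real" where
  "qmc n t f = (if n = 0 then 0 else 1 / real n * (\<Sum>i=1..n. f (t i)))"

text \<open>
  The suprema are over bounded nonempty sets when \<open>r > d + 1\<close> and the weights are positive,
  because point evaluation and integration are then bounded functionals.
\<close>

definition wce :: "(nat \<Rightarrow> nat \<Rightarrow> real ^ 'n \<Rightarrow> real) \<Rightarrow> real \<Rightarrow> (nat \<Rightarrow> real) \<Rightarrow> nat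
    \<Rightarrow> nat \<Rightarrow> (nat \<Rightarrow> nat \<Rightarrow> real ^ 'n) \<Rightarrow> real" where
  "wce P r g m n t = (SUP f\<in>{f \<in> Hm P r g m. norm_H P r g m f \<le> 1}. \<bar>integ m f - qmc n t f\<bar>)"

definition init_error :: "(nat \<Rightarrow> nat \<Rightarrow> real ^ 'n \<Rightarrow> real) \<Rightarrow> real \<Rightarrow> (nat \<Rightarrow> real) \<Rightarrow> nat
    \<Rightarrow> real" where
  "init_error P r g m = (SUP f\<in>{f \<in> Hm P r g m. norm_H P r g m f \<le> 1}. \<bar>integ m f\<bar>)"

text \<open>
  A suitable \<open>n\<close> always exists for positive weights and \<open>r > d + 1\<close>: averaging the squared
  error over uniformly distributed points bounds its minimum by a constant (in \<open>n\<close>)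
  times \<open>1 / n\<close>. So the use of \<open>LEAST\<close> is unproblematic.
\<close>

definition n_min :: "(nat \<Rightarrow> nat \<Rightarrow> real ^ 'n \<Rightarrow> real) \<Rightarrow> real \<Rightarrow> (nat \<Rightarrow> nat \<Rightarrow> real)
    \<Rightarrow> real \<Rightarrow> nat \<Rightarrow> nat" where
  "n_min P r \<gamma> \<epsilon> m = (LEAST n. \<exists>t. (\<forall>i\<in>{1..n}. t i \<in> domain m) \<and>
     wce P r (\<gamma> m) m n t \<le> \<epsilon> * init_error P r (\<gamma> m) m)"


subsection \<open>Tractability\<close>

text \<open>Here \<open>N \<epsilon> m\<close> is an information complexity such as \<open>n_min P r \<gamma> \<epsilon> m\<close>.\<close>

definition tract_bound :: "(real \<Rightarrow> nat \<Rightarrow> nat) \<Rightarrow> real \<Rightarrow> real \<Rightarrow> real \<Rightarrow> bool" where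
  "tract_bound N C p q \<longleftrightarrow>
     (\<forall>m\<ge>1. \<forall>\<epsilon>\<in>{0<..<1}. real (N \<epsilon> m) \<le> C * \<epsilon> powr (- p) * real m powr q)"

definition poly_tractable :: "(real \<Rightarrow> nat \<Rightarrow> nat) \<Rightarrow> bool" where
  "poly_tractable N \<longleftrightarrow> (\<exists>C\<ge>0. \<exists>p\<ge>0. \<exists>q\<ge>0. tract_bound N C p q)"

definition eps_exponent :: "(real \<Rightarrow> nat \<Rightarrow> nat) \<Rightarrow> real" where
  "eps_exponent N = Inf {p. p \<ge> 0 \<and> (\<exists>C\<ge>0. \<exists>q\<ge>0. tract_bound N C p q)}"

definition m_exponent :: "(real \<Rightarrow> nat \<Rightarrow> nat) \<Rightarrow> real" where
  "m_exponent N = Inf {q. q \<ge> 0 \<and> (\<exists>C\<ge>0. \<exists>p\<ge>0. tract_bound N C p q)}"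

definition strongly_poly_tractable :: "(real \<Rightarrow> nat \<Rightarrow> nat) \<Rightarrow> bool" where
  "strongly_poly_tractable N \<longleftrightarrow> (\<exists>C\<ge>0. \<exists>p\<ge>0. tract_bound N C p 0)"

definition strong_eps_exponent :: "(real \<Rightarrow> nat \<Rightarrow> nat) \<Rightarrow> real" where
  "strong_eps_exponent N = Inf {p. p \<ge> 0 \<and> (\<exists>C\<ge>0. tract_bound N C p 0)}"

definition weakly_tractable :: "(real \<Rightarrow> nat \<Rightarrow> nat) \<Rightarrow> bool" where
  "weakly_tractable N \<longleftrightarrow>
     ((\<lambda>(\<epsilon>, m). ln (real (N \<epsilon> m)) / (1 / \<epsilon> + real m)) \<longlongrightarrow> 0)
       (inf (filtercomap (\<lambda>(\<epsilon>, m). 1 / \<epsilon> + real m) at_top) (principal ({0<..<1} \<times> {1..})))"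

end

theory Submission
  imports Defs "HOL-Real_Asymp.Real_Asymp"
begin

text \<open>Expand functions on the \<open>m\<close>-fold product of the simplex in the orthonormal products
\<open>phi m l k\<close> of the given polynomials. In these coordinates integration is the coefficient of
the constant function, and the worst-case error of a QMC rule becomes a weighted sum of squares,
\[ e^2 = \frac{1}{n^2} \sum_{l \ne 0} \frac{1}{B(l)} \sum_k \Big(\sum_{s=1}^n \varphi_{l,k}(t_s)\Big)^2. \]
Both halves of the theorem come from this quadratic form.

Upper bound. If the points are chosen one after the other, a uniformly distributed new point raises
the double sum, on average, by \<open>\<Sum>l\<noteq>0. card (indices of degree l) / B(l)\<close>, because the basis
functions have mean zero and variance one. The bound on \<open>Pker\<close> turns this increment into at most
\<open>(\<Prod>j. 1 + \<gamma>\<^sub>j c) - 1\<close>, so some points achieve \<open>e\<^sup>2 \<le> ((\<Prod>j. 1 + \<gamma>\<^sub>j c) - 1) / n\<close>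
(\<open>exists_good_points\<close>). That the quadratic form bounds the error on all of \<open>Hm\<close> needs the
pointwise expansion of a function of the space in its Fourier series (\<open>Hm_expansion\<close>), which rests on
Stone--Weierstrass and on the fact that \<open>Pker\<close> controls all blocks of equal degree at once.

Lower bound. Keep only the degrees 0, 1, 2 in every factor and multiply all weights by a constant
\<open>a \<le> 1\<close> so small that the resulting product kernel is non-negative. The corresponding quadratic form
is smaller than \<open>e\<^sup>2\<close>, and dropping its off-diagonal terms leaves
\<open>e\<^sup>2 \<ge> (\<Prod>j. 1 + \<eta> \<gamma>\<^sub>j) / n - 1\<close> (\<open>wce_lower_bound\<close>). Here \<open>\<eta> > 0\<close> because no
point of the simplex is a common zero of all basis polynomials of degrees 1 and 2: the polynomial
\<open>|y - x|\<^sup>2\<close> vanishes at \<open>x\<close> but has positive mean (\<open>low_kernel_diag_pos\<close>).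

As the initial error is 1, the information complexity therefore lies between
\<open>(\<Prod>j. 1 + \<eta> \<gamma>\<^sub>j) / 2\<close> and \<open>(\<Prod>j. 1 + \<gamma>\<^sub>j c) / \<epsilon>\<^sup>2\<close>. For bounded weights the logarithms of
both products are of the exact order \<open>\<Sum>j. \<gamma>\<^sub>j\<close>, and the three characterisations and the bounds on
the exponents follow by taking logarithms (locale \<open>product_bounded_complexity\<close>).\<close>

section \<open>Integration over products of the simplex\<close>

text \<open>Index sets \<open>{1..m}\<close> and the basis element \<open>P 0 1\<close> are to stay in this form under
simplification.\<close>

declare One_nat_def [simp del]

lemma Td_eq_std_simplex: "(Td :: (real ^ 'n) set) = convex hull (insert 0 Basis)"
proof -
  have B: "(Basis :: (real ^ 'n) set) = (\<lambda>i. axis i 1) ` UNIV"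
    by (auto simp: Basis_vec_def)
  have inj: "inj (\<lambda>i::'n. axis i (1::real))"
    by (auto simp: inj_on_def axis_eq_axis)
  have 1: "(\<forall>i\<in>Basis. 0 \<le> x \<bullet> i) \<longleftrightarrow> (\<forall>i. 0 \<le> x $ i)" for x :: "real ^ 'n"
    unfolding B by (simp add: inner_axis)
  have 2: "sum ((\<bullet>) x) Basis = (\<Sum>i\<in>UNIV. x $ i)" for x :: "real ^ 'n"
    unfolding B by (simp add: sum.reindex[OF inj] inner_axis)
  show ?thesis
    unfolding std_simplex Td_def 1 2 by auto
qed

lemma measure_Td: "measure lborel (Td :: (real ^ 'n) set) = 1 / fact CARD('n)"
  by (simp add: Td_eq_std_simplex content_std_simplex)

lemma convex_Td: "convex (Td :: (real ^ 'n) set)"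
  by (simp add: Td_eq_std_simplex)

lemma compact_Td: "compact (Td :: (real ^ 'n) set)"
  by (simp add: Td_eq_std_simplex finite_imp_compact_convex_hull)

lemma closed_Td: "closed (Td :: (real ^ 'n) set)"
  by (simp add: compact_Td compact_imp_closed)

lemma Td_sets: "(Td :: (real ^ 'n) set) \<in> sets lborel"
  by (simp add: closed_Td)

lemma emeasure_Td: "emeasure lborel (Td :: (real ^ 'n) set) = ennreal (1 / fact CARD('n))"
  using emeasure_eq_ennreal_measure[of lborel "Td :: (real ^ 'n) set"]
    emeasure_compact_finite[OF compact_Td] by (simp add: measure_Td less_top)

lemma zero_in_Td: "0 \<in> Td"
  by (simp add: Td_def)

text \<open>The simplex is convex with non-empty interior, hence the closure of its interior, so a neighbourhood
of any of its points meets the interior. This makes a continuous function that vanishes almost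
everywhere vanish at every point of the domain, boundary included.\<close>

lemma emeasure_Td_Int_open:
  assumes "open V" "x \<in> V" "x \<in> (Td :: (real ^ 'n) set)"
  shows "emeasure lborel (V \<inter> Td) > 0"
proof -
  have ne: "interior (Td :: (real ^ 'n) set) \<noteq> {}"
  proof
    assume "interior (Td :: (real ^ 'n) set) = {}"
    then have "negligible (Td :: (real ^ 'n) set)"
      by (simp add: negligible_convex_interior convex_Td)
    then have "(Td :: (real ^ 'n) set) \<in> null_sets lborel"
      by (simp add: negligible_iff_null_sets null_sets_completion_iff[OF Td_sets])
    then have "emeasure lborel (Td :: (real ^ 'n) set) = 0" by (rule null_setsD1)
    then show False by (simp add: emeasure_Td)
  qed
  then have "x \<in> closure (interior Td)"
    using convex_closure_interior[OF convex_Td ne] closure_subset assms(3) by auto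
  then have ne2: "V \<inter> interior Td \<noteq> {}"
    using assms by (meson disjoint_iff closure_iff_nhds_not_empty open_Int subset_refl)
  have "\<not> negligible (V \<inter> interior Td)"
    by (intro open_not_negligible ne2 open_Int assms open_interior)
  moreover have int_sets: "V \<inter> interior Td \<in> sets lborel"
    using assms by (simp add: open_Int)
  ultimately have "emeasure lborel (V \<inter> interior Td) \<noteq> 0"
    using null_sets_completion_iff[OF int_sets] by (auto simp: negligible_iff_null_sets null_sets_def)
  moreover have "emeasure lborel (V \<inter> interior Td) \<le> emeasure lborel (V \<inter> Td)"
    by (rule emeasure_mono) (use interior_subset[of "Td :: (real^'n) set"] assms in \<open>auto simp: closed_Td
        intro!: sets.Int\<close>)
  ultimately show ?thesis by (metis le_zero_eq not_gr_zero)
qed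

text \<open>Points of the domain take the value \<open>undefined\<close> outside \<open>{1..m}\<close>. Writing the domain as a full
product, with singletons as the remaining factors, makes Tychonoff's theorem applicable.\<close>

lemma domain_eq_PiE_UNIV:
  "domain m = PiE UNIV (\<lambda>j. if j \<in> {1..m} then Td else {undefined})"
  by (auto simp: domain_def PiE_def Pi_def extensional_def)

lemma compact_domain: "compact (domain m :: (nat \<Rightarrow> real ^ 'n) set)"
proof -
  have "compactin (product_topology (\<lambda>_::nat. euclidean :: (real^'n) topology) UNIV)
     (PiE UNIV (\<lambda>j. if j \<in> {1..m} then Td else {undefined}))"
    unfolding compactin_PiE using compact_Td by auto
  then show ?thesis
    by (simp add: domain_eq_PiE_UNIV euclidean_product_topology)
qed

lemma closed_domain: "closed (domain m :: (nat \<Rightarrow> real ^ 'n) set)"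
  by (simp add: compact_domain compact_imp_closed)

lemma domain_nonempty: "(domain m :: (nat \<Rightarrow> real ^ 'n) set) \<noteq> {}"
  using zero_in_Td by (auto simp: domain_def PiE_eq_empty_iff)

abbreviation lborel_PiM :: "nat \<Rightarrow> (nat \<Rightarrow> real ^ 'n) measure" where
  "lborel_PiM m \<equiv> PiM {1..m} (\<lambda>_. lborel)"

interpretation lborel_product: product_sigma_finite "\<lambda>_ :: nat. lborel :: (real ^ 'n) measure"
  by unfold_locales

text \<open>The product topology on functions, in which continuity on the domain is meant, and the finite product
\<open>\<sigma>\<close>-algebra, with respect to which integrals are taken, live on different spaces; measurability of
the inclusion connects them.\<close>

lemma id_measurable_lborel_PiM:
  "(\<lambda>x. x) \<in> borel_measurable (lborel_PiM m :: (nat \<Rightarrow> real ^ 'n) measure)"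
proof (rule measurable_coordinatewise_then_product)
  fix i
  show "(\<lambda>x. x i) \<in> borel_measurable (lborel_PiM m :: (nat \<Rightarrow> real ^ 'n) measure)"
  proof (cases "i \<in> {1..m}")
    case True
    then show ?thesis using measurable_component_singleton[of i "{1..m}" "\<lambda>_. lborel :: (real^'n)
        measure"] by simp
  next
    case False
    have "(\<lambda>x. undefined) \<in> borel_measurable (lborel_PiM m :: (nat \<Rightarrow> real ^ 'n) measure)" by simp
    then show ?thesis
      by (rule measurable_cong[THEN iffD1, rotated]) (use False in \<open>auto simp: space_PiM PiE_def
          extensional_def\<close>)
  qed
qed

lemma domain_sets: "(domain m :: (nat \<Rightarrow> real ^ 'n) set) \<in> sets (lborel_PiM m)"
  unfolding domain_def by (rule sets_PiM_I_finite) (auto simp: closed_Td)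

lemma emeasure_domain: "emeasure (lborel_PiM m) (domain m :: (nat \<Rightarrow> real ^ 'n) set)
    = ennreal ((1 / fact CARD('n)) ^ m)"
  unfolding domain_def
  by (subst lborel_product.emeasure_PiM) (auto simp: closed_Td emeasure_Td simp flip: ennreal_power)

lemma set_borel_measurable_domain:
  fixes f :: "(nat \<Rightarrow> real ^ 'n) \<Rightarrow> real"
  assumes "continuous_on (domain m) f"
  shows "(\<lambda>x. indicator (domain m) x *\<^sub>R f x) \<in> borel_measurable (lborel_PiM m)"
proof -
  have "(\<lambda>x. indicator (domain m) x *\<^sub>R f x) \<in> borel_measurable borel"
    using assms by (intro borel_measurable_continuous_on_indicator) (auto simp: closed_domain)
  from measurable_compose[OF id_measurable_lborel_PiM this] show ?thesis .
qed

lemma continuous_on_domain_bounded: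
  fixes f :: "(nat \<Rightarrow> real ^ 'n) \<Rightarrow> real"
  assumes "continuous_on (domain m) f"
  obtains B where "B \<ge> 0" "\<And>x. x \<in> domain m \<Longrightarrow> \<bar>f x\<bar> \<le> B"
proof -
  have "bounded (f ` domain m)"
    by (intro compact_imp_bounded compact_continuous_image assms compact_domain)
  then obtain B where "\<forall>x\<in>domain m. norm (f x) \<le> B" by (auto simp: bounded_iff)
  then show ?thesis using that[of "max B 0"] by fastforce
qed

lemma set_integrable_domain:
  fixes f :: "(nat \<Rightarrow> real ^ 'n) \<Rightarrow> real"
  assumes "continuous_on (domain m) f"
  shows "set_integrable (lborel_PiM m) (domain m) f"
proof -
  obtain B where B: "\<And>x. x \<in> domain m \<Longrightarrow> \<bar>f x\<bar> \<le> B" using continuous_on_domain_bounded assms by blast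
  show ?thesis unfolding set_integrable_def
    by (rule integrableI_bounded_set[where A = "domain m" and B = B])
       (use B set_borel_measurable_domain[OF assms] in \<open>auto simp: domain_sets emeasure_domain ennreal_power\<close>)
qed

lemma integ_add:
  fixes f g :: "(nat \<Rightarrow> real ^ 'n) \<Rightarrow> real"
  assumes "continuous_on (domain m) f" "continuous_on (domain m) g"
  shows "integ m (\<lambda>x. f x + g x) = integ m f + integ m g"
  unfolding integ_def using set_integral_add(2)[OF set_integrable_domain[OF assms(1)]
      set_integrable_domain[OF assms(2)]]
  by (simp add: distrib_left)

lemma integ_cmult:
  fixes f :: "(nat \<Rightarrow> real ^ 'n) \<Rightarrow> real"
  shows "integ m (\<lambda>x. c * f x) = c * integ m f"
  unfolding integ_def by simp

lemma integ_diff: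
  fixes f g :: "(nat \<Rightarrow> real ^ 'n) \<Rightarrow> real"
  assumes "continuous_on (domain m) f" "continuous_on (domain m) g"
  shows "integ m (\<lambda>x. f x - g x) = integ m f - integ m g"
  unfolding integ_def using set_integral_diff(2)[OF set_integrable_domain[OF assms(1)]
      set_integrable_domain[OF assms(2)]]
  by (simp add: right_diff_distrib)

lemma integ_zero: "integ m (\<lambda>x. 0) = 0"
  by (simp add: integ_def set_lebesgue_integral_def)

lemma integ_sum:
  fixes f :: "'i \<Rightarrow> (nat \<Rightarrow> real ^ 'n) \<Rightarrow> real"
  assumes "\<And>i. i \<in> A \<Longrightarrow> continuous_on (domain m) (f i)"
  shows "integ m (\<lambda>x. \<Sum>i\<in>A. f i x) = (\<Sum>i\<in>A. integ m (f i))"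
  using assms
proof (induction A rule: infinite_finite_induct)
  case (insert a A)
  then show ?case by (simp add: integ_add continuous_on_sum)
qed (simp_all add: integ_zero)

lemma integ_mono:
  fixes f g :: "(nat \<Rightarrow> real ^ 'n) \<Rightarrow> real"
  assumes "continuous_on (domain m) f" "continuous_on (domain m) g" "\<And>x. x \<in> domain m \<Longrightarrow> f x \<le> g x"
  shows "integ m f \<le> integ m g"
  unfolding integ_def
  using set_integral_mono[OF set_integrable_domain[OF assms(1)] set_integrable_domain[OF assms(2)] assms(3)]
  by (simp add: mult_left_mono)

lemma integ_cong:
  fixes f g :: "(nat \<Rightarrow> real ^ 'n) \<Rightarrow> real"
  assumes "\<And>x. x \<in> domain m \<Longrightarrow> f x = g x"
  shows "integ m f = integ m g"
  unfolding integ_def set_lebesgue_integral_def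
  by (intro arg_cong2[where f = "(*)"] refl Bochner_Integration.integral_cong) (auto simp: indicator_def
      assms)

lemma integ_const: "integ m (\<lambda>x :: nat \<Rightarrow> real ^ 'n. c) = c"
proof -
  have "measure (lborel_PiM m) (domain m :: (nat \<Rightarrow> real ^ 'n) set) = (1 / fact CARD('n)) ^ m"
    by (simp add: measure_def emeasure_domain)
  then show ?thesis
    by (simp add: integ_def set_integral_const domain_sets emeasure_domain power_one_over)
qed

lemma integ_abs_le:
  fixes f :: "(nat \<Rightarrow> real ^ 'n) \<Rightarrow> real"
  assumes "continuous_on (domain m) f" "\<And>x. x \<in> domain m \<Longrightarrow> \<bar>f x\<bar> \<le> B"
  shows "\<bar>integ m f\<bar> \<le> B"
proof -
  have "integ m f \<le> integ m (\<lambda>x :: nat \<Rightarrow> real ^ 'n. B)" "integ m (\<lambda>x :: nat \<Rightarrow> real ^ 'n. - B) \<le> integ m f"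
    using assms by (intro integ_mono; force simp: abs_le_iff)+
  then show ?thesis by (simp add: integ_const)
qed

lemma integ_prod:
  fixes p :: "nat \<Rightarrow> real ^ 'n \<Rightarrow> real"
  assumes "\<And>j. j \<in> {1..m} \<Longrightarrow> continuous_on Td (p j)"
  shows "integ m (\<lambda>x. \<Prod>j=1..m. p j (x j)) = (\<Prod>j=1..m. fact CARD('n) * (LINT y:Td|lborel. p j y))"
proof -
  have "(LINT x:domain m|lborel_PiM m. (\<Prod>j=1..m. p j (x j)))
      = (LINT x|lborel_PiM m. (\<Prod>j=1..m. indicator Td (x j) *\<^sub>R p j (x j)))"
    unfolding set_lebesgue_integral_def
  proof (rule Bochner_Integration.integral_cong[OF refl])
    fix x :: "nat \<Rightarrow> real ^ 'n" assume "x \<in> space (lborel_PiM m)"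
    then have "indicator (domain m) x = (\<Prod>j=1..m. indicator Td (x j) :: real)"
      by (auto simp: domain_def PiE_def space_PiM indicator_def Pi_def prod_zero_iff)
    then show "indicator (domain m) x *\<^sub>R (\<Prod>j=1..m. p j (x j)) = (\<Prod>j=1..m. indicator Td (x j) *\<^sub>R p j (x j))"
      by (simp add: prod.distrib)
  qed
  also have "\<dots> = (\<Prod>j=1..m. LINT y|lborel. indicator Td y *\<^sub>R p j y)"
  proof (rule lborel_product.product_integral_prod)
    fix j assume "j \<in> {1..m}"
    from borel_integrable_compact[OF compact_Td assms[OF this]]
    show "integrable lborel (\<lambda>y. indicator Td y *\<^sub>R p j y)"
      by (simp add: indicator_def if_distrib cong: if_cong)
  qed simp
  finally show ?thesis by (simp add: integ_def prod.distrib set_lebesgue_integral_def)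
qed

text \<open>By continuity the function would exceed a positive constant on a box around the point, and the part of
the box in the domain is a product of sets of positive measure.\<close>

lemma integ_nonneg_eq_0:
  fixes g :: "(nat \<Rightarrow> real ^ 'n) \<Rightarrow> real"
  assumes cont: "continuous_on (domain m) g" and nn: "\<And>x. x \<in> domain m \<Longrightarrow> g x \<ge> 0"
    and zero: "integ m g = 0" and x0: "x0 \<in> domain m"
  shows "g x0 = 0"
proof (rule ccontr)
  assume "g x0 \<noteq> 0"
  then have gx: "g x0 > 0" using nn[OF x0] by simp
  define \<delta> where "\<delta> = g x0 / 2"
  have "open {\<delta><..}" "g x0 \<in> {\<delta><..}" using gx by (auto simp: \<delta>_def)
  then obtain V where V: "open V" "x0 \<in> V" "\<And>y. y \<in> domain m \<Longrightarrow> y \<in> V \<Longrightarrow> g y > \<delta>"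
    using cont x0 unfolding continuous_on_topological by (metis greaterThan_iff)
  obtain X where X: "x0 \<in> PiE UNIV X" "\<And>i. open (X i)" "PiE UNIV X \<subseteq> V"
    using product_topology_open_contains_basis[of "\<lambda>_. euclidean" UNIV V x0] V
    by (auto simp: open_fun_def)
  define A where "A = PiE {1..m} (\<lambda>j. X j \<inter> Td)"
  have x0u: "x0 i = undefined" if "i \<notin> {1..m}" for i
    using x0 that unfolding domain_def by (rule PiE_arb)
  have AV: "A \<subseteq> domain m \<inter> V"
  proof
    fix y assume y: "y \<in> A"
    have "y i \<in> X i" for i
    proof (cases "i \<in> {1..m}")
      case True then show ?thesis using y by (auto simp: A_def PiE_def Pi_def)
    next
      case False
      then have "y i = x0 i" using y x0u[OF False] by (auto simp: A_def PiE_def extensional_def)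
      then show ?thesis using X(1) by auto
    qed
    then have "y \<in> PiE UNIV X" by auto
    moreover have "y \<in> domain m" using y by (auto simp: A_def domain_def PiE_def Pi_def)
    ultimately show "y \<in> domain m \<inter> V" using X(3) by auto
  qed
  have Asets: "A \<in> sets (lborel_PiM m)"
    unfolding A_def by (rule sets_PiM_I_finite) (use X in \<open>auto intro!: sets.Int simp: closed_Td\<close>)
  have "emeasure (lborel_PiM m) A = (\<Prod>j=1..m. emeasure lborel (X j \<inter> Td))"
    unfolding A_def
    by (rule lborel_product.emeasure_PiM) (use X in \<open>auto intro!: sets.Int simp: closed_Td\<close>)
  moreover have "emeasure lborel (X j \<inter> Td) > 0" if "j \<in> {1..m}" for j
    by (rule emeasure_Td_Int_open[where x = "x0 j"]) (use X x0 that in \<open>auto simp: domain_def PiE_def Pi_def\<close>)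
  ultimately have "emeasure (lborel_PiM m) A \<noteq> 0"
    by (simp add: prod_zero_iff) (metis atLeastAtMost_iff not_gr_zero)
  moreover have "emeasure (lborel_PiM m) A \<noteq> \<infinity>"
  proof -
    have "emeasure (lborel_PiM m) A \<le> emeasure (lborel_PiM m) (domain m :: (nat \<Rightarrow> real ^ 'n) set)"
      by (rule emeasure_mono) (use AV domain_sets in auto)
    also have "\<dots> < \<infinity>" by (simp add: emeasure_domain)
    finally show ?thesis by simp
  qed
  ultimately have Apos: "measure (lborel_PiM m) A > 0"
    by (simp add: measure_def enn2real_positive_iff less_top zero_less_iff_neq_zero)
  have "\<delta> * measure (lborel_PiM m) A = (LINT x:A|lborel_PiM m. \<delta>)"
    using Asets \<open>emeasure (lborel_PiM m) A \<noteq> \<infinity>\<close> by (subst set_integral_const) auto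
  also have "\<dots> \<le> (LINT x:domain m|lborel_PiM m. g x)"
    unfolding set_lebesgue_integral_def
  proof (rule integral_mono)
    show "integrable (lborel_PiM m) (\<lambda>x. indicator A x *\<^sub>R \<delta>)"
      using Asets \<open>emeasure (lborel_PiM m) A \<noteq> \<infinity>\<close> by (auto simp: less_top)
    show "integrable (lborel_PiM m) (\<lambda>x. indicator (domain m) x *\<^sub>R g x)"
      using set_integrable_domain[OF cont] by (simp add: set_integrable_def)
    show "indicator A x *\<^sub>R \<delta> \<le> indicator (domain m) x *\<^sub>R g x" for x
      using AV V(3)[of x] nn[of x] by (auto simp: indicator_def intro: less_imp_le)
  qed
  finally have "\<delta> * measure (lborel_PiM m) A \<le> 0"
    using zero by (simp add: integ_def)
  then show False using Apos gx by (simp add: \<delta>_def mult_le_0_iff)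
qed

text \<open>The averaging principle: \<open>integ\<close> is a mean, so a function cannot exceed its mean everywhere.\<close>

lemma exists_le_integ:
  fixes g :: "(nat \<Rightarrow> real ^ 'n) \<Rightarrow> real"
  assumes cont: "continuous_on (domain m) g"
  shows "\<exists>x\<in>domain m. g x \<le> integ m g"
proof -
  obtain x where x: "x \<in> domain m" "\<forall>y\<in>domain m. g x \<le> g y"
    using continuous_attains_inf[OF compact_domain domain_nonempty cont] by blast
  have "integ m (\<lambda>y :: nat \<Rightarrow> real ^ 'n. g x) \<le> integ m g"
    by (rule integ_mono) (use cont x in auto)
  then show ?thesis using x by (auto simp: integ_const)
qed

section \<open>Polynomials and orthonormal bases on the simplex\<close>

lemma finite_exponents: "finite {\<alpha> :: 'n::finite \<Rightarrow> nat. (\<Sum>i\<in>UNIV. \<alpha> i) \<le> l}"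
proof (rule finite_subset)
  show "{\<alpha> :: 'n \<Rightarrow> nat. (\<Sum>i\<in>UNIV. \<alpha> i) \<le> l} \<subseteq> PiE UNIV (\<lambda>_. {..l})"
  proof
    fix \<alpha> :: "'n \<Rightarrow> nat" assume "\<alpha> \<in> {\<alpha>. (\<Sum>i\<in>UNIV. \<alpha> i) \<le> l}"
    moreover have "\<alpha> i \<le> (\<Sum>i\<in>UNIV. \<alpha> i)" for i by (rule member_le_sum) auto
    ultimately show "\<alpha> \<in> PiE UNIV (\<lambda>_. {..l})" by (auto intro: order_trans)
  qed
qed (auto intro!: finite_PiE)

lemma poly_deg_leI:
  fixes f :: "real ^ 'n \<Rightarrow> real"
  assumes "f = (\<lambda>x. \<Sum>\<alpha> | (\<Sum>i\<in>UNIV. \<alpha> i) \<le> l. c \<alpha> * (\<Prod>i\<in>UNIV. (x $ i) ^ \<alpha> i))"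
  shows "f \<in> poly_deg_le l"
  unfolding poly_deg_le_def mem_Collect_eq by (rule exI[of _ c]) (rule assms)

lemma poly_deg_le_sum:
  fixes f :: "'i \<Rightarrow> real ^ 'n \<Rightarrow> real"
  assumes "\<And>i. i \<in> A \<Longrightarrow> f i \<in> poly_deg_le l"
  shows "(\<lambda>x. \<Sum>i\<in>A. f i x) \<in> poly_deg_le l"
proof -
  have "\<forall>i\<in>A. \<exists>c. f i = (\<lambda>x. \<Sum>\<alpha> | (\<Sum>i\<in>UNIV. \<alpha> i) \<le> l. c \<alpha> * (\<Prod>i\<in>UNIV. (x $ i) ^ \<alpha> i))"
    using assms unfolding poly_deg_le_def mem_Collect_eq by (rule ballI)
  then obtain c where c: "\<And>i. i \<in> A \<Longrightarrow>
      f i = (\<lambda>x. \<Sum>\<alpha> | (\<Sum>i\<in>UNIV. \<alpha> i) \<le> l. c i \<alpha> * (\<Prod>i\<in>UNIV. (x $ i) ^ \<alpha> i))"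
    unfolding bchoice_iff by blast
  have "(\<lambda>x. \<Sum>i\<in>A. f i x) = (\<lambda>x. \<Sum>\<alpha> | (\<Sum>i\<in>UNIV. \<alpha> i) \<le> l. (\<Sum>i\<in>A. c i \<alpha>) * (\<Prod>i\<in>UNIV. (x $ i) ^ \<alpha> i))"
  proof
    fix x
    have "(\<Sum>i\<in>A. f i x) = (\<Sum>i\<in>A. \<Sum>\<alpha> | (\<Sum>i\<in>UNIV. \<alpha> i) \<le> l. c i \<alpha> * (\<Prod>i\<in>UNIV. (x $ i) ^ \<alpha> i))"
      by (intro sum.cong refl) (simp only: c)
    also have "\<dots> = (\<Sum>\<alpha> | (\<Sum>i\<in>UNIV. \<alpha> i) \<le> l. \<Sum>i\<in>A. c i \<alpha> * (\<Prod>i\<in>UNIV. (x $ i) ^ \<alpha> i))"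
      by (rule sum.swap)
    finally show "(\<Sum>i\<in>A. f i x) = (\<Sum>\<alpha> | (\<Sum>i\<in>UNIV. \<alpha> i) \<le> l. (\<Sum>i\<in>A. c i \<alpha>) * (\<Prod>i\<in>UNIV. (x $ i) ^ \<alpha> i))"
      by (simp add: sum_distrib_right)
  qed
  then show ?thesis by (rule poly_deg_leI)
qed

lemma poly_deg_le_cmult:
  fixes f :: "real ^ 'n \<Rightarrow> real"
  assumes "f \<in> poly_deg_le l"
  shows "(\<lambda>x. a * f x) \<in> poly_deg_le l"
proof -
  obtain c where "f = (\<lambda>x. \<Sum>\<alpha> | (\<Sum>i\<in>UNIV. \<alpha> i) \<le> l. c \<alpha> * (\<Prod>i\<in>UNIV. (x $ i) ^ \<alpha> i))"
    using assms by (auto simp: poly_deg_le_def)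
  then have "(\<lambda>x. a * f x) = (\<lambda>x. \<Sum>\<alpha> | (\<Sum>i\<in>UNIV. \<alpha> i) \<le> l. (a * c \<alpha>) * (\<Prod>i\<in>UNIV. (x $ i) ^ \<alpha> i))"
    by (simp add: sum_distrib_left mult.assoc)
  then show ?thesis by (rule poly_deg_leI)
qed

lemma poly_deg_le_monom:
  fixes \<alpha> :: "'n::finite \<Rightarrow> nat"
  assumes "(\<Sum>i\<in>UNIV. \<alpha> i) \<le> l"
  shows "(\<lambda>x :: real ^ 'n. \<Prod>i\<in>UNIV. (x $ i) ^ \<alpha> i) \<in> poly_deg_le l"
proof -
  have "(\<lambda>x :: real ^ 'n. \<Prod>i\<in>UNIV. (x $ i) ^ \<alpha> i) =
     (\<lambda>x. \<Sum>\<beta> | (\<Sum>i\<in>UNIV. \<beta> i) \<le> l. (if \<beta> = \<alpha> then 1 else 0) * (\<Prod>i\<in>UNIV. (x $ i) ^ \<beta> i))"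
    using assms by (simp add: if_distrib[of "\<lambda>c. c * _"] sum.delta finite_exponents cong: if_cong)
  then show ?thesis by (rule poly_deg_leI)
qed

lemma poly_deg_le_mono:
  fixes f :: "real ^ 'n \<Rightarrow> real"
  assumes "f \<in> poly_deg_le l" "l \<le> l'"
  shows "f \<in> poly_deg_le l'"
proof -
  obtain c where c: "f = (\<lambda>x. \<Sum>\<alpha> | (\<Sum>i\<in>UNIV. \<alpha> i) \<le> l. c \<alpha> * (\<Prod>i\<in>UNIV. (x $ i) ^ \<alpha> i))"
    using assms by (auto simp: poly_deg_le_def)
  show ?thesis unfolding c
    by (intro poly_deg_le_sum poly_deg_le_cmult poly_deg_le_monom) (use assms in auto)
qed

lemma poly_deg_le_add:
  fixes f g :: "real ^ 'n \<Rightarrow> real"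
  assumes "f \<in> poly_deg_le l" "g \<in> poly_deg_le l"
  shows "(\<lambda>x. f x + g x) \<in> poly_deg_le l"
proof -
  have "(\<lambda>x. \<Sum>b\<in>{True, False}. (if b then f else g) x) \<in> poly_deg_le l"
    by (rule poly_deg_le_sum) (use assms in auto)
  then show ?thesis by simp
qed

lemma poly_deg_le_diff:
  fixes f g :: "real ^ 'n \<Rightarrow> real"
  assumes "f \<in> poly_deg_le l" "g \<in> poly_deg_le l"
  shows "(\<lambda>x. f x - g x) \<in> poly_deg_le l"
proof -
  have "(\<lambda>x. f x + (-1) * g x) \<in> poly_deg_le l"
    by (rule poly_deg_le_add[OF assms(1) poly_deg_le_cmult[OF assms(2)]])
  then show ?thesis by simp
qed

lemma poly_deg_le_mult:
  fixes f g :: "real ^ 'n \<Rightarrow> real"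
  assumes "f \<in> poly_deg_le l" "g \<in> poly_deg_le l'"
  shows "(\<lambda>x. f x * g x) \<in> poly_deg_le (l + l')"
proof -
  obtain c where c: "f = (\<lambda>x. \<Sum>\<alpha> | (\<Sum>i\<in>UNIV. \<alpha> i) \<le> l. c \<alpha> * (\<Prod>i\<in>UNIV. (x $ i) ^ \<alpha> i))"
    using assms by (auto simp: poly_deg_le_def)
  obtain c' where c': "g = (\<lambda>x. \<Sum>\<alpha> | (\<Sum>i\<in>UNIV. \<alpha> i) \<le> l'. c' \<alpha> * (\<Prod>i\<in>UNIV. (x $ i) ^ \<alpha> i))"
    using assms by (auto simp: poly_deg_le_def)
  have "(\<lambda>x. f x * g x) = (\<lambda>x. \<Sum>\<alpha> | (\<Sum>i\<in>UNIV. \<alpha> i) \<le> l. \<Sum>\<beta> | (\<Sum>i\<in>UNIV. \<beta> i) \<le> l'.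
      (c \<alpha> * c' \<beta>) * (\<Prod>i\<in>UNIV. (x $ i) ^ (\<alpha> i + \<beta> i)))"
    unfolding c c' sum_product by (simp add: power_add prod.distrib mult_ac)
  also have "\<dots> \<in> poly_deg_le (l + l')"
    by (intro poly_deg_le_sum poly_deg_le_cmult poly_deg_le_monom)
       (auto simp: sum.distrib intro: add_mono)
  finally show ?thesis .
qed

lemma poly_deg_le_const: "(\<lambda>x :: real ^ 'n. c) \<in> poly_deg_le l"
  using poly_deg_le_cmult[OF poly_deg_le_monom[of "\<lambda>_. 0" l], of c] by simp

lemma poly_deg_le_coord: "(\<lambda>x :: real ^ 'n. x $ i) \<in> poly_deg_le 1"
proof -
  have "(\<lambda>x :: real ^ 'n. x $ i) = (\<lambda>x. \<Prod>k\<in>UNIV. (x $ k) ^ (if k = i then 1 else 0))"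
    by (simp add: if_distrib[of "\<lambda>e. _ ^ e"] prod.delta cong: if_cong)
  also have "\<dots> \<in> poly_deg_le 1" by (rule poly_deg_le_monom) (simp add: sum.delta)
  finally show ?thesis .
qed

lemma poly_deg_le_continuous:
  fixes f :: "real ^ 'n \<Rightarrow> real"
  assumes "f \<in> poly_deg_le l"
  shows "continuous_on A f"
  using assms by (auto simp: poly_deg_le_def intro!: continuous_intros)

lemma set_integrable_Td:
  fixes f :: "real ^ 'n \<Rightarrow> real"
  assumes "continuous_on Td f"
  shows "set_integrable lborel Td f"
  using borel_integrable_compact[OF compact_Td assms]
  by (simp add: set_integrable_def indicator_def if_distrib cong: if_cong)

lemma ip_commute: "ip f g = ip g f"
  by (simp add: ip_def mult.commute)

lemma ip_sum_right:
  fixes f :: "real ^ 'n \<Rightarrow> real"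
  assumes "continuous_on Td f" "\<And>i. i \<in> A \<Longrightarrow> continuous_on Td (g i)"
  shows "ip f (\<lambda>x. \<Sum>i\<in>A. g i x) = (\<Sum>i\<in>A. ip f (g i))"
proof (cases "finite A")
  case True
  have "integrable lborel (\<lambda>x. indicator Td x *\<^sub>R (f x * g i x))" if "i \<in> A" for i
    using set_integrable_Td[OF continuous_on_mult[OF assms(1) assms(2)[OF that]]]
    by (simp add: set_integrable_def)
  then have "(LINT x:Td|lborel. (\<Sum>i\<in>A. f x * g i x)) = (\<Sum>i\<in>A. LINT x:Td|lborel. f x * g i x)"
    unfolding set_lebesgue_integral_def scaleR_sum_right by (rule Bochner_Integration.integral_sum)
  then show ?thesis by (simp add: ip_def sum_distrib_left)
qed (simp add: ip_def set_lebesgue_integral_def)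

lemma ip_cmult_right: "ip f (\<lambda>x. c * g x) = c * ip f g"
  by (simp add: ip_def mult.left_commute[of _ c])

lemma ip_diff_right:
  fixes f g h :: "real ^ 'n \<Rightarrow> real"
  assumes "continuous_on Td f" "continuous_on Td g" "continuous_on Td h"
  shows "ip f (\<lambda>x. g x - h x) = ip f g - ip f h"
proof -
  have "(LINT x:Td|lborel. f x * g x - f x * h x)
      = (LINT x:Td|lborel. f x * g x) - (LINT x:Td|lborel. f x * h x)"
    using assms by (intro set_integral_diff set_integrable_Td continuous_intros)
  then show ?thesis by (simp add: ip_def right_diff_distrib)
qed

text \<open>Multi-degrees with all entries at most \<open>L\<close>; they exhaust the index set of all multi-degrees by finite
product sets.\<close>

definition degs :: "nat \<Rightarrow> nat \<Rightarrow> (nat \<Rightarrow> nat) set" where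
  "degs m L = PiE {1..m} (\<lambda>_. {..L})"

definition basis_idx :: "nat \<Rightarrow> nat \<Rightarrow> (nat \<Rightarrow> nat) \<Rightarrow> (nat \<Rightarrow> nat) set" where
  "basis_idx d m l = PiE {1..m} (\<lambda>j. {1..rdim d (l j)})"

abbreviation alldegs :: "nat \<Rightarrow> (nat \<Rightarrow> nat) set" where
  "alldegs m \<equiv> PiE {1..m} (\<lambda>_. UNIV)"

lemma multi_idx_eq: "multi_idx d m = Sigma (alldegs m) (basis_idx d m)"
  unfolding multi_idx_def by (intro Sigma_cong) (simp_all add: basis_idx_def)

lemma finite_degs [simp, intro]: "finite (degs m L)"
  by (auto simp: degs_def intro!: finite_PiE)

lemma finite_basis_idx [simp, intro]: "finite (basis_idx d m l)"
  by (auto simp: basis_idx_def intro!: finite_PiE)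

lemma degs_subset: "degs m L \<subseteq> alldegs m"
  by (auto simp: degs_def PiE_def)

lemma finite_alldegs_subset_degs:
  assumes "finite G" "G \<subseteq> alldegs m"
  shows "\<exists>L. G \<subseteq> degs m L"
proof -
  define L where "L = Max (insert 0 ((\<lambda>(l, j). l j) ` (G \<times> {1..m})))"
  have "l j \<le> L" if "l \<in> G" "j \<in> {1..m}" for l j
    unfolding L_def using that assms(1) by (intro Max_ge) force+
  then show ?thesis using assms(2) by (intro exI[of _ L]) (auto simp: degs_def PiE_def Pi_def subset_iff)
qed

text \<open>Distributivity, separately for the basis indices here and for the degrees next; together they
factor sums over multi-indices of products of one-dimensional terms.\<close>

lemma sum_basis_idx_prod:
  fixes w :: "nat \<Rightarrow> nat \<Rightarrow> 'a::comm_semiring_1"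
  shows "(\<Sum>k\<in>basis_idx d m l. \<Prod>j=1..m. w j (k j)) = (\<Prod>j=1..m. \<Sum>k=1..rdim d (l j). w j k)"
  unfolding basis_idx_def by (rule prod_sum_PiE[symmetric]) auto

lemma sum_degs_prod:
  fixes w :: "nat \<Rightarrow> nat \<Rightarrow> 'a::comm_semiring_1"
  shows "(\<Sum>l\<in>degs m L. \<Prod>j=1..m. w j (l j)) = (\<Prod>j=1..m. \<Sum>l\<le>L. w j l)"
  unfolding degs_def by (rule prod_sum_PiE[symmetric]) auto

lemma sum_degs_basis_idx_prod:
  fixes w :: "nat \<Rightarrow> nat \<Rightarrow> nat \<Rightarrow> 'a::comm_semiring_1"
  shows "(\<Sum>l\<in>degs m L. \<Sum>k\<in>basis_idx d m l. \<Prod>j=1..m. w j (l j) (k j)) =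
     (\<Prod>j=1..m. \<Sum>l\<le>L. \<Sum>k=1..rdim d l. w j l k)"
proof -
  have "(\<Sum>l\<in>degs m L. \<Sum>k\<in>basis_idx d m l. \<Prod>j=1..m. w j (l j) (k j)) =
      (\<Sum>l\<in>degs m L. \<Prod>j=1..m. \<Sum>k=1..rdim d (l j). w j (l j) k)"
    by (intro sum.cong refl sum_basis_idx_prod)
  also have "\<dots> = (\<Prod>j=1..m. \<Sum>l\<le>L. \<Sum>k=1..rdim d l. w j l k)"
    by (rule sum_degs_prod)
  finally show ?thesis .
qed

locale simplex_basis =
  fixes P :: "nat \<Rightarrow> nat \<Rightarrow> real ^ 'n \<Rightarrow> real"
  assumes basis: "orthonormal_bases P"
begin

lemma P_orth_space: "k \<in> {1..rdim CARD('n) l} \<Longrightarrow> P l k \<in> orth_poly_space l"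
  using basis by (auto simp: orthonormal_bases_def)

lemma P_poly: "k \<in> {1..rdim CARD('n) l} \<Longrightarrow> P l k \<in> poly_deg_le l"
  using P_orth_space by (auto simp: orth_poly_space_def)

lemma P_cont: "k \<in> {1..rdim CARD('n) l} \<Longrightarrow> continuous_on A (P l k)"
  using P_poly poly_deg_le_continuous by blast

lemma P_0_1: "P 0 1 = (\<lambda>x. 1)"
  using basis by (auto simp: orthonormal_bases_def)

lemma rdim_0: "rdim CARD('n) 0 = 1"
  by (simp add: rdim_def)

lemma ip_P_P:
  assumes "k \<in> {1..rdim CARD('n) l}" "k' \<in> {1..rdim CARD('n) l'}"
  shows "ip (P l k) (P l' k') = (if l = l' \<and> k = k' then 1 else 0)"
proof (cases l l' rule: linorder_cases)
  case less
  then have "ip (P l' k') (P l k) = 0"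
    using P_orth_space[OF assms(2)] P_poly[OF assms(1)] by (auto simp: orth_poly_space_def)
  then show ?thesis using less by (simp add: ip_commute)
next
  case equal
  then show ?thesis using assms basis by (auto simp: orthonormal_bases_def)
next
  case greater
  then have "ip (P l k) (P l' k') = 0"
    using P_orth_space[OF assms(1)] P_poly[OF assms(2)] by (auto simp: orth_poly_space_def)
  then show ?thesis using greater by simp
qed

lemmas orth_poly_space_P_expansion =
  basis[unfolded orthonormal_bases_def, THEN conjunct1, THEN spec, THEN conjunct2, THEN conjunct2, THEN bspec]

text \<open>Subtracting the projection onto the lower degrees (known, by induction, to contain all lower-degree
polynomials) leaves an element of \<open>orth_poly_space L\<close>, which is spanned by the basis elements of
degree \<open>L\<close>.\<close>

lemma poly_deg_le_P_expansion:
  assumes "f \<in> poly_deg_le L"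
  shows "\<exists>c. f = (\<lambda>x. \<Sum>l\<le>L. \<Sum>k=1..rdim CARD('n) l. c l k * P l k x)"
  using assms
proof (induction L arbitrary: f rule: less_induct)
  case (less L)
  \<comment> \<open>The orthogonal projection of \<open>f\<close> onto the degrees below \<open>L\<close>.\<close>
  define h where "h = (\<lambda>x. \<Sum>l<L. \<Sum>k=1..rdim CARD('n) l. ip (P l k) f * P l k x)"
  have fc: "continuous_on A f" for A using less.prems by (rule poly_deg_le_continuous)
  have hpoly: "h \<in> poly_deg_le L"
    unfolding h_def by (intro poly_deg_le_sum poly_deg_le_cmult poly_deg_le_mono[OF P_poly]) auto
  have hc: "continuous_on A h" for A using hpoly by (rule poly_deg_le_continuous)
  have ip_h: "ip (P l k) h = ip (P l k) f" if "l < L" "k \<in> {1..rdim CARD('n) l}" for l k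
  proof -
    have "ip (P l k) h = (\<Sum>l'<L. \<Sum>k'=1..rdim CARD('n) l'. ip (P l' k') f * ip (P l k) (P l' k'))"
    proof -
      have "ip (P l k) h = (\<Sum>l'<L. ip (P l k) (\<lambda>x. \<Sum>k'=1..rdim CARD('n) l'. ip (P l' k') f * P l' k' x))"
        unfolding h_def
        by (rule ip_sum_right) (intro continuous_on_sum continuous_on_mult continuous_on_const P_cont
            that(2))+
      also have "\<dots> = (\<Sum>l'<L. \<Sum>k'=1..rdim CARD('n) l'. ip (P l k) (\<lambda>x. ip (P l' k') f * P l' k' x))"
        by (rule sum.cong[OF refl], rule ip_sum_right) (intro continuous_on_mult continuous_on_const
            P_cont that(2))+
      finally show ?thesis by (simp only: ip_cmult_right)
    qed
    also have "\<dots> = (\<Sum>l'<L. \<Sum>k'=1..rdim CARD('n) l'. if l' = l \<and> k' = k then ip (P l k) f else 0)"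
      using that by (intro sum.cong refl) (auto simp: ip_P_P)
    also have "\<dots> = (\<Sum>l'<L. if l' = l then ip (P l k) f else 0)"
      using that by (intro sum.cong refl) auto
    also have "\<dots> = ip (P l k) f" using that by simp
    finally show ?thesis .
  qed
  have "(\<lambda>x. f x - h x) \<in> orth_poly_space L"
    unfolding orth_poly_space_def
  proof (intro CollectI conjI allI impI ballI)
    show "(\<lambda>x. f x - h x) \<in> poly_deg_le L" by (rule poly_deg_le_diff[OF less.prems hpoly])
    fix l' and g :: "real ^ 'n \<Rightarrow> real" assume l': "l' < L" and gl: "g \<in> poly_deg_le l'"
    from less.IH[OF l' gl] obtain c where g: "g
        = (\<lambda>x. \<Sum>l\<le>l'. \<Sum>k=1..rdim CARD('n) l. c l k * P l k x)" by blast
    have *: "ip (\<lambda>x. f x - h x) (P l k) = 0" if "l \<le> l'" "k \<in> {1..rdim CARD('n) l}" for l k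
      using that l' ip_h[of l k] fc hc P_cont[OF that(2)]
      by (subst ip_commute) (simp add: ip_diff_right)
    then show "ip (\<lambda>x. f x - h x) g = 0"
    proof -
      have dc: "continuous_on Td (\<lambda>x. f x - h x)" by (intro continuous_on_diff fc hc)
      have "ip (\<lambda>x. f x - h x) g = (\<Sum>l\<le>l'. ip (\<lambda>x. f x - h x) (\<lambda>x. \<Sum>k=1..rdim CARD('n) l. c l k * P l k x))"
        unfolding g
        by (rule ip_sum_right[OF dc]) (intro continuous_on_sum continuous_on_mult continuous_on_const P_cont)
      also have "\<dots> = (\<Sum>l\<le>l'. \<Sum>k=1..rdim CARD('n) l. ip (\<lambda>x. f x - h x) (\<lambda>x. c l k * P l k x))"
        by (rule sum.cong[OF refl], rule ip_sum_right[OF dc]) (intro continuous_on_mult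
            continuous_on_const P_cont)
      also have "\<dots> = 0"
        using * by (intro sum.neutral ballI) (simp add: ip_cmult_right)
      finally show ?thesis .
    qed
  qed
  then obtain c where c: "(\<lambda>x. f x - h x) = (\<lambda>x. \<Sum>k=1..rdim CARD('n) L. c k * P L k x)"
    using orth_poly_space_P_expansion by blast
  have "f x = h x + (f x - h x)" for x by simp
  also have "h x + (f x - h x) = (\<Sum>l\<le>L. \<Sum>k=1..rdim CARD('n) l. (if l < L then ip (P l k) f else c k)
      * P l k x)" for x
    using fun_cong[OF c, of x] unfolding h_def
    by (simp add: lessThan_Suc_atMost[symmetric])
  finally have "f = (\<lambda>x. \<Sum>l\<le>L. \<Sum>k=1..rdim CARD('n) l. (if l < L then ip (P l k) f else c k) * P l k x)"
    by (rule ext)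
  then show ?case by (rule exI[of _ "\<lambda>l k. if l < L then ip (P l k) f else c k"])
qed

definition phi :: "nat \<Rightarrow> (nat \<Rightarrow> nat) \<Rightarrow> (nat \<Rightarrow> nat) \<Rightarrow> (nat \<Rightarrow> real ^ 'n) \<Rightarrow> real" where
  "phi m l k x = (\<Prod>j=1..m. P (l j) (k j) (x j))"

lemma acoef_eq: "acoef P m (l, k) f = integ m (\<lambda>x. f x * phi m l k x)"
  by (simp add: acoef_def integ_def phi_def)

lemma basis_idx_memD: "k \<in> basis_idx d m l \<Longrightarrow> j \<in> {1..m} \<Longrightarrow> k j \<in> {1..rdim d (l j)}"
  by (auto simp: basis_idx_def PiE_def Pi_def)

lemma continuous_on_coord: "continuous_on A (\<lambda>x :: nat \<Rightarrow> real ^ 'n. x j)"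
  by (rule continuous_on_subset[OF continuous_on_product_coordinates]) simp

lemma continuous_on_coord_comp:
  assumes "\<And>A. continuous_on A (p :: real ^ 'n \<Rightarrow> real)"
  shows "continuous_on B (\<lambda>x :: nat \<Rightarrow> real ^ 'n. p (x j))"
  by (rule continuous_on_compose2[OF assms[of UNIV] continuous_on_coord[of B j]]) simp

lemma phi_cont:
  assumes "k \<in> basis_idx CARD('n) m l"
  shows "continuous_on A (phi m l k)"
  unfolding phi_def
  by (rule continuous_on_prod, rule continuous_on_coord_comp, rule P_cont, rule basis_idx_memD[OF assms])

lemma integ_phi_phi:
  assumes l: "l \<in> alldegs m" "l' \<in> alldegs m"
      and k: "k \<in> basis_idx CARD('n) m l" "k' \<in> basis_idx CARD('n) m l'"
  shows "integ m (\<lambda>x. phi m l k x * phi m l' k' x) = (if l = l' \<and> k = k' then 1 else 0)"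
proof -
  have "integ m (\<lambda>x. phi m l k x * phi m l' k' x) =
      integ m (\<lambda>x. \<Prod>j=1..m. P (l j) (k j) (x j) * P (l' j) (k' j) (x j))"
    by (simp add: phi_def prod.distrib)
  also have "\<dots> = (\<Prod>j=1..m. ip (P (l j) (k j)) (P (l' j) (k' j)))"
    unfolding ip_def
    by (rule integ_prod, rule continuous_on_mult) (rule P_cont, erule basis_idx_memD[OF k(1)], rule
        P_cont, erule basis_idx_memD[OF k(2)])
  also have "\<dots> = (\<Prod>j=1..m. if l j = l' j \<and> k j = k' j then 1 else 0)"
    by (intro prod.cong refl ip_P_P basis_idx_memD[OF k(1)] basis_idx_memD[OF k(2)])
  also have "\<dots> = (if l = l' \<and> k = k' then 1 else 0)"
  proof (cases "l = l' \<and> k = k'")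
    case False
    have "\<exists>j\<in>{1..m}. l j \<noteq> l' j \<or> k j \<noteq> k' j"
    proof (rule ccontr)
      assume "\<not> ?thesis"
      then have eq: "l j = l' j" "k j = k' j" if "j \<in> {1..m}" for j using that by auto
      have "l = l'" by (rule PiE_ext[OF l]) (rule eq)
      moreover have "k = k'"
        by (rule PiE_ext[OF k(1)[unfolded basis_idx_def] k(2)[folded \<open>l
            = l'\<close>, unfolded basis_idx_def]]) (rule eq)
      ultimately show False using False by simp
    qed
    then have "(\<Prod>j=1..m. if l j = l' j \<and> k j = k' j then 1 else 0 :: real) = 0"
      by (auto simp: prod_zero_iff)
    then show ?thesis using False by auto
  qed auto
  finally show ?thesis .
qed

definition span_phi :: "nat \<Rightarrow> nat \<Rightarrow> ((nat \<Rightarrow> real ^ 'n) \<Rightarrow> real) set" where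
  "span_phi m L = {f. \<exists>c. f = (\<lambda>x. \<Sum>l\<in>degs m L. \<Sum>k\<in>basis_idx CARD('n) m l. c l k * phi m l k x)}"

lemma span_phiI:
  assumes "f = (\<lambda>x. \<Sum>l\<in>degs m L. \<Sum>k\<in>basis_idx CARD('n) m l. c l k * phi m l k x)"
  shows "f \<in> span_phi m L"
  unfolding span_phi_def mem_Collect_eq by (rule exI[of _ c]) (rule assms)

lemma prod_poly_in_span_phi:
  assumes "\<And>j. j \<in> {1..m} \<Longrightarrow> p j \<in> poly_deg_le L"
  shows "(\<lambda>x. \<Prod>j=1..m. p j (x j)) \<in> span_phi m L"
proof -
  have "\<forall>j\<in>{1..m}. \<exists>c. p j = (\<lambda>x. \<Sum>l\<le>L. \<Sum>k=1..rdim CARD('n) l. c l k * P l k x)"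
    by (intro ballI poly_deg_le_P_expansion assms)
  then obtain c where c: "\<And>j. j \<in> {1..m} \<Longrightarrow> p j = (\<lambda>x. \<Sum>l\<le>L. \<Sum>k=1..rdim CARD('n) l. c j l k * P l k x)"
    unfolding bchoice_iff by blast
  have "(\<lambda>x. \<Prod>j=1..m. p j (x j)) =
      (\<lambda>x. \<Prod>j=1..m. \<Sum>l\<le>L. \<Sum>k=1..rdim CARD('n) l. c j l k * P l k (x j))"
    by (intro ext prod.cong refl) (simp only: c)
  also have "\<dots> = (\<lambda>x. \<Sum>l\<in>degs m L. \<Sum>k\<in>basis_idx CARD('n) m l. (\<Prod>j=1..m. c j (l j) (k j)) * phi m l k x)"
    by (subst sum_degs_basis_idx_prod[symmetric]) (simp add: phi_def prod.distrib)
  finally show ?thesis by (rule span_phiI)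
qed

lemma span_phi_sum:
  assumes "\<And>i. i \<in> A \<Longrightarrow> f i \<in> span_phi m L"
  shows "(\<lambda>x. \<Sum>i\<in>A. f i x) \<in> span_phi m L"
proof -
  have "\<forall>i\<in>A. \<exists>c. f i = (\<lambda>x. \<Sum>l\<in>degs m L. \<Sum>k\<in>basis_idx CARD('n) m l. c l k * phi m l k x)"
    using assms unfolding span_phi_def mem_Collect_eq by (rule ballI)
  then obtain c where c: "\<And>i. i \<in> A \<Longrightarrow> f i
      = (\<lambda>x. \<Sum>l\<in>degs m L. \<Sum>k\<in>basis_idx CARD('n) m l. c i l k * phi m l k x)"
    unfolding bchoice_iff by blast
  have "(\<lambda>x. \<Sum>i\<in>A. f i x) = (\<lambda>x. \<Sum>i\<in>A. \<Sum>l\<in>degs m L. \<Sum>k\<in>basis_idx CARD('n) m l. c i l k * phi m l k x)"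
    by (intro ext sum.cong refl) (simp only: c)
  also have "\<dots> = (\<lambda>x. \<Sum>l\<in>degs m L. \<Sum>k\<in>basis_idx CARD('n) m l. (\<Sum>i\<in>A. c i l k) * phi m l k x)"
  proof
    fix x
    have "(\<Sum>i\<in>A. \<Sum>l\<in>degs m L. \<Sum>k\<in>basis_idx CARD('n) m l. c i l k * phi m l k x)
        = (\<Sum>l\<in>degs m L. \<Sum>i\<in>A. \<Sum>k\<in>basis_idx CARD('n) m l. c i l k * phi m l k x)"
      by (rule sum.swap)
    also have "\<dots> = (\<Sum>l\<in>degs m L. \<Sum>k\<in>basis_idx CARD('n) m l. \<Sum>i\<in>A. c i l k * phi m l k x)"
      by (intro sum.cong refl sum.swap)
    finally show "(\<Sum>i\<in>A. \<Sum>l\<in>degs m L. \<Sum>k\<in>basis_idx CARD('n) m l. c i l k * phi m l k x) =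
       (\<Sum>l\<in>degs m L. \<Sum>k\<in>basis_idx CARD('n) m l. (\<Sum>i\<in>A. c i l k) * phi m l k x)"
      by (simp add: sum_distrib_right)
  qed
  finally show ?thesis by (rule span_phiI)
qed

lemma span_phi_cmult:
  assumes "f \<in> span_phi m L"
  shows "(\<lambda>x. a * f x) \<in> span_phi m L"
proof -
  obtain c where "f = (\<lambda>x. \<Sum>l\<in>degs m L. \<Sum>k\<in>basis_idx CARD('n) m l. c l k * phi m l k x)"
    using assms by (auto simp: span_phi_def)
  then have "(\<lambda>x. a * f x) = (\<lambda>x. \<Sum>l\<in>degs m L. \<Sum>k\<in>basis_idx CARD('n) m l. (a * c l k) * phi m l k x)"
    by (simp add: sum_distrib_left mult.assoc)
  then show ?thesis by (rule span_phiI)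
qed

lemma phi_in_span_phi:
  assumes "l \<in> degs m L" "k \<in> basis_idx CARD('n) m l" "L \<le> L'"
  shows "phi m l k \<in> span_phi m L'"
proof -
  have "phi m l k = (\<lambda>x. \<Prod>j=1..m. P (l j) (k j) (x j))" by (simp add: fun_eq_iff phi_def)
  also have "\<dots> \<in> span_phi m L'"
  proof (rule prod_poly_in_span_phi)
    fix j assume j: "j \<in> {1..m}"
    then have "l j \<le> L" using assms by (auto simp: degs_def PiE_def Pi_def)
    then show "P (l j) (k j) \<in> poly_deg_le L'"
      using poly_deg_le_mono[OF P_poly[OF basis_idx_memD[OF assms(2) j]], of L'] assms(3) by simp
  qed
  finally show ?thesis .
qed

lemma span_phi_mono:
  assumes "f \<in> span_phi m L" "L \<le> L'"
  shows "f \<in> span_phi m L'"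
proof -
  obtain c where c: "f = (\<lambda>x. \<Sum>l\<in>degs m L. \<Sum>k\<in>basis_idx CARD('n) m l. c l k * phi m l k x)"
    using assms by (auto simp: span_phi_def)
  show ?thesis unfolding c
    by (intro span_phi_sum span_phi_cmult phi_in_span_phi) (use assms in auto)
qed

lemma span_phi_cont: "f \<in> span_phi m L \<Longrightarrow> continuous_on A f"
  by (auto simp: span_phi_def intro!: continuous_intros phi_cont)

lemma span_phi_mult:
  assumes "f \<in> span_phi m L" "g \<in> span_phi m L'"
  shows "(\<lambda>x. f x * g x) \<in> span_phi m (L + L')"
proof -
  obtain c where c: "f = (\<lambda>x. \<Sum>l\<in>degs m L. \<Sum>k\<in>basis_idx CARD('n) m l. c l k * phi m l k x)"
    using assms by (auto simp: span_phi_def)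
  obtain c' where c': "g = (\<lambda>x. \<Sum>l\<in>degs m L'. \<Sum>k\<in>basis_idx CARD('n) m l. c' l k * phi m l k x)"
    using assms by (auto simp: span_phi_def)
  have pp: "(\<lambda>x. phi m l k x * phi m l' k' x) \<in> span_phi m (L + L')"
    if "l \<in> degs m L" "k \<in> basis_idx CARD('n) m l" "l' \<in> degs m L'" "k' \<in> basis_idx CARD('n) m l'" for l k
        l' k'
  proof -
    have "(\<lambda>x. \<Prod>j=1..m. P (l j) (k j) (x j) * P (l' j) (k' j) (x j)) \<in> span_phi m (L + L')"
    proof (rule prod_poly_in_span_phi)
      fix j assume j: "j \<in> {1..m}"
      have "l j + l' j \<le> L + L'" using that j by (auto simp: degs_def PiE_def Pi_def intro: add_mono)
      with poly_deg_le_mult[OF P_poly[OF basis_idx_memD[OF that(2) j]] P_poly[OF basis_idx_memD[OF that(4)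
          j]]]
      show "(\<lambda>x. P (l j) (k j) x * P (l' j) (k' j) x) \<in> poly_deg_le (L + L')"
        by (rule poly_deg_le_mono)
    qed
    then show ?thesis by (simp add: phi_def prod.distrib)
  qed
  have "(\<lambda>x. f x * g x) = (\<lambda>x. \<Sum>l\<in>degs m L. \<Sum>k\<in>basis_idx CARD('n) m l. c l k * phi m l k x * g x)"
    by (simp add: c sum_distrib_right)
  also have "\<dots> = (\<lambda>x. \<Sum>l\<in>degs m L. \<Sum>k\<in>basis_idx CARD('n) m l. c l k *
      (\<Sum>l'\<in>degs m L'. \<Sum>k'\<in>basis_idx CARD('n) m l'. c' l' k' * (phi m l k x * phi m l' k' x)))"
    by (intro ext sum.cong refl) (simp add: c' sum_distrib_left mult_ac)
  also have "\<dots> \<in> span_phi m (L + L')"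
    by (intro span_phi_sum span_phi_cmult pp)
  finally show ?thesis .
qed

lemma span_phi_const: "(\<lambda>x. c) \<in> span_phi m L"
proof -
  have "(\<lambda>x. \<Prod>j=1..m. (\<lambda>_. 1) (x j)) \<in> span_phi m L"
    by (rule prod_poly_in_span_phi) (rule poly_deg_le_const)
  from span_phi_cmult[OF this, of c] show ?thesis by simp
qed

lemma span_phi_coord:
  assumes "j0 \<in> {1..m}"
  shows "(\<lambda>x. x j0 $ i) \<in> span_phi m 1"
proof -
  have "(\<lambda>x. \<Prod>j=1..m. (\<lambda>y. if j = j0 then y $ i else 1) (x j)) \<in> span_phi m 1"
  proof (rule prod_poly_in_span_phi)
    show "(\<lambda>y. if j = j0 then y $ i else 1) \<in> poly_deg_le 1" for j
      by (cases "j = j0") (simp_all add: poly_deg_le_const poly_deg_le_coord)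
  qed
  then show ?thesis using assms by (simp add: prod.delta)
qed

text \<open>Products of basis elements span an algebra of functions that contains the coordinates and hence
separates points.\<close>

lemma span_phi_dense:
  fixes f :: "(nat \<Rightarrow> real ^ 'n) \<Rightarrow> real"
  assumes "continuous_on (domain m) f" "e > 0"
  shows "\<exists>L. \<exists>g\<in>span_phi m L. \<forall>x\<in>domain m. \<bar>f x - g x\<bar> < e"
proof -
  interpret function_ring_on "\<Union>L. span_phi m L" "domain m"
  proof
    show "compact (domain m :: (nat \<Rightarrow> real ^ 'n) set)" by (rule compact_domain)
    show "continuous_on (domain m) f" if "f \<in> (\<Union>L. span_phi m L)" for f
      using that span_phi_cont by auto
    show "(\<lambda>x. f x + g x) \<in> (\<Union>L. span_phi m L)"
      if f: "f \<in> (\<Union>L. span_phi m L)" and g: "g \<in> (\<Union>L. span_phi m L)" for f g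
    proof -
      obtain L L' where "f \<in> span_phi m L" "g \<in> span_phi m L'" using f g by auto
      then have "f \<in> span_phi m (max L L')" "g \<in> span_phi m (max L L')"
        by (auto intro: span_phi_mono)
      then have "(\<lambda>x. \<Sum>b\<in>{True, False}. (if b then f else g) x) \<in> span_phi m (max L L')"
        by (intro span_phi_sum) auto
      then show ?thesis by auto
    qed
    show "(\<lambda>x. f x * g x) \<in> (\<Union>L. span_phi m L)"
      if f: "f \<in> (\<Union>L. span_phi m L)" and g: "g \<in> (\<Union>L. span_phi m L)" for f g
    proof -
      obtain L L' where "f \<in> span_phi m L" "g \<in> span_phi m L'" using f g by auto
      from span_phi_mult[OF this] show ?thesis by blast
    qed
    show "(\<lambda>_. c) \<in> (\<Union>L. span_phi m L)" for c using span_phi_const by blast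
    show "\<exists>f\<in>\<Union>L. span_phi m L. f x \<noteq> f y"
      if x: "x \<in> domain m" and y: "y \<in> domain m" and "x \<noteq> y" for x y :: "nat \<Rightarrow> real ^ 'n"
    proof -
      have "\<exists>j\<in>{1..m}. x j \<noteq> y j"
      proof (rule ccontr)
        assume "\<not> ?thesis"
        then have "x = y" by (intro PiE_ext[OF x[unfolded domain_def] y[unfolded domain_def]]) auto
        then show False using \<open>x \<noteq> y\<close> by simp
      qed
      then obtain j where j: "j \<in> {1..m}" "x j \<noteq> y j" by blast
      then obtain i where i: "x j $ i \<noteq> y j $ i" by (auto simp: vec_eq_iff)
      show ?thesis
        by (rule bexI[of _ "\<lambda>x. x j $ i"]) (use i span_phi_coord[OF j(1), of i] in blast)+
    qed
  qed
  from Stone_Weierstrass_basic[OF assms] show ?thesis by auto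
qed

text \<open>Approximating \<open>h\<close> by \<open>g\<close> in the span gives \<open>\<integral>h\<^sup>2 = \<integral>h(h - g)\<close>, which is as small as desired.\<close>

lemma continuous_zero_if_orthogonal:
  assumes cont: "continuous_on (domain m) h"
    and orth: "\<And>l k. l \<in> alldegs m \<Longrightarrow> k \<in> basis_idx CARD('n) m l \<Longrightarrow> integ m (\<lambda>x. h x * phi m l k x) = 0"
    and x: "x \<in> domain m"
  shows "h x = 0"
proof -
  have "integ m (\<lambda>x. h x ^ 2) \<le> e * B" if e: "e > 0" and B: "B \<ge> 0" "\<And>x. x \<in> domain m \<Longrightarrow> \<bar>h x\<bar> \<le> B" for e B
  proof -
    obtain L g where g: "g \<in> span_phi m L" "\<forall>x\<in>domain m. \<bar>h x - g x\<bar> < e"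
      using span_phi_dense[OF cont e] by blast
    have gc: "continuous_on (domain m) g" using g span_phi_cont by blast
    obtain c where c: "g = (\<lambda>x. \<Sum>l\<in>degs m L. \<Sum>k\<in>basis_idx CARD('n) m l. c l k * phi m l k x)"
      using g by (auto simp: span_phi_def)
    have "integ m (\<lambda>x. h x * g x)
        = integ m (\<lambda>x. \<Sum>l\<in>degs m L. \<Sum>k\<in>basis_idx CARD('n) m l. c l k * (h x * phi m l k x))"
      by (simp add: c sum_distrib_left mult_ac)
    also have "\<dots> = (\<Sum>l\<in>degs m L. \<Sum>k\<in>basis_idx CARD('n) m l. c l k * integ m (\<lambda>x. h x * phi m l k x))"
      by (simp add: integ_sum integ_cmult cont phi_cont continuous_on_sum continuous_on_mult)
    also have "\<dots> = 0"
      using degs_subset by (intro sum.neutral ballI) (auto simp: orth subset_iff)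
    finally have hg: "integ m (\<lambda>x. h x * g x) = 0" .
    have "integ m (\<lambda>x. h x * (h x - g x)) = integ m (\<lambda>x. h x * h x - h x * g x)"
      by (simp add: right_diff_distrib)
    also have "\<dots> = integ m (\<lambda>x. h x * h x)"
      by (subst integ_diff) (use cont gc hg in \<open>auto intro!: continuous_intros\<close>)
    finally have "integ m (\<lambda>x. h x ^ 2) = integ m (\<lambda>x. h x * (h x - g x))"
      by (simp add: power2_eq_square)
    also have "\<bar>\<dots>\<bar> \<le> e * B"
    proof (rule integ_abs_le)
      show "continuous_on (domain m) (\<lambda>x. h x * (h x - g x))" using cont gc by (intro continuous_intros)
      show "\<bar>h x * (h x - g x)\<bar> \<le> e * B" if "x \<in> domain m" for x
        using mult_mono[OF B(2)[OF that] less_imp_le[OF bspec[OF g(2) that]]] B(1)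
        by (simp add: abs_mult mult.commute)
    qed
    finally show ?thesis by simp
  qed
  moreover obtain B where B: "B \<ge> 0" "\<And>x. x \<in> domain m \<Longrightarrow> \<bar>h x\<bar> \<le> B"
    using continuous_on_domain_bounded[OF cont] by blast
  ultimately have le: "integ m (\<lambda>x. h x ^ 2) \<le> e * B" if "e > 0" for e
    using that by blast
  have "integ m (\<lambda>x. h x ^ 2) \<le> 0 + e" if "e > 0" for e
  proof -
    have "integ m (\<lambda>x. h x ^ 2) \<le> (e / (B + 1)) * B" using B that by (intro le) simp
    also have "\<dots> \<le> e" using B that by (simp add: field_simps)
    finally show ?thesis by simp
  qed
  then have "integ m (\<lambda>x. h x ^ 2) \<le> 0" by (rule field_le_epsilon)
  moreover have "integ m (\<lambda>x :: nat \<Rightarrow> real ^ 'n. 0) \<le> integ m (\<lambda>x. h x ^ 2)"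
    using cont by (intro integ_mono continuous_intros) auto
  ultimately have "integ m (\<lambda>x. h x ^ 2) = 0" by (simp add: integ_zero)
  then have "h x ^ 2 = 0"
    using integ_nonneg_eq_0[of m "\<lambda>x. h x ^ 2" x] cont x by (auto intro!: continuous_intros)
  then show ?thesis by simp
qed

end

section \<open>Weights, convergence and the choice of good points\<close>

text \<open>The factor \<open>1 / [l (l + d)]\<^sup>r\<close> by which degree \<open>l\<close> enters the reproducing kernel.\<close>

definition decay :: "nat \<Rightarrow> real \<Rightarrow> nat \<Rightarrow> real" where
  "decay d r l = 1 / (real l * (real l + real d)) powr r"

definition inv_weight :: "nat \<Rightarrow> real \<Rightarrow> real \<Rightarrow> nat \<Rightarrow> real" where
  "inv_weight d r g l = (if l = 0 then 1 else g * decay d r l)"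

definition inv_weight_prod :: "nat \<Rightarrow> real \<Rightarrow> (nat \<Rightarrow> real) \<Rightarrow> nat \<Rightarrow> (nat \<Rightarrow> nat) \<Rightarrow> real" where
  "inv_weight_prod d r g m l = (\<Prod>j=1..m. inv_weight d r (g j) (l j))"

definition zero_degs :: "nat \<Rightarrow> nat \<Rightarrow> nat" where
  "zero_degs m = (\<lambda>j\<in>{1..m}. 0)"

lemma zero_degs_in_alldegs [simp]: "zero_degs m \<in> alldegs m"
  by (auto simp: zero_degs_def)

lemma zero_degs_in_degs [simp]: "zero_degs m \<in> degs m L"
  by (auto simp: zero_degs_def degs_def)

lemma basis_idx_zero_degs: "basis_idx d m (zero_degs m) = {\<lambda>j\<in>{1..m}. 1}"
proof -
  have "basis_idx d m (zero_degs m) = PiE {1..m} (\<lambda>_. {1})"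
    unfolding basis_idx_def by (rule PiE_cong) (simp add: zero_degs_def rdim_def)
  then show ?thesis by (simp add: PiE_singleton restrict_def)
qed

lemma decay_nonneg: "decay d r l \<ge> 0"
  by (simp add: decay_def)

lemma decay_pos: "l \<ge> 1 \<Longrightarrow> decay d r l > 0"
  by (simp add: decay_def)

lemma inv_weight_pos: "g > 0 \<Longrightarrow> inv_weight d r g l > 0"
  using decay_pos[of l d r] by (auto simp: inv_weight_def)

lemma Bcoef_inv_weight: "g > 0 \<Longrightarrow> Bcoef d r g l * inv_weight d r g l = 1"
  by (auto simp: Bcoef_def inv_weight_def decay_def)

lemma inv_weight_prod_pos: "(\<And>j. j \<in> {1..m} \<Longrightarrow> g j > 0) \<Longrightarrow> inv_weight_prod d r g m l > 0"
  unfolding inv_weight_prod_def by (intro prod_pos ballI inv_weight_pos) auto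

lemma Bprod_inv_weight_prod: "(\<And>j. j \<in> {1..m} \<Longrightarrow> g j > 0) \<Longrightarrow> Bprod d r g m l * inv_weight_prod d r g m l = 1"
  by (simp add: Bprod_def inv_weight_prod_def Bcoef_inv_weight flip: prod.distrib)

lemma Bprod_pos:
  assumes "\<And>j. j \<in> {1..m} \<Longrightarrow> g j > 0" shows "Bprod d r g m l > 0"
  using Bprod_inv_weight_prod[of m g d r l] inv_weight_prod_pos[of m g d r l] assms
  by (metis less_eq_real_def mult_le_0_iff not_less zero_less_one)

lemma inv_weight_prod_zero_degs: "inv_weight_prod d r g m (zero_degs m) = 1"
  by (simp add: inv_weight_prod_def inv_weight_def zero_degs_def)

lemma Bprod_zero_degs: "Bprod d r g m (zero_degs m) = 1"
  by (simp add: Bprod_def Bcoef_def zero_degs_def)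

text \<open>A dominated series of continuous functions converges uniformly, and \<open>integ\<close> is continuous for uniform
convergence.\<close>

lemma has_sum_integ:
  fixes f :: "'i \<Rightarrow> (nat \<Rightarrow> real ^ 'n) \<Rightarrow> real"
  assumes cont: "\<And>i. i \<in> X \<Longrightarrow> continuous_on (domain m) (f i)"
    and bound: "\<And>i x. i \<in> X \<Longrightarrow> x \<in> domain m \<Longrightarrow> \<bar>f i x\<bar> \<le> A i"
    and A: "A summable_on X"
  shows "continuous_on (domain m) (\<lambda>x. \<Sum>\<^sub>\<infinity>i\<in>X. f i x)"
    and "((\<lambda>i. integ m (f i)) has_sum integ m (\<lambda>x. \<Sum>\<^sub>\<infinity>i\<in>X. f i x)) X"
proof -
  define g where "g = (\<lambda>x. \<Sum>\<^sub>\<infinity>i\<in>X. f i x)"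
  have lim: "uniform_limit (domain m) (\<lambda>F x. \<Sum>i\<in>F. f i x) g (finite_subsets_at_top X)"
    unfolding g_def by (rule Weierstrass_m_test_general[OF _ A]) (use bound in auto)
  have sc: "continuous_on (domain m) (\<lambda>x. \<Sum>i\<in>F. f i x)" if "F \<subseteq> X" for F
    by (intro continuous_on_sum cont) (use that in auto)
  have gc: "continuous_on (domain m) g"
    by (rule uniform_limit_theorem[OF _ lim])
       (auto intro!: eventually_finite_subsets_at_top_weakI sc)
  then show "continuous_on (domain m) (\<lambda>x. \<Sum>\<^sub>\<infinity>i\<in>X. f i x)" by (simp add: g_def)
  have "((\<lambda>i. integ m (f i)) has_sum integ m g) X"
    unfolding has_sum_def
  proof (rule tendstoI)
    fix e :: real assume e: "e > 0"
    from uniform_limitD[OF lim, of "e / 2"] e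
    have ev: "\<forall>\<^sub>F F in finite_subsets_at_top X. \<forall>x\<in>domain m. dist (\<Sum>i\<in>F. f i x) (g x) < e / 2" by simp
    have ev2: "\<forall>\<^sub>F F in finite_subsets_at_top X. F \<subseteq> X"
      by (rule eventually_finite_subsets_at_top_weakI)
    show "\<forall>\<^sub>F F in finite_subsets_at_top X. dist (\<Sum>i\<in>F. integ m (f i)) (integ m g) < e"
      using ev ev2
    proof eventually_elim
      case (elim F)
      have "(\<Sum>i\<in>F. integ m (f i)) - integ m g = integ m (\<lambda>x. (\<Sum>i\<in>F. f i x) - g x)"
        using elim(2) by (subst integ_diff[OF sc gc]) (auto intro!: integ_sum[symmetric] cont)
      also have "\<bar>\<dots>\<bar> \<le> e / 2"
        using elim by (intro integ_abs_le continuous_on_diff sc gc) (auto simp: dist_real_def intro: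
            less_imp_le)
      finally show ?case using e by (simp add: dist_real_def)
    qed
  qed
  then show "((\<lambda>i. integ m (f i)) has_sum integ m (\<lambda>x. \<Sum>\<^sub>\<infinity>i\<in>X. f i x)) X" by (simp add: g_def)
qed

text \<open>The terms are at most \<open>l powr (2 * d - 2 * r)\<close>, and this exponent is less than \<open>-2\<close>.\<close>

lemma summable_decay:
  assumes r: "r > real d + 1"
  shows "(\<lambda>l. real l ^ (2 * d) / (real l * (real l + real d)) powr r) summable_on {1..}"
proof (rule summable_on_comparison_test)
  have "summable (\<lambda>n. norm (inverse ((real n)\<^sup>2)))"
    using inverse_power_summable[of 2, where ?'a = real] by simp
  then have "(\<lambda>n. inverse ((real n)\<^sup>2)) summable_on UNIV"
    by (rule norm_summable_imp_summable_on)
  then show "(\<lambda>n. inverse ((real n)\<^sup>2)) summable_on {1..}"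
    by (rule summable_on_subset_banach) auto
  fix l :: nat assume l: "l \<in> {1..}"
  then have l1: "real l \<ge> 1" by simp
  have "real l powr (2 * (real d + 1)) \<le> real l powr (2 * r)"
    using r l1 by (intro powr_mono) auto
  also have "\<dots> = (real l * real l) powr r"
    using l1 by (simp add: powr_mult powr_add[symmetric])
  also have "\<dots> \<le> (real l * (real l + real d)) powr r"
    using r l1 by (intro powr_mono2 mult_left_mono) auto
  also have "real l powr (2 * (real d + 1)) = real l ^ (2 * d) * (real l)\<^sup>2"
  proof -
    have "real l powr (2 * (real d + 1)) = real l powr real (2 * d + 2)"
      by (simp add: algebra_simps)
    also have "\<dots> = real l ^ (2 * d + 2)" using l1 by (subst powr_realpow) auto
    finally show ?thesis by (simp only: power_add)
  qed
  finally have "real l ^ (2 * d) * (real l)\<^sup>2 \<le> (real l * (real l + real d)) powr r" .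
  moreover have "a / y \<le> inverse z" if "a * z \<le> y" "z > 0" "y > 0" for a y z :: real
    using that by (simp add: field_simps)
  ultimately show "real l ^ (2 * d) / (real l * (real l + real d)) powr r \<le> inverse ((real l)\<^sup>2)"
    using l1 by simp
qed auto

locale simplex_space = simplex_basis P for P :: "nat \<Rightarrow> nat \<Rightarrow> real ^ 'n \<Rightarrow> real" +
  fixes M r :: real
  assumes M: "\<And>l x y. l \<ge> 1 \<Longrightarrow> x \<in> Td \<Longrightarrow> y \<in> Td \<Longrightarrow> Pker P l x y \<le> M * real l ^ (2 * CARD('n))"
    and r: "r > real CARD('n) + 1"
begin

definition diag_bound :: "nat \<Rightarrow> real" where
  "diag_bound l = (if l = 0 then 1 else M * real l ^ (2 * CARD('n)))"

lemma Pker_diag: "Pker P l x x = (\<Sum>k=1..rdim CARD('n) l. (P l k x)\<^sup>2)"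
  by (simp add: Pker_def power2_eq_square)

lemma Pker_0: "Pker P 0 x y = 1"
  by (simp add: Pker_def rdim_0 P_0_1)

lemma Pker_diag_le: "x \<in> Td \<Longrightarrow> (\<Sum>k=1..rdim CARD('n) l. (P l k x)\<^sup>2) \<le> diag_bound l"
proof (cases "l = 0")
  case True then show ?thesis using Pker_0[of x x] by (simp add: diag_bound_def Pker_diag)
next
  case False
  assume "x \<in> Td" with False M[of l x x] show ?thesis by (simp add: diag_bound_def Pker_diag)
qed

lemma M_nonneg: "M \<ge> 0"
proof -
  have "0 \<le> (\<Sum>k=1..rdim CARD('n) 1. (P 1 k 0)\<^sup>2)" by (intro sum_nonneg) auto
  also have "\<dots> \<le> M" using Pker_diag_le[OF zero_in_Td, of 1] by (simp add: diag_bound_def)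
  finally show ?thesis .
qed

lemma diag_bound_nonneg: "diag_bound l \<ge> 0"
  using M_nonneg by (simp add: diag_bound_def)

lemma sum_decay_le_cdr:
  assumes "finite F" "F \<subseteq> {1..}"
  shows "(\<Sum>l\<in>F. diag_bound l * decay CARD('n) r l) \<le> cdr CARD('n) r M"
proof -
  have "(\<Sum>l\<in>F. diag_bound l * decay CARD('n) r l)
      = M * (\<Sum>l\<in>F. real l ^ (2 * CARD('n)) / (real l * (real l + real CARD('n))) powr r)"
    unfolding sum_distrib_left by (intro sum.cong refl) (use assms in \<open>auto simp: diag_bound_def decay_def\<close>)
  also have "\<dots> \<le> M * (\<Sum>\<^sub>\<infinity>l\<in>{1..}. real l ^ (2 * CARD('n)) / (real l * (real l + real CARD('n))) powr r)"
    by (intro mult_left_mono finite_sum_le_infsum summable_decay assms M_nonneg) (use r in auto)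
  finally show ?thesis by (simp add: cdr_def)
qed

lemma cdr_nonneg: "cdr CARD('n) r M \<ge> 0"
  using sum_decay_le_cdr[of "{}"] by simp

definition diag_bound_prod :: "nat \<Rightarrow> (nat \<Rightarrow> nat) \<Rightarrow> real" where
  "diag_bound_prod m l = (\<Prod>j=1..m. diag_bound (l j))"

lemma diag_bound_prod_nonneg: "diag_bound_prod m l \<ge> 0"
  unfolding diag_bound_prod_def by (intro prod_nonneg diag_bound_nonneg ballI)

lemma sum_phi_sq_le:
  assumes "x \<in> domain m"
  shows "(\<Sum>k\<in>basis_idx CARD('n) m l. (phi m l k x)\<^sup>2) \<le> diag_bound_prod m l"
proof -
  have "(\<Sum>k\<in>basis_idx CARD('n) m l. (phi m l k x)\<^sup>2)
      = (\<Prod>j=1..m. \<Sum>k=1..rdim CARD('n) (l j). (P (l j) k (x j))\<^sup>2)"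
    unfolding sum_basis_idx_prod[symmetric] by (simp add: phi_def prod_power_distrib)
  also have "\<dots> \<le> diag_bound_prod m l"
    unfolding diag_bound_prod_def
    by (intro prod_mono conjI sum_nonneg Pker_diag_le) (use assms in \<open>auto simp: domain_def PiE_def Pi_def\<close>)
  finally show ?thesis .
qed

text \<open>The cardinality is the integral of the diagonal of the kernel. In this way the bound on \<open>Pker\<close>
also bounds the number of basis elements.\<close>

lemma card_basis_idx_le:
  assumes "l \<in> alldegs m"
  shows "real (card (basis_idx CARD('n) m l)) \<le> diag_bound_prod m l"
proof -
  have "real (card (basis_idx CARD('n) m l))
      = (\<Sum>k\<in>basis_idx CARD('n) m l. integ m (\<lambda>x. phi m l k x * phi m l k x))"
    using assms by (simp add: integ_phi_phi)
  also have "\<dots> = integ m (\<lambda>x. \<Sum>k\<in>basis_idx CARD('n) m l. phi m l k x * phi m l k x)"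
    by (intro integ_sum[symmetric] continuous_on_mult phi_cont)
  also have "\<dots> \<le> integ m (\<lambda>x :: nat \<Rightarrow> real ^ 'n. diag_bound_prod m l)"
    by (intro integ_mono continuous_on_mult continuous_on_sum phi_cont continuous_on_const)
       (use sum_phi_sq_le in \<open>auto simp: power2_eq_square\<close>)
  finally show ?thesis by (simp add: integ_const)
qed

lemma phi_zero_degs:
  assumes "k \<in> basis_idx CARD('n) m (zero_degs m)"
  shows "phi m (zero_degs m) k x = 1"
proof -
  have "k = (\<lambda>j\<in>{1..m}. 1)" using assms unfolding basis_idx_zero_degs by simp
  then show ?thesis by (simp add: phi_def zero_degs_def P_0_1)
qed

end

locale simplex_weighted = simplex_space P M r
  for P :: "nat \<Rightarrow> nat \<Rightarrow> real ^ 'n \<Rightarrow> real" and M r +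
  fixes g :: "nat \<Rightarrow> real" and m :: nat
  assumes g_pos: "\<And>j. j \<in> {1..m} \<Longrightarrow> g j > 0"
begin

definition trace_bound :: real where "trace_bound = (\<Prod>j=1..m. 1 + g j * cdr CARD('n) r M)"

lemma inv_weight_pos_at: "inv_weight_prod CARD('n) r g m l > 0" by (rule inv_weight_prod_pos) (rule g_pos)
lemma weight_pos_at: "Bprod CARD('n) r g m l > 0" by (rule Bprod_pos) (rule g_pos)
lemma weight_mult_inv_at: "Bprod CARD('n) r g m l * inv_weight_prod CARD('n) r g m l
    = 1" by (rule Bprod_inv_weight_prod) (rule g_pos)

text \<open>A finite set of multi-degrees lies in a product set \<open>degs m L\<close>, over which the sum factors into
partial sums of the series in \<open>cdr\<close>.\<close>

lemma sum_inv_weight_diag_le: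
  assumes "finite G" "G \<subseteq> alldegs m"
  shows "(\<Sum>l\<in>G. inv_weight_prod CARD('n) r g m l * diag_bound_prod m l) \<le> trace_bound"
proof -
  obtain L where L: "G \<subseteq> degs m L" using finite_alldegs_subset_degs[OF assms] by blast
  have "(\<Sum>l\<in>G. inv_weight_prod CARD('n) r g m l * diag_bound_prod m l)
      \<le> (\<Sum>l\<in>degs m L. inv_weight_prod CARD('n) r g m l * diag_bound_prod m l)"
    by (intro sum_mono2 L finite_degs mult_nonneg_nonneg less_imp_le[OF inv_weight_pos_at]
        diag_bound_prod_nonneg)
  also have "\<dots> = (\<Sum>l\<in>degs m L. \<Prod>j=1..m. inv_weight CARD('n) r (g j) (l j) * diag_bound (l j))"
    by (simp add: inv_weight_prod_def diag_bound_prod_def prod.distrib)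
  also have "\<dots> = (\<Prod>j=1..m. \<Sum>l\<le>L. inv_weight CARD('n) r (g j) l * diag_bound l)"
    by (rule sum_degs_prod)
  also have "\<dots> \<le> trace_bound"
    unfolding trace_bound_def
  proof (intro prod_mono conjI sum_nonneg mult_nonneg_nonneg diag_bound_nonneg less_imp_le[OF
      inv_weight_pos] g_pos)
    fix j assume j: "j \<in> {1..m}"
    have "(\<Sum>l\<le>L. inv_weight CARD('n) r (g j) l * diag_bound l)
        = 1 + (\<Sum>l=1..L. inv_weight CARD('n) r (g j) l * diag_bound l)"
      by (simp add: atMost_atLeast0 sum.atLeast_Suc_atMost inv_weight_def diag_bound_def One_nat_def)
    also have "(\<Sum>l=1..L. inv_weight CARD('n) r (g j) l * diag_bound l)
        = g j * (\<Sum>l=1..L. diag_bound l * decay CARD('n) r l)"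
      unfolding sum_distrib_left by (intro sum.cong refl) (auto simp: inv_weight_def)
    also have "\<dots> \<le> g j * cdr CARD('n) r M"
      by (intro mult_left_mono sum_decay_le_cdr less_imp_le[OF g_pos[OF j]]) auto
    finally show "(\<Sum>l\<le>L. inv_weight CARD('n) r (g j) l * diag_bound l) \<le> 1 + g j * cdr CARD('n) r M" by simp
  qed
  finally show ?thesis .
qed

lemma summable_inv_weight_diag: "(\<lambda>l. inv_weight_prod CARD('n) r g m l
    * diag_bound_prod m l) summable_on alldegs m"
  by (rule nonneg_bdd_above_summable_on)
     (use sum_inv_weight_diag_le in \<open>auto intro!: bdd_aboveI[of _ trace_bound] mult_nonneg_nonneg
         less_imp_le[OF inv_weight_pos_at] diag_bound_prod_nonneg\<close>)

lemma infsum_card_le: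
  shows "(\<lambda>l. inv_weight_prod CARD('n) r g m l
      * real (card (basis_idx CARD('n) m l))) summable_on alldegs m - {zero_degs m}"
    and "(\<Sum>\<^sub>\<infinity>l\<in>alldegs m - {zero_degs m}. inv_weight_prod CARD('n) r g m l
        * real (card (basis_idx CARD('n) m l))) \<le> trace_bound - 1"
proof -
  have W: "(\<lambda>l. inv_weight_prod CARD('n) r g m l * diag_bound_prod m l) summable_on alldegs m - {zero_degs m}"
    by (rule summable_on_subset_banach[OF summable_inv_weight_diag]) auto
  show s: "(\<lambda>l. inv_weight_prod CARD('n) r g m l
      * real (card (basis_idx CARD('n) m l))) summable_on alldegs m - {zero_degs m}"
    by (rule summable_on_comparison_test[OF W])
       (use card_basis_idx_le less_imp_le[OF inv_weight_pos_at] in \<open>auto intro!: mult_left_mono\<close>)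
  show "(\<Sum>\<^sub>\<infinity>l\<in>alldegs m - {zero_degs m}. inv_weight_prod CARD('n) r g m l
      * real (card (basis_idx CARD('n) m l))) \<le> trace_bound - 1"
  proof (rule infsum_le_finite_sums[OF s])
    fix F assume F: "finite F" "F \<subseteq> alldegs m - {zero_degs m}"
    have "(\<Sum>l\<in>F. inv_weight_prod CARD('n) r g m l * real (card (basis_idx CARD('n) m l)))
        \<le> (\<Sum>l\<in>F. inv_weight_prod CARD('n) r g m l * diag_bound_prod m l)"
      by (intro sum_mono mult_left_mono card_basis_idx_le less_imp_le[OF inv_weight_pos_at]) (use F in auto)
    also have "\<dots> = (\<Sum>l\<in>insert (zero_degs m) F. inv_weight_prod CARD('n) r g m l * diag_bound_prod m l) - 1"
    proof -
      have "diag_bound_prod m (zero_degs m)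
          = 1" by (simp add: diag_bound_prod_def diag_bound_def zero_degs_def)
      moreover have "zero_degs m \<notin> F" using F by auto
      ultimately show ?thesis using F by (simp add: inv_weight_prod_zero_degs)
    qed
    also have "\<dots> \<le> trace_bound - 1"
      using sum_inv_weight_diag_le[of "insert (zero_degs m) F"] F by auto
    finally show "(\<Sum>l\<in>F. inv_weight_prod CARD('n) r g m l * real (card (basis_idx CARD('n) m l)))
        \<le> trace_bound - 1" .
  qed
qed

definition point_sum :: "nat \<Rightarrow> (nat \<Rightarrow> nat \<Rightarrow> real ^ 'n) \<Rightarrow> (nat \<Rightarrow> nat) \<Rightarrow> (nat \<Rightarrow> nat) \<Rightarrow> real" where
  "point_sum n t l k = (\<Sum>s=1..n. phi m l k (t s))"

text \<open>The square of the worst-case error of the points \<open>t 1, \<dots>, t n\<close>, multiplied by \<open>n\<^sup>2\<close>.\<close>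

definition discrepancy :: "nat \<Rightarrow> (nat \<Rightarrow> nat \<Rightarrow> real ^ 'n) \<Rightarrow> real" where
  "discrepancy n t = (\<Sum>\<^sub>\<infinity>l\<in>alldegs m - {zero_degs m}. inv_weight_prod CARD('n) r g m l *
      (\<Sum>k\<in>basis_idx CARD('n) m l. (point_sum n t l k)\<^sup>2))"

lemma point_sum_sq_le:
  assumes "\<And>i. i \<in> {1..n} \<Longrightarrow> t i \<in> domain m"
  shows "(\<Sum>k\<in>basis_idx CARD('n) m l. (point_sum n t l k)\<^sup>2) \<le> real n ^ 2 * diag_bound_prod m l"
proof -
  have "(\<Sum>k\<in>basis_idx CARD('n) m l. (point_sum n t l k)\<^sup>2)
      \<le> (\<Sum>k\<in>basis_idx CARD('n) m l. real n * (\<Sum>s=1..n. (phi m l k (t s))\<^sup>2))"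
  proof (rule sum_mono)
    fix k
    have "(\<Sum>s=1..n. phi m l k (t s))\<^sup>2 \<le> (\<Sum>s=1..n. (phi m l k (t s))\<^sup>2) * card {1..n}"
      by (rule sum_squared_le_sum_of_squares)
    then show "(point_sum n t l k)\<^sup>2 \<le> real n * (\<Sum>s=1..n. (phi m l k (t s))\<^sup>2)"
      by (simp add: point_sum_def mult.commute)
  qed
  also have "\<dots> = real n * (\<Sum>s=1..n. \<Sum>k\<in>basis_idx CARD('n) m l. (phi m l k (t s))\<^sup>2)"
    unfolding sum_distrib_left[symmetric] by (subst sum.swap) simp
  also have "\<dots> \<le> real n * (\<Sum>s=1..n. diag_bound_prod m l)"
    by (intro mult_left_mono sum_mono sum_phi_sq_le assms) auto
  finally show ?thesis by (simp add: power2_eq_square)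
qed

lemma summable_discrepancy:
  assumes "\<And>i. i \<in> {1..n} \<Longrightarrow> t i \<in> domain m"
  shows "(\<lambda>l. inv_weight_prod CARD('n) r g m l *
      (\<Sum>k\<in>basis_idx CARD('n) m l. (point_sum n t l k)\<^sup>2)) summable_on alldegs m - {zero_degs m}"
proof (rule summable_on_comparison_test)
  show "(\<lambda>l. real n ^ 2 * (inv_weight_prod CARD('n) r g m l * diag_bound_prod m l)) summable_on alldegs m
      - {zero_degs m}"
    by (intro summable_on_cmult_right summable_on_subset_banach[OF summable_inv_weight_diag]) auto
  show "inv_weight_prod CARD('n) r g m l * (\<Sum>k\<in>basis_idx CARD('n) m l. (point_sum n t l k)\<^sup>2)
      \<le> real n ^ 2 * (inv_weight_prod CARD('n) r g m l * diag_bound_prod m l)" for l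
    using mult_left_mono[OF point_sum_sq_le[where n = n and t = t and l
        = l, OF assms] less_imp_le[OF inv_weight_pos_at[of l]]] by (simp add: mult_ac)
  show "inv_weight_prod CARD('n) r g m l * (\<Sum>k\<in>basis_idx CARD('n) m l. (point_sum n t l k)\<^sup>2) \<ge> 0" for l
    by (intro mult_nonneg_nonneg sum_nonneg less_imp_le[OF inv_weight_pos_at]) auto
qed

text \<open>Points are added one by one. Averaged over the new point \<open>x\<close>, the sum of the
\<open>(point_sum n t l k + phi m l k x)\<^sup>2\<close> grows by exactly the number of indices, as \<open>phi m l k\<close> has mean
zero and variance one; some \<open>x\<close> does at least as well as the average.\<close>

lemma exists_good_points:
  "\<exists>t. (\<forall>i\<in>{1..n}. t i \<in> domain m) \<and> discrepancy n t \<le> real n * (trace_bound - 1)"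
proof (induction n)
  case 0
  show ?case by (intro exI[of _ "\<lambda>_. undefined"]) (simp add: discrepancy_def point_sum_def)
next
  case (Suc n)
  then obtain t where t0: "\<forall>i\<in>{1..n}. t i \<in> domain m" "discrepancy n t \<le> real n * (trace_bound - 1)" by blast
  then have t: "\<And>i. i \<in> {1..n} \<Longrightarrow> t i \<in> domain m" "discrepancy n t \<le> real n * (trace_bound - 1)" by blast+
  let ?A = "alldegs m - {zero_degs m}"
  define f where "f = (\<lambda>l x. inv_weight_prod CARD('n) r g m l *
      (\<Sum>k\<in>basis_idx CARD('n) m l. (point_sum n t l k + phi m l k x)\<^sup>2))"
  define h where "h = (\<lambda>x. \<Sum>\<^sub>\<infinity>l\<in>?A. f l x)"
  have fc: "continuous_on (domain m) (f l)" for l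
    unfolding f_def by (intro continuous_on_mult continuous_on_const continuous_on_sum continuous_on_power
        continuous_on_add phi_cont)
  have f_bound: "\<bar>f l x\<bar> \<le> (real (Suc n))\<^sup>2 * (inv_weight_prod CARD('n) r g m l * diag_bound_prod m l)"
      if "x \<in> domain m" for l x
  proof -
    have "point_sum (Suc n) (t(Suc n := x)) l k = point_sum n t l k + phi m l k x" for k
      by (simp add: point_sum_def)
    then have "f l x = inv_weight_prod CARD('n) r g m l *
        (\<Sum>k\<in>basis_idx CARD('n) m l. (point_sum (Suc n) (t(Suc n := x)) l k)\<^sup>2)"
      by (simp add: f_def)
    moreover have "(\<Sum>k\<in>basis_idx CARD('n) m l. (point_sum (Suc n) (t(Suc n := x)) l k)\<^sup>2)
        \<le> (real (Suc n))\<^sup>2 * diag_bound_prod m l"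
      by (rule point_sum_sq_le) (use t that in \<open>auto simp: le_Suc_eq\<close>)
    moreover have "0 \<le> (\<Sum>k\<in>basis_idx CARD('n) m l. (point_sum (Suc n) (t(Suc n := x)) l k)\<^sup>2)"
        by (intro sum_nonneg) auto
    ultimately show ?thesis
      using mult_left_mono[of "\<Sum>k\<in>basis_idx CARD('n) m l. (point_sum (Suc n) (t(Suc n := x)) l k)\<^sup>2" _
          "inv_weight_prod CARD('n) r g m l"] inv_weight_pos_at[of l]
      by (simp add: abs_mult abs_of_pos mult_ac)
  qed
  have sumA: "(\<lambda>l. (real (Suc n))\<^sup>2 * (inv_weight_prod CARD('n) r g m l
      * diag_bound_prod m l)) summable_on ?A"
    by (intro summable_on_cmult_right summable_on_subset_banach[OF summable_inv_weight_diag]) auto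
  have hc: "continuous_on (domain m) h" and hint: "((\<lambda>l. integ m (f l)) has_sum integ m h) ?A"
    unfolding h_def using has_sum_integ[where X = ?A and f = f, OF fc f_bound sumA] by blast+
  \<comment> \<open>The mixed term of the square integrates to zero, as \<open>l\<close> is not the constant degree.\<close>
  have int_f: "integ m (f l) = inv_weight_prod CARD('n) r g m l *
      (\<Sum>k\<in>basis_idx CARD('n) m l. (point_sum n t l k)\<^sup>2) + inv_weight_prod CARD('n) r g m l
      * real (card (basis_idx CARD('n) m l))" if l: "l \<in> ?A" for l
  proof -
    have int_sq: "integ m (\<lambda>x. (point_sum n t l k + phi m l k x)\<^sup>2) = (point_sum n t l k)\<^sup>2 + 1"
        if k: "k \<in> basis_idx CARD('n) m l" for k
    proof -
      have one_idx: "(\<lambda>j\<in>{1..m}. 1) \<in> basis_idx CARD('n) m (zero_degs m)" by (simp add: basis_idx_zero_degs)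
      have "integ m (\<lambda>x. phi m l k x * phi m (zero_degs m) (\<lambda>j\<in>{1..m}. 1) x) = 0"
        using l k one_idx by (subst integ_phi_phi) auto
      then have z: "integ m (phi m l k) = 0" by (simp add: phi_zero_degs[OF one_idx])
      have "integ m (\<lambda>x. (point_sum n t l k + phi m l k x)\<^sup>2) =
          integ m (\<lambda>x. ((point_sum n t l k)\<^sup>2 + 2 * point_sum n t l k * phi m l k x) + phi m l k x
              * phi m l k x)"
        by (simp add: power2_eq_square algebra_simps)
      also have "\<dots> = integ m (\<lambda>x. (point_sum n t l k)\<^sup>2 + 2 * point_sum n t l k * phi m l k x)
          + integ m (\<lambda>x. phi m l k x * phi m l k x)"
        by (intro integ_add continuous_on_add continuous_on_mult continuous_on_const phi_cont k)
      also have "integ m (\<lambda>x. (point_sum n t l k)\<^sup>2 + 2 * point_sum n t l k * phi m l k x) =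
          integ m (\<lambda>x :: nat \<Rightarrow> real ^ 'n. (point_sum n t l k)\<^sup>2) + integ m (\<lambda>x. 2 * point_sum n t l k
              * phi m l k x)"
        by (intro integ_add continuous_on_mult continuous_on_const phi_cont k)
      also have "integ m (\<lambda>x. 2 * point_sum n t l k * phi m l k x)
          = 2 * point_sum n t l k * integ m (phi m l k)"
        by (rule integ_cmult)
      finally show ?thesis using l k z by (simp add: integ_const integ_phi_phi)
    qed
    have "integ m (f l) = inv_weight_prod CARD('n) r g m l *
        (\<Sum>k\<in>basis_idx CARD('n) m l. integ m (\<lambda>x. (point_sum n t l k + phi m l k x)\<^sup>2))"
      unfolding f_def integ_cmult
      by (subst integ_sum) (auto intro!: continuous_on_power continuous_on_add continuous_on_const phi_cont)
    also have "\<dots> = inv_weight_prod CARD('n) r g m l * ((\<Sum>k\<in>basis_idx CARD('n) m l. (point_sum n t l k)\<^sup>2)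
        + real (card (basis_idx CARD('n) m l)))"
      by (simp add: int_sq sum.distrib)
    finally show ?thesis by (simp add: distrib_left)
  qed
  have "integ m h = (\<Sum>\<^sub>\<infinity>l\<in>?A. integ m (f l))"
    using hint by (simp add: infsumI)
  also have "\<dots> = (\<Sum>\<^sub>\<infinity>l\<in>?A. inv_weight_prod CARD('n) r g m l *
      (\<Sum>k\<in>basis_idx CARD('n) m l. (point_sum n t l k)\<^sup>2) + inv_weight_prod CARD('n) r g m l
      * real (card (basis_idx CARD('n) m l)))"
    by (rule infsum_cong) (rule int_f)
  also have "\<dots> = discrepancy n t + (\<Sum>\<^sub>\<infinity>l\<in>?A. inv_weight_prod CARD('n) r g m l
      * real (card (basis_idx CARD('n) m l)))"
    unfolding discrepancy_def by (rule infsum_add[OF summable_discrepancy[OF t(1)] infsum_card_le(1)])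
  also have "\<dots> \<le> real (Suc n) * (trace_bound - 1)"
    using t(2) infsum_card_le(2) by (simp add: algebra_simps)
  finally have "integ m h \<le> real (Suc n) * (trace_bound - 1)" .
  then obtain x where x: "x \<in> domain m" "h x \<le> real (Suc n) * (trace_bound - 1)"
    using exists_le_integ[OF hc] by fastforce
  have "discrepancy (Suc n) (t(Suc n := x)) = h x"
    by (simp add: discrepancy_def h_def f_def point_sum_def)
  then have "discrepancy (Suc n) (t(Suc n := x)) \<le> real (Suc n) * (trace_bound - 1)" using x(2) by simp
  moreover have "\<forall>i\<in>{1..Suc n}. (t(Suc n := x)) i \<in> domain m"
    using t(1) x(1) by (auto simp: le_Suc_eq)
  ultimately show ?case by blast
qed

end

section \<open>Worst-case error: upper bound\<close>

lemma has_sum_sum_finite: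
  fixes f :: "'i \<Rightarrow> 'a \<Rightarrow> real"
  assumes "\<And>i. i \<in> I \<Longrightarrow> (f i has_sum s i) X"
  shows "((\<lambda>x. \<Sum>i\<in>I. f i x) has_sum (\<Sum>i\<in>I. s i)) X"
  using assms
proof (induction I rule: infinite_finite_induct)
  case (insert i I)
  then have "((\<lambda>x. f i x + (\<Sum>i\<in>I. f i x)) has_sum (s i + (\<Sum>i\<in>I. s i))) X"
    by (intro has_sum_add) auto
  then show ?case using insert by simp
qed simp_all

context simplex_weighted
begin

definition block_energy :: "((nat \<Rightarrow> real ^ 'n) \<Rightarrow> real) \<Rightarrow> (nat \<Rightarrow> nat) \<Rightarrow> real" where
  "block_energy f l = Bprod CARD('n) r g m l * (\<Sum>k\<in>basis_idx CARD('n) m l. (acoef P m (l, k) f)\<^sup>2)"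

lemma block_energy_nonneg: "block_energy f l \<ge> 0"
  unfolding block_energy_def by (intro mult_nonneg_nonneg sum_nonneg less_imp_le[OF weight_pos_at]) auto

lemma norm_H_sq: "(norm_H P r g m f)\<^sup>2 = inner_H P r g m f f" and norm_H_nonneg: "norm_H P r g m f \<ge> 0"
proof -
  have "inner_H P r g m f f \<ge> 0"
    unfolding inner_H_def mult.assoc power2_eq_square[symmetric]
    by (intro infsum_nonneg mult_nonneg_nonneg less_imp_le[OF weight_pos_at]) auto
  then show "(norm_H P r g m f)\<^sup>2 = inner_H P r g m f f" "norm_H P r g m f \<ge> 0"
    by (simp_all add: norm_H_def)
qed

lemma sum_block_energy_le:
  assumes f: "f \<in> Hm P r g m" and G: "finite G" "G \<subseteq> alldegs m"
  shows "(\<Sum>l\<in>G. block_energy f l) \<le> (norm_H P r g m f)\<^sup>2"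
proof -
  have "(\<Sum>l\<in>G. block_energy f l)
      = (\<Sum>i\<in>Sigma G (basis_idx CARD('n) m). Bprod CARD('n) r g m (fst i) * (acoef P m i f)\<^sup>2)"
    unfolding block_energy_def sum_distrib_left using G by (subst sum.Sigma) (auto simp: case_prod_beta)
  also have "\<dots> \<le> (\<Sum>\<^sub>\<infinity>i\<in>multi_idx CARD('n) m. Bprod CARD('n) r g m (fst i) * (acoef P m i f)\<^sup>2)"
    by (rule finite_sum_le_infsum)
       (use f G less_imp_le[OF weight_pos_at] in \<open>auto simp: Hm_def multi_idx_eq intro!: mult_nonneg_nonneg\<close>)
  also have "\<dots> = (norm_H P r g m f)\<^sup>2"
    unfolding norm_H_sq inner_H_def by (simp add: power2_eq_square mult.assoc)
  finally show ?thesis .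
qed

text \<open>The component of \<open>f\<close> of exact multi-degree \<open>l\<close>. The Fourier series is summed by such blocks because
\<open>Pker\<close> bounds only the sum of the squares of all basis elements of equal degree; bounding them
individually would cost a factor \<open>rdim\<close>, with which the series no longer converges absolutely for
large \<open>d\<close> and \<open>r\<close> close to \<open>d + 1\<close>.\<close>

definition block :: "((nat \<Rightarrow> real ^ 'n) \<Rightarrow> real) \<Rightarrow> (nat \<Rightarrow> nat) \<Rightarrow> (nat \<Rightarrow> real ^ 'n) \<Rightarrow> real" where
  "block f l x = (\<Sum>k\<in>basis_idx CARD('n) m l. acoef P m (l, k) f * phi m l k x)"

lemma block_cont: "continuous_on A (block f l)"
  unfolding block_def by (intro continuous_on_sum continuous_on_mult continuous_on_const phi_cont)

text \<open>Cauchy--Schwarz followed by the inequality of the means, with the weight \<open>B(l)\<close> moved from one factor to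
the other; both summands on the right are summable over all multi-degrees.\<close>

lemma abs_block_le:
  assumes x: "x \<in> domain m"
  shows "\<bar>block f l x\<bar> \<le> (block_energy f l + inv_weight_prod CARD('n) r g m l * diag_bound_prod m l) / 2"
proof -
  let ?u = "block_energy f l" and ?v = "inv_weight_prod CARD('n) r g m l * diag_bound_prod m l"
  have "(block f l x)\<^sup>2 \<le> (\<Sum>k\<in>basis_idx CARD('n) m l. (acoef P m (l, k) f)\<^sup>2) *
      (\<Sum>k\<in>basis_idx CARD('n) m l. (phi m l k x)\<^sup>2)"
    unfolding block_def by (rule Cauchy_Schwarz_ineq_sum)
  also have "\<dots> \<le> (\<Sum>k\<in>basis_idx CARD('n) m l. (acoef P m (l, k) f)\<^sup>2) * diag_bound_prod m l"
    by (intro mult_left_mono sum_phi_sq_le x sum_nonneg) auto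
  also have "\<dots> = ?u * ?v"
  proof -
    have "?u * ?v = (Bprod CARD('n) r g m l * inv_weight_prod CARD('n) r g m l)
        * ((\<Sum>k\<in>basis_idx CARD('n) m l. (acoef P m (l, k) f)\<^sup>2) * diag_bound_prod m l)"
      unfolding block_energy_def by (simp only: mult_ac)
    from this[unfolded weight_mult_inv_at mult_1_left] show ?thesis by (rule sym)
  qed
  also have "\<dots> \<le> ((?u + ?v) / 2)\<^sup>2"
    using zero_le_power2[of "?u - ?v"] by (simp add: power2_eq_square field_simps)
  finally have "\<bar>block f l x\<bar>\<^sup>2 \<le> ((?u + ?v) / 2)\<^sup>2" by simp
  then show ?thesis
    by (rule power2_le_imp_le)
       (intro divide_nonneg_pos add_nonneg_nonneg block_energy_nonneg mult_nonneg_nonneg less_imp_le[OF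
           inv_weight_pos_at] diag_bound_prod_nonneg, simp)
qed

text \<open>The Fourier series converges uniformly, so its sum is continuous; it has the same coefficients as
\<open>f\<close>, and a continuous function is determined by its coefficients.\<close>

lemma Hm_expansion:
  assumes f: "f \<in> Hm P r g m" and x: "x \<in> domain m"
  shows "((\<lambda>l. block f l x) has_sum f x) (alldegs m)"
proof -
  let ?A = "\<lambda>l. (block_energy f l + inv_weight_prod CARD('n) r g m l * diag_bound_prod m l) / 2"
  have fc: "continuous_on (domain m) f" using f by (simp add: Hm_def)
  have sc: "(\<lambda>l. block_energy f l) summable_on alldegs m"
    by (rule nonneg_bdd_above_summable_on)
       (use sum_block_energy_le[OF f] block_energy_nonneg in \<open>auto intro!: bdd_aboveI[of _ "(norm_H P r g
           m f)\<^sup>2"]\<close>)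
  have sA: "?A summable_on alldegs m"
    unfolding divide_inverse by (intro summable_on_cmult_left summable_on_add sc summable_inv_weight_diag)
  define h where "h = (\<lambda>x. \<Sum>\<^sub>\<infinity>l\<in>alldegs m. block f l x)"
  have hc: "continuous_on (domain m) h"
    unfolding h_def by (rule has_sum_integ(1)[OF block_cont abs_block_le sA])
  have hs: "((\<lambda>l. block f l y) has_sum h y) (alldegs m)" if "y \<in> domain m" for y
  proof -
    have "(\<lambda>l. block f l y) summable_on alldegs m"
      by (rule abs_summable_summable, rule summable_on_comparison_test[OF sA])
         (use abs_block_le[OF that] in auto)
    then show ?thesis by (simp add: h_def)
  qed
  have "h x - f x = 0"
  proof (rule continuous_zero_if_orthogonal[OF _ _ x, where h = "\<lambda>x. h x - f x"])
    show "continuous_on (domain m) (\<lambda>x. h x - f x)" by (intro continuous_on_diff hc fc)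
    fix l' k' assume l': "l' \<in> alldegs m" and k': "k' \<in> basis_idx CARD('n) m l'"
    obtain B where B: "B \<ge> 0" "\<And>x. x \<in> domain m \<Longrightarrow> \<bar>phi m l' k' x\<bar> \<le> B"
      using continuous_on_domain_bounded[OF phi_cont[OF k']] by blast
    have bd: "\<bar>block f l y * phi m l' k' y\<bar> \<le> ?A l * B" if "y \<in> domain m" for l y
      unfolding abs_mult
      by (intro mult_mono abs_block_le B that divide_nonneg_pos add_nonneg_nonneg block_energy_nonneg
            mult_nonneg_nonneg less_imp_le[OF inv_weight_pos_at] diag_bound_prod_nonneg) auto
    have sAB: "(\<lambda>l. ?A l * B) summable_on alldegs m"
      by (rule summable_on_cmult_left) (rule sA)
    have hsB: "((\<lambda>l. integ m (\<lambda>y. block f l y * phi m l' k' y)) has_sum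
        integ m (\<lambda>y. \<Sum>\<^sub>\<infinity>l\<in>alldegs m. block f l y * phi m l' k' y)) (alldegs m)"
      by (rule has_sum_integ(2)[OF _ bd sAB]) (intro continuous_on_mult block_cont phi_cont k')
    have hB: "integ m (\<lambda>y. \<Sum>\<^sub>\<infinity>l\<in>alldegs m. block f l y * phi m l' k' y) = integ m (\<lambda>y. h y * phi m l' k' y)"
      by (rule integ_cong, rule infsumI, rule has_sum_cmult_left, rule hs)
    have blk: "integ m (\<lambda>y. block f l y * phi m l' k' y) = (if l = l' then acoef P m (l', k') f else 0)"
      if l: "l \<in> alldegs m" for l
    proof -
      have "integ m (\<lambda>y. block f l y * phi m l' k' y) =
          integ m (\<lambda>y. \<Sum>k\<in>basis_idx CARD('n) m l. acoef P m (l, k) f * (phi m l k y * phi m l' k' y))"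
        by (simp add: block_def sum_distrib_right mult.assoc)
      also have "\<dots> = (\<Sum>k\<in>basis_idx CARD('n) m l. integ m (\<lambda>y. acoef P m (l, k) f * (phi m l k y
          * phi m l' k' y)))"
        by (intro integ_sum continuous_on_mult continuous_on_const phi_cont k')
      also have "\<dots> = (\<Sum>k\<in>basis_idx CARD('n) m l. if l = l' \<and> k = k' then acoef P m (l', k') f else 0)"
        unfolding integ_cmult by (intro sum.cong refl) (use l l' k' in \<open>auto simp: integ_phi_phi\<close>)
      also have "\<dots> = (if l = l' then acoef P m (l', k') f else 0)"
        using k' by (cases "l = l'") simp_all
      finally show ?thesis .
    qed
    have "((\<lambda>l. if l = l' then acoef P m (l', k') f else 0) has_sum integ m (\<lambda>y. h y
        * phi m l' k' y)) (alldegs m)"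
      using hsB unfolding hB by (rule has_sum_cong[THEN iffD1, rotated]) (rule blk)
    moreover have "((\<lambda>l. if l
        = l' then acoef P m (l', k') f else 0) has_sum acoef P m (l', k') f) (alldegs m)"
      by (rule has_sum_finite_neutralI[where B = "{l'}"]) (use l' in auto)
    ultimately have eq: "integ m (\<lambda>y. h y * phi m l' k' y) = integ m (\<lambda>y. f y * phi m l' k' y)"
      using has_sum_unique by (fastforce simp: acoef_eq)
    have "integ m (\<lambda>y. (h y - f y) * phi m l' k' y) = integ m (\<lambda>y. h y * phi m l' k' y - f y * phi m l' k' y)"
      by (simp add: left_diff_distrib)
    also have "\<dots> = 0"
      by (subst integ_diff) (use eq in \<open>auto intro!: continuous_on_mult hc fc phi_cont k'\<close>)
    finally show "integ m (\<lambda>y. (h y - f y) * phi m l' k' y) = 0" .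
  qed
  then show ?thesis using hs[OF x] by simp
qed

definition one_idx :: "nat \<Rightarrow> nat" where "one_idx = (\<lambda>j\<in>{1..m}. 1)"

lemma K_zero_degs: "basis_idx CARD('n) m (zero_degs m) = {one_idx}"
  by (simp add: basis_idx_zero_degs one_idx_def)

lemma phi_zero_degs_one_idx: "phi m (zero_degs m) one_idx x = 1"
  by (rule phi_zero_degs) (simp add: K_zero_degs)

lemma acoef_zero_degs: "acoef P m (zero_degs m, one_idx) f = integ m f"
  by (simp add: acoef_eq phi_zero_degs_one_idx)

lemma abs_integ_le_norm:
  assumes "f \<in> Hm P r g m"
  shows "\<bar>integ m f\<bar> \<le> norm_H P r g m f"
proof -
  have "(\<Sum>l\<in>{zero_degs m}. block_energy f l) \<le> (norm_H P r g m f)\<^sup>2"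
    by (rule sum_block_energy_le[OF assms]) auto
  then have "\<bar>integ m f\<bar>\<^sup>2 \<le> (norm_H P r g m f)\<^sup>2"
    by (simp add: block_energy_def Bprod_zero_degs K_zero_degs acoef_zero_degs)
  then show ?thesis by (rule power2_le_imp_le) (rule norm_H_nonneg)
qed

lemma discrepancy_nonneg: "discrepancy n t \<ge> 0"
  unfolding discrepancy_def by (intro infsum_nonneg mult_nonneg_nonneg sum_nonneg less_imp_le[OF
      inv_weight_pos_at]) auto

text \<open>The constant block of the expansion integrates exactly, and Cauchy--Schwarz bounds the contribution of
the others.\<close>

lemma qmc_error_le:
  assumes f: "f \<in> Hm P r g m" and n: "n \<ge> 1" and t: "\<And>i. i \<in> {1..n} \<Longrightarrow> t i \<in> domain m"
  shows "\<bar>integ m f - qmc n t f\<bar> \<le> norm_H P r g m f * sqrt (discrepancy n t) / real n"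
proof -
  let ?A = "alldegs m - {zero_degs m}"
  have "((\<lambda>l. block f l (t s)) has_sum (f (t s) - integ m f)) ?A" if s: "s \<in> {1..n}" for s
  proof -
    have "((\<lambda>l. block f l (t s)) has_sum (f (t s) - block f (zero_degs m) (t s))) ?A"
      by (rule has_sum_Diff[OF Hm_expansion[OF f t[OF s]]]) (auto intro: has_sum_finiteI)
    then show ?thesis by (simp add: block_def K_zero_degs acoef_zero_degs phi_zero_degs_one_idx)
  qed
  then have "((\<lambda>l. \<Sum>s=1..n. block f l (t s)) has_sum (\<Sum>s=1..n. f (t s) - integ m f)) ?A"
    by (rule has_sum_sum_finite)
  moreover have "(\<Sum>s=1..n. block f l (t s))
      = (\<Sum>k\<in>basis_idx CARD('n) m l. acoef P m (l, k) f * point_sum n t l k)" for l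
    unfolding block_def point_sum_def by (subst sum.swap) (simp add: sum_distrib_left)
  moreover have "(\<Sum>s=1..n. f (t s) - integ m f) = real n * (qmc n t f - integ m f)"
    using n by (simp add: sum_subtractf qmc_def right_diff_distrib)
  ultimately have hs: "((\<lambda>l. \<Sum>k\<in>basis_idx CARD('n) m l. acoef P m (l, k) f * point_sum n t l k)
      has_sum real n * (qmc n t f - integ m f)) ?A"
    by simp
  have bound: "\<bar>\<Sum>l\<in>G. \<Sum>k\<in>basis_idx CARD('n) m l. acoef P m (l, k) f * point_sum n t l k\<bar>
      \<le> norm_H P r g m f * sqrt (discrepancy n t)"
    if G: "finite G" "G \<subseteq> ?A" for G
  proof -
    let ?SG = "Sigma G (basis_idx CARD('n) m)"
    let ?BP = "Bprod CARD('n) r g m" and ?BI = "inv_weight_prod CARD('n) r g m"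
    have "sqrt (?BP l) * sqrt (?BI l) = 1" for l by (simp add: weight_mult_inv_at flip: real_sqrt_mult)
    then have cancel: "(sqrt (?BP l) * a) * (sqrt (?BI l) * b) = a * b" for l a b
      by (metis mult.assoc mult.commute mult.left_neutral)
    have s1: "(\<Sum>l\<in>G. \<Sum>k\<in>basis_idx CARD('n) m l. acoef P m (l, k) f * point_sum n t l k) =
        (\<Sum>i\<in>?SG. (sqrt (?BP (fst i)) * acoef P m i f) * (sqrt (?BI (fst i)) * point_sum n t (fst i) (snd i)))"
      unfolding cancel using G by (subst sum.Sigma) (auto simp: case_prod_beta)
    have s2: "(\<Sum>i\<in>?SG. (sqrt (?BP (fst i)) * acoef P m i f)\<^sup>2) = (\<Sum>l\<in>G. block_energy f l)"
    proof -
      have "(\<Sum>l\<in>G. block_energy f l) = (\<Sum>i\<in>?SG. ?BP (fst i) * (acoef P m i f)\<^sup>2)"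
        unfolding block_energy_def sum_distrib_left using G by (subst sum.Sigma) (auto simp: case_prod_beta)
      then show ?thesis by (simp add: power_mult_distrib less_imp_le[OF weight_pos_at])
    qed
    have s3: "(\<Sum>i\<in>?SG. (sqrt (?BI (fst i)) * point_sum n t (fst i) (snd i))\<^sup>2) =
        (\<Sum>l\<in>G. ?BI l * (\<Sum>k\<in>basis_idx CARD('n) m l. (point_sum n t l k)\<^sup>2))"
    proof -
      have "(\<Sum>l\<in>G. ?BI l * (\<Sum>k\<in>basis_idx CARD('n) m l. (point_sum n t l k)\<^sup>2)) =
          (\<Sum>i\<in>?SG. ?BI (fst i) * (point_sum n t (fst i) (snd i))\<^sup>2)"
        unfolding sum_distrib_left using G by (subst sum.Sigma) (auto simp: case_prod_beta)
      then show ?thesis by (simp add: power_mult_distrib less_imp_le[OF inv_weight_pos_at])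
    qed
    have "(\<Sum>l\<in>G. \<Sum>k\<in>basis_idx CARD('n) m l. acoef P m (l, k) f * point_sum n t l k)\<^sup>2 \<le>
        (\<Sum>l\<in>G. block_energy f l) * (\<Sum>l\<in>G. ?BI l * (\<Sum>k\<in>basis_idx CARD('n) m l. (point_sum n t l k)\<^sup>2))"
      unfolding s1 s2[symmetric] s3[symmetric] by (rule Cauchy_Schwarz_ineq_sum)
    also have "(\<Sum>l\<in>G. block_energy f l) * (\<Sum>l\<in>G. inv_weight_prod CARD('n) r g m l *
        (\<Sum>k\<in>basis_idx CARD('n) m l. (point_sum n t l k)\<^sup>2)) \<le> (norm_H P r g m f)\<^sup>2 * discrepancy n t"
    proof (rule mult_mono)
      show "(\<Sum>l\<in>G. block_energy f l)
          \<le> (norm_H P r g m f)\<^sup>2" by (rule sum_block_energy_le[OF f]) (use G in auto)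
      show "(\<Sum>l\<in>G. inv_weight_prod CARD('n) r g m l * (\<Sum>k\<in>basis_idx CARD('n) m l. (point_sum n t l k)\<^sup>2))
          \<le> discrepancy n t"
        unfolding discrepancy_def
        by (rule finite_sum_le_infsum[OF summable_discrepancy[OF t] G])
           (auto intro!: mult_nonneg_nonneg sum_nonneg less_imp_le[OF inv_weight_pos_at])
      show "0 \<le> (\<Sum>l\<in>G. inv_weight_prod CARD('n) r g m l * (\<Sum>k\<in>basis_idx CARD('n) m l. (point_sum n t l k)\<^sup>2))"
        by (intro sum_nonneg mult_nonneg_nonneg less_imp_le[OF inv_weight_pos_at]) auto
    qed auto
    also have "\<dots> = (norm_H P r g m f * sqrt (discrepancy n t))\<^sup>2"
        by (simp add: power_mult_distrib discrepancy_nonneg)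
    finally have "\<bar>\<Sum>l\<in>G. \<Sum>k\<in>basis_idx CARD('n) m l. acoef P m (l, k) f * point_sum n t l k\<bar>\<^sup>2
        \<le> (norm_H P r g m f * sqrt (discrepancy n t))\<^sup>2" by simp
    then show ?thesis by (rule power2_le_imp_le) (intro mult_nonneg_nonneg norm_H_nonneg real_sqrt_ge_zero
        discrepancy_nonneg)
  qed
  have "real n * (qmc n t f - integ m f) \<le> norm_H P r g m f * sqrt (discrepancy n t)"
    by (rule has_sum_le_finite_sums[OF hs]) (use bound in \<open>fastforce simp: abs_le_iff\<close>)
  moreover have "- (real n * (qmc n t f - integ m f)) \<le> norm_H P r g m f * sqrt (discrepancy n t)"
  proof (rule has_sum_le_finite_sums)
    show "((\<lambda>l. - (\<Sum>k\<in>basis_idx CARD('n) m l. acoef P m (l, k) f * point_sum n t l k)) has_sum - (real n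
        * (qmc n t f - integ m f))) ?A"
      using hs by (simp add: has_sum_uminus)
  qed (use bound in \<open>fastforce simp: abs_le_iff sum_negf\<close>)
  ultimately have "\<bar>real n * (qmc n t f - integ m f)\<bar> \<le> norm_H P r g m f * sqrt (discrepancy n t)" by linarith
  then show ?thesis using n by (simp add: abs_mult abs_minus_commute pos_le_divide_eq mult.commute)
qed

text \<open>Finite Fourier sums are the only functions whose membership in \<open>Hm\<close> is ever needed: they contain the
constant 1 and the fooling functions for the lower bound.\<close>

definition finite_expansion :: "nat \<Rightarrow> ((nat \<Rightarrow> nat) \<Rightarrow> (nat \<Rightarrow> nat) \<Rightarrow> real) \<Rightarrow> (nat \<Rightarrow> real ^ 'n) \<Rightarrow> real" where
  "finite_expansion L a x = (\<Sum>l\<in>degs m L. \<Sum>k\<in>basis_idx CARD('n) m l. a l k * phi m l k x)"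

lemma finite_expansion_cont: "continuous_on A (finite_expansion L a)"
  unfolding finite_expansion_def by (intro continuous_on_sum continuous_on_mult continuous_on_const phi_cont)

lemma acoef_finite_expansion:
  assumes l': "l' \<in> alldegs m" and k': "k' \<in> basis_idx CARD('n) m l'"
  shows "acoef P m (l', k') (finite_expansion L a) = (if l' \<in> degs m L then a l' k' else 0)"
proof -
  have "acoef P m (l', k') (finite_expansion L a) =
      integ m (\<lambda>x. \<Sum>l\<in>degs m L. \<Sum>k\<in>basis_idx CARD('n) m l. a l k * (phi m l k x * phi m l' k' x))"
    by (simp add: acoef_eq finite_expansion_def sum_distrib_right mult.assoc)
  also have "\<dots> = (\<Sum>l\<in>degs m L. integ m (\<lambda>x. \<Sum>k\<in>basis_idx CARD('n) m l. a l k * (phi m l k x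
      * phi m l' k' x)))"
    by (intro integ_sum continuous_on_sum continuous_on_mult continuous_on_const phi_cont k')
  also have "\<dots> = (\<Sum>l\<in>degs m L. \<Sum>k\<in>basis_idx CARD('n) m l. integ m (\<lambda>x. a l k * (phi m l k x
      * phi m l' k' x)))"
    by (rule sum.cong[OF refl]) (intro integ_sum continuous_on_mult continuous_on_const phi_cont k')
  also have "\<dots> = (\<Sum>l\<in>degs m L. \<Sum>k\<in>basis_idx CARD('n) m l. if l = l' \<and> k = k' then a l' k' else 0)"
    unfolding integ_cmult
    by (intro sum.cong refl) (use l' k' degs_subset in \<open>auto simp: integ_phi_phi subset_iff\<close>)
  also have "\<dots> = (\<Sum>l\<in>degs m L. if l = l' then a l' k' else 0)"
    by (intro sum.cong refl) (use k' in \<open>auto simp: if_distrib cong: if_cong\<close>)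
  also have "\<dots> = (if l' \<in> degs m L then a l' k' else 0)" by simp
  finally show ?thesis .
qed

lemma inner_finite_expansion:
  "((\<lambda>i. Bprod CARD('n) r g m (fst i) * (acoef P m i (finite_expansion L a))\<^sup>2) has_sum
      (\<Sum>l\<in>degs m L. \<Sum>k\<in>basis_idx CARD('n) m l. Bprod CARD('n) r g m l * (a l k)\<^sup>2))
     (multi_idx CARD('n) m)"
proof (rule has_sum_finite_neutralI[where B = "Sigma (degs m L) (basis_idx CARD('n) m)"])
  show "Sigma (degs m L) (basis_idx CARD('n) m) \<subseteq> multi_idx CARD('n) m"
    using degs_subset by (auto simp: multi_idx_eq)
  show "Bprod CARD('n) r g m (fst i) * (acoef P m i (finite_expansion L a))\<^sup>2 = 0"
    if "i \<in> multi_idx CARD('n) m - Sigma (degs m L) (basis_idx CARD('n) m)" for i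
    using that by (cases i) (auto simp: multi_idx_eq acoef_finite_expansion)
  have "(\<Sum>i\<in>Sigma (degs m L) (basis_idx CARD('n) m). Bprod CARD('n) r g m (fst i)
      * (acoef P m i (finite_expansion L a))\<^sup>2) =
      (\<Sum>l\<in>degs m L. \<Sum>k\<in>basis_idx CARD('n) m l. Bprod CARD('n) r g m l
          * (acoef P m (l, k) (finite_expansion L a))\<^sup>2)"
    by (subst sum.Sigma) (auto simp: case_prod_beta)
  also have "\<dots> = (\<Sum>l\<in>degs m L. \<Sum>k\<in>basis_idx CARD('n) m l. Bprod CARD('n) r g m l * (a l k)\<^sup>2)"
    using degs_subset by (intro sum.cong refl) (auto simp: acoef_finite_expansion subset_iff)
  finally show "(\<Sum>l\<in>degs m L. \<Sum>k\<in>basis_idx CARD('n) m l. Bprod CARD('n) r g m l * (a l k)\<^sup>2) =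
      (\<Sum>i\<in>Sigma (degs m L) (basis_idx CARD('n) m). Bprod CARD('n) r g m (fst i)
          * (acoef P m i (finite_expansion L a))\<^sup>2)" by simp
qed auto

lemma norm_finite_expansion: "norm_H P r g m (finite_expansion L a)
    = sqrt (\<Sum>l\<in>degs m L. \<Sum>k\<in>basis_idx CARD('n) m l. Bprod CARD('n) r g m l * (a l k)\<^sup>2)"
  unfolding norm_H_def inner_H_def using infsumI[OF inner_finite_expansion[of L a]]
  by (simp add: power2_eq_square mult.assoc)

lemma cmult_P_in_H1:
  assumes k: "k \<in> {1..rdim CARD('n) l}"
  shows "(\<lambda>x. a * P l k x) \<in> H1 P r b"
  unfolding H1_def
proof (intro CollectI conjI)
  show "continuous_on Td (\<lambda>x. a * P l k x)" by (intro continuous_on_mult continuous_on_const P_cont k)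
  have "ip (\<lambda>x. a * P l k x) (P l' k') = 0" if "l' \<noteq> l" "k' \<in> {1..rdim CARD('n) l'}" for l' k'
  proof -
    have "ip (P l' k') (\<lambda>x. a * P l k x) = 0"
      unfolding ip_cmult_right using that k by (simp add: ip_P_P)
    then show ?thesis by (subst ip_commute)
  qed
  then show "summable (\<lambda>l'. \<Sum>k'=1..rdim CARD('n) l'. Bcoef CARD('n) r b l' * (ip (\<lambda>x. a
      * P l k x) (P l' k'))\<^sup>2)"
    by (intro summable_finite[of "{l}"]) auto
qed

text \<open>Each term of the sum is a product of functions of one block; its coefficient is attached to the first
factor, which exists as \<open>m \<ge> 1\<close>.\<close>

lemma finite_expansion_in_alg_tensor:
  assumes m: "m \<ge> 1"
  shows "finite_expansion L a \<in> alg_tensor P r g m"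
proof -
  let ?I = "Sigma (degs m L) (basis_idx CARD('n) m)"
  have fin: "finite ?I" by auto
  obtain e where e: "bij_betw e {0..<card ?I} ?I"
    using ex_bij_betw_nat_finite[OF fin] by blast
  define h where "h = (\<lambda>i j x. (if j
      = 1 then a (fst (e i)) (snd (e i)) else 1) * P (fst (e i) j) (snd (e i) j) x)"
  have prod_h: "(\<Prod>j=1..m. h i j (x j)) = a (fst (e i)) (snd (e i)) * phi m (fst (e i)) (snd (e i)) x" for i x
    using m by (simp add: h_def prod.distrib phi_def prod.delta)
  have "finite_expansion L a x = (\<Sum>i<card ?I. \<Prod>j=1..m. h i j (x j))" for x
  proof -
    have "finite_expansion L a x = (\<Sum>i\<in>?I. a (fst i) (snd i) * phi m (fst i) (snd i) x)"
      unfolding finite_expansion_def by (subst sum.Sigma) (auto simp: case_prod_beta)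
    also have "\<dots> = (\<Sum>i\<in>{0..<card ?I}. a (fst (e i)) (snd (e i)) * phi m (fst (e i)) (snd (e i)) x)"
      by (rule sum.reindex_bij_betw[OF e, symmetric])
    finally show ?thesis by (simp only: prod_h atLeast0LessThan)
  qed
  moreover have "h i j \<in> H1 P r (g j)" if i: "i < card ?I" and j: "j \<in> {1..m}" for i j
  proof -
    have "e i \<in> ?I" using bij_betwE[OF e] i by auto
    then have "snd (e i) \<in> basis_idx CARD('n) m (fst (e i))" by auto
    from cmult_P_in_H1[OF basis_idx_memD[OF this j]] show ?thesis unfolding h_def by blast
  qed
  ultimately show ?thesis
    unfolding alg_tensor_def by (intro CollectI exI[of _ "card ?I"] exI[of _ h]) auto
qed

lemma finite_expansion_in_Hm:
  assumes m: "m \<ge> 1"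
  shows "finite_expansion L a \<in> Hm P r g m"
  unfolding Hm_def
proof (intro CollectI conjI allI impI)
  show "continuous_on (domain m) (finite_expansion L a)" by (rule finite_expansion_cont)
  show "(\<lambda>i. Bprod CARD('n) r g m (fst i)
      * (acoef P m i (finite_expansion L a))\<^sup>2) summable_on multi_idx CARD('n) m"
    using inner_finite_expansion by (rule has_sum_imp_summable)
  fix \<epsilon> :: real assume "\<epsilon> > 0"
  have "acoef P m i (\<lambda>x. 0) = 0" for i
    by (cases i) (simp add: acoef_eq integ_zero)
  then have "norm_H P r g m (\<lambda>x. finite_expansion L a x - finite_expansion L a x) = 0"
    by (simp add: norm_H_def inner_H_def)
  then show "\<exists>h\<in>alg_tensor P r g m. norm_H P r g m (\<lambda>x. finite_expansion L a x - h x) < \<epsilon>"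
    using finite_expansion_in_alg_tensor[OF m] \<open>\<epsilon> > 0\<close> by (intro bexI[of _ "finite_expansion L a"]) auto
qed

lemma const_one_finite_expansion: "finite_expansion 0 (\<lambda>_ _. 1) = (\<lambda>x. 1)"
proof -
  have "degs m 0 = {zero_degs m}"
    by (auto simp: degs_def zero_degs_def PiE_def Pi_def extensional_def fun_eq_iff)
  then show ?thesis by (auto simp: finite_expansion_def K_zero_degs phi_zero_degs_one_idx)
qed

lemma one_in_unit_ball:
  assumes "m \<ge> 1" shows "(\<lambda>x. 1) \<in> {f \<in> Hm P r g m. norm_H P r g m f \<le> 1}"
proof -
  have "degs m 0 = {zero_degs m}"
    by (auto simp: degs_def zero_degs_def PiE_def Pi_def extensional_def fun_eq_iff)
  then have "norm_H P r g m (finite_expansion 0 (\<lambda>_ _. 1)) = 1"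
    by (simp add: norm_finite_expansion K_zero_degs Bprod_zero_degs)
  then show ?thesis using finite_expansion_in_Hm[OF assms, of 0 "\<lambda>_ _. 1"]
      by (simp add: const_one_finite_expansion)
qed

lemma init_error_eq_1:
  assumes m: "m \<ge> 1" shows "init_error P r g m = 1"
proof (rule antisym)
  show "init_error P r g m \<le> 1"
    unfolding init_error_def
    by (rule cSUP_least) (use one_in_unit_ball[OF m] abs_integ_le_norm in force)+
  have "1 = \<bar>integ m (\<lambda>x :: nat \<Rightarrow> real ^ 'n. 1)\<bar>" by (simp add: integ_const)
  also have "\<dots> \<le> init_error P r g m"
    unfolding init_error_def
    by (rule cSUP_upper[OF one_in_unit_ball[OF m]])
       (use abs_integ_le_norm in \<open>force intro!: bdd_aboveI2[where M = 1]\<close>)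
  finally show "1 \<le> init_error P r g m" .
qed

lemma wce_le:
  assumes m: "m \<ge> 1" and n: "n \<ge> 1" and t: "\<And>i. i \<in> {1..n} \<Longrightarrow> t i \<in> domain m"
  shows "wce P r g m n t \<le> sqrt (discrepancy n t) / real n"
  unfolding wce_def
proof (rule cSUP_least)
  fix f assume "f \<in> {f \<in> Hm P r g m. norm_H P r g m f \<le> 1}"
  then have f: "f \<in> Hm P r g m" "norm_H P r g m f \<le> 1" by auto
  have "\<bar>integ m f - qmc n t f\<bar> \<le> norm_H P r g m f * sqrt (discrepancy n t) / real n"
    by (rule qmc_error_le[OF f(1) n t])
  also have "\<dots> \<le> 1 * sqrt (discrepancy n t) / real n"
    by (intro divide_right_mono mult_right_mono f real_sqrt_ge_zero discrepancy_nonneg) auto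
  finally show "\<bar>integ m f - qmc n t f\<bar> \<le> sqrt (discrepancy n t) / real n" by simp
qed (use one_in_unit_ball[OF m] in auto)

lemma wce_ge:
  assumes n: "n \<ge> 1" and t: "\<And>i. i \<in> {1..n} \<Longrightarrow> t i \<in> domain m"
    and f: "f \<in> Hm P r g m" "norm_H P r g m f \<le> 1"
  shows "\<bar>integ m f - qmc n t f\<bar> \<le> wce P r g m n t"
  unfolding wce_def
proof (rule cSUP_upper)
  show "bdd_above ((\<lambda>f. \<bar>integ m f - qmc n t f\<bar>) ` {f \<in> Hm P r g m. norm_H P r g m f \<le> 1})"
  proof (rule bdd_aboveI2)
    fix f assume "f \<in> {f \<in> Hm P r g m. norm_H P r g m f \<le> 1}"
    then have f: "f \<in> Hm P r g m" "norm_H P r g m f \<le> 1" by auto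
    have "\<bar>integ m f - qmc n t f\<bar> \<le> norm_H P r g m f * sqrt (discrepancy n t) / real n"
      by (rule qmc_error_le[OF f(1) n t])
    also have "\<dots> \<le> 1 * sqrt (discrepancy n t) / real n"
      by (intro divide_right_mono mult_right_mono f real_sqrt_ge_zero discrepancy_nonneg) auto
    finally show "\<bar>integ m f - qmc n t f\<bar> \<le> 1 * sqrt (discrepancy n t) / real n" .
  qed
qed (use f in auto)

lemma wce_0: "wce P r g m 0 t = init_error P r g m"
  by (simp add: wce_def init_error_def qmc_def)

lemma trace_bound_ge_1: "trace_bound \<ge> 1"
  unfolding trace_bound_def by (intro prod_ge_1) (auto intro!: mult_nonneg_nonneg cdr_nonneg
      less_imp_le[OF g_pos])

text \<open>The upper bound for the information complexity. Rounding up costs nothing: with \<open>\<epsilon> < 1\<close>, the extra 1 is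
absorbed by the difference between \<open>trace_bound\<close> and \<open>trace_bound - 1\<close>.\<close>

lemma exists_admissible:
  assumes m: "m \<ge> 1" and eps: "0 < \<epsilon>" "\<epsilon> < 1"
  shows "\<exists>n t. (\<forall>i\<in>{1..n}. t i \<in> domain m) \<and> wce P r g m n t \<le> \<epsilon> * init_error P r g m \<and>
     real n \<le> trace_bound / \<epsilon>\<^sup>2"
proof -
  \<comment> \<open>At least one point, as the empty rule is defined differently.\<close>
  define n where "n = max 1 (nat \<lceil>(trace_bound - 1) / \<epsilon>\<^sup>2\<rceil>)"
  have e2: "0 < \<epsilon>\<^sup>2" "\<epsilon>\<^sup>2 < 1" using eps by (auto simp: power_less_one_iff)
  have n1: "n \<ge> 1" by (simp add: n_def)
  obtain t where t: "\<forall>i\<in>{1..n}. t i \<in> domain m" "discrepancy n t \<le> real n * (trace_bound - 1)"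
    using exists_good_points[of n] by blast
  have nl: "real n \<ge> (trace_bound - 1) / \<epsilon>\<^sup>2" unfolding n_def by linarith
  have "discrepancy n t \<le> real n * (real n * \<epsilon>\<^sup>2)"
    using t(2) nl e2 by (smt (verit, best) mult_left_mono of_nat_0_le_iff pos_divide_le_eq)
  then have "sqrt (discrepancy n t) \<le> sqrt ((real n * \<epsilon>)\<^sup>2)"
    by (simp add: power2_eq_square mult_ac)
  also have "\<dots> = real n * \<epsilon>" using eps by (simp add: abs_mult)
  finally have "sqrt (discrepancy n t) / real n \<le> \<epsilon>" using n1 by (simp add: field_simps)
  then have "wce P r g m n t \<le> \<epsilon> * init_error P r g m"
    using wce_le[OF m n1, of t] t(1) by (simp add: init_error_eq_1[OF m])
  moreover have "real n \<le> trace_bound / \<epsilon>\<^sup>2"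
  proof (cases "nat \<lceil>(trace_bound - 1) / \<epsilon>\<^sup>2\<rceil> \<ge> 1")
    case True
    then have "real n \<le> (trace_bound - 1) / \<epsilon>\<^sup>2 + 1" unfolding n_def by linarith
    moreover have "1 \<le> 1 / \<epsilon>\<^sup>2" using e2 by (simp add: field_simps)
    ultimately show ?thesis by (simp add: diff_divide_distrib)
  next
    case False
    then have "n = 1" by (simp add: n_def)
    moreover have "\<epsilon>\<^sup>2 \<le> trace_bound" using trace_bound_ge_1 e2 by linarith
    ultimately show ?thesis using e2 by (simp add: field_simps)
  qed
  ultimately show ?thesis using t(1) by blast
qed

end

section \<open>Worst-case error: lower bound\<close>

context simplex_space
begin

text \<open>The terms of degrees 1 and 2 of the reproducing kernel. Degree 1 alone is not enough: at the centroid
of the simplex all polynomials in \<open>orth_poly_space 1\<close> vanish.\<close>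

definition low_kernel :: "real ^ 'n \<Rightarrow> real ^ 'n \<Rightarrow> real" where
  "low_kernel x y = (\<Sum>l=1..2. decay CARD('n) r l * Pker P l x y)"

text \<open>The bound on the kernel is one-sided; Cauchy--Schwarz and its instances on the diagonal give the
other side.\<close>

lemma abs_Pker_le:
  assumes "l \<ge> 1" "x \<in> Td" "y \<in> Td"
  shows "\<bar>Pker P l x y\<bar> \<le> diag_bound l"
proof -
  have "(Pker P l x y)\<^sup>2 \<le> Pker P l x x * Pker P l y y"
    unfolding Pker_diag by (simp only: Pker_def Cauchy_Schwarz_ineq_sum)
  also have "\<dots> \<le> diag_bound l * diag_bound l"
    unfolding Pker_diag by (intro mult_mono Pker_diag_le assms sum_nonneg diag_bound_nonneg) auto
  finally have "\<bar>Pker P l x y\<bar>\<^sup>2 \<le> (diag_bound l)\<^sup>2" by (simp add: power2_eq_square)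
  then show ?thesis by (rule power2_le_imp_le) (rule diag_bound_nonneg)
qed

lemma abs_low_kernel_le:
  assumes "x \<in> Td" "y \<in> Td"
  shows "\<bar>low_kernel x y\<bar> \<le> cdr CARD('n) r M"
proof -
  have "\<bar>low_kernel x y\<bar> \<le> (\<Sum>l=1..2. \<bar>decay CARD('n) r l * Pker P l x y\<bar>)"
    unfolding low_kernel_def by (rule sum_abs)
  also have "\<dots> \<le> (\<Sum>l=1..2. diag_bound l * decay CARD('n) r l)"
  proof (rule sum_mono)
    fix l :: nat assume "l \<in> {1..2}"
    then have "\<bar>Pker P l x y\<bar> \<le> diag_bound l" by (intro abs_Pker_le assms) auto
    from mult_left_mono[OF this decay_nonneg[of "CARD('n)" r l]]
    show "\<bar>decay CARD('n) r l * Pker P l x y\<bar> \<le> diag_bound l * decay CARD('n) r l"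
      by (simp add: abs_mult decay_nonneg mult.commute)
  qed
  also have "\<dots> \<le> cdr CARD('n) r M" by (rule sum_decay_le_cdr) auto
  finally show ?thesis .
qed

lemma low_kernel_diag: "low_kernel x x = (\<Sum>l=1..2. decay CARD('n) r l * (\<Sum>k=1..rdim CARD('n) l. (P l k x)\<^sup>2))"
  by (simp add: low_kernel_def Pker_diag)

text \<open>If all basis elements of degrees 1
    and 2 vanished at \<open>x\<close>, every polynomial of degree at most 2 would have
its value at \<open>x\<close> as its mean. The polynomial \<open>|y - x|\<^sup>2\<close> would then have mean zero and vanish on the
whole simplex.\<close>

lemma low_kernel_diag_pos: "low_kernel x x > 0"
proof (rule ccontr)
  assume "\<not> low_kernel x x > 0"
  moreover have nn: "decay CARD('n) r l * (\<Sum>k=1..rdim CARD('n) l. (P l k x)\<^sup>2) \<ge> 0" for l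
    by (intro mult_nonneg_nonneg decay_nonneg sum_nonneg) auto
  ultimately have "(\<Sum>l=1..2. decay CARD('n) r l * (\<Sum>k=1..rdim CARD('n) l. (P l k x)\<^sup>2)) = 0"
    unfolding low_kernel_diag using sum_nonneg[of "{1..2::nat}", OF nn] by (meson antisym not_less)
  then have "decay CARD('n) r l * (\<Sum>k=1..rdim CARD('n) l. (P l k x)\<^sup>2) = 0" if "l \<in> {1..2}" for l
    using sum_nonneg_eq_0_iff[of "{1..2::nat}" "\<lambda>l. decay CARD('n) r l *
        (\<Sum>k=1..rdim CARD('n) l. (P l k x)\<^sup>2)"] nn that
    by blast
  then have "(\<Sum>k=1..rdim CARD('n) l. (P l k x)\<^sup>2) = 0" if "l \<in> {1..2}" for l
    using that decay_pos[of l "CARD('n)" r] by fastforce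
  then have P0: "P l k x = 0" if "l \<in> {1..2}" "k \<in> {1..rdim CARD('n) l}" for l k
    using that sum_nonneg_eq_0_iff[of "{1..rdim CARD('n) l}" "\<lambda>k. (P l k x)\<^sup>2"] by fastforce
  \<comment> \<open>The polynomial \<open>|y - x|\<^sup>2\<close>.\<close>
  define f where "f = (\<lambda>y :: real ^ 'n. \<Sum>i\<in>UNIV. (y $ i - x $ i) * (y $ i - x $ i))"
  have "f \<in> poly_deg_le (1 + 1)"
    unfolding f_def
    by (intro poly_deg_le_sum poly_deg_le_mult poly_deg_le_diff poly_deg_le_coord poly_deg_le_const)
  then have f2: "f \<in> poly_deg_le 2" by (simp add: nat_1_add_1)
  from poly_deg_le_P_expansion[OF f2]
  obtain c where c: "f = (\<lambda>y. \<Sum>l\<le>2. \<Sum>k=1..rdim CARD('n) l. c l k * P l k y)" by blast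
  have split: "(\<Sum>l\<le>2. F l) = F 0 + (\<Sum>l=1..2. F l)" for F :: "nat \<Rightarrow> real"
    by (simp add: atMost_atLeast0 sum.atLeast_Suc_atMost One_nat_def)
  have "f x = c 0 1"
    unfolding c split using P0 by (simp add: rdim_0 P_0_1)
  then have c0: "c 0 1 = 0" by (simp add: f_def)
  have fc: "continuous_on A f" for A by (rule poly_deg_le_continuous[OF f2])
  have one: "1 \<in> {1..rdim CARD('n) 0}" by (simp add: rdim_0)
  have "ip (P 0 1) f = (\<Sum>l\<le>2. ip (P 0 1) (\<lambda>y. \<Sum>k=1..rdim CARD('n) l. c l k * P l k y))"
    unfolding c
    by (rule ip_sum_right[OF P_cont[OF one]]) (intro continuous_on_sum continuous_on_mult
        continuous_on_const P_cont)
  also have "\<dots> = (\<Sum>l\<le>2. \<Sum>k=1..rdim CARD('n) l. ip (P 0 1) (\<lambda>y. c l k * P l k y))"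
    by (rule sum.cong[OF refl], rule ip_sum_right[OF P_cont[OF one]]) (intro continuous_on_mult
        continuous_on_const P_cont)
  also have "\<dots> = (\<Sum>l\<le>2. \<Sum>k=1..rdim CARD('n) l. if l = 0 \<and> k = 1 then c 0 1 else 0)"
    unfolding ip_cmult_right by (intro sum.cong refl) (use one in \<open>auto simp: ip_P_P\<close>)
  also have "\<dots> = 0" by (intro sum.neutral ballI) (use c0 in auto)
  finally have "ip (P 0 1) f = 0" .
  then have "fact CARD('n) * (LINT y:Td|lborel. f y) = 0" by (simp add: ip_def P_0_1)
  moreover have "integ 1 (\<lambda>z. \<Prod>j=1..1. f (z j)) = (\<Prod>j=1..1::nat. fact CARD('n) * (LINT y:Td|lborel. f y))"
    by (rule integ_prod) (rule fc)
  ultimately have int0: "integ 1 (\<lambda>z. f (z 1)) = 0" by simp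
  have f0: "f y = 0" if y: "y \<in> Td" for y
  proof -
    define z where "z = (\<lambda>j\<in>{1..1::nat}. y)"
    have "f (z 1) = 0"
    proof (rule integ_nonneg_eq_0[OF _ _ int0])
      show "continuous_on (domain 1) (\<lambda>z. f (z 1))" by (rule continuous_on_coord_comp) (rule fc)
      show "0 \<le> f (z 1)" for z by (auto simp: f_def intro!: sum_nonneg)
      show "z \<in> domain 1" using y by (auto simp: z_def domain_def)
    qed
    then show ?thesis by (simp add: z_def)
  qed
  have eq: "y = x" if "y \<in> Td" for y
  proof -
    have "(\<Sum>i\<in>UNIV. (y $ i - x $ i) * (y $ i - x $ i)) = 0" using f0[OF that] by (simp add: f_def)
    then have "\<forall>i\<in>UNIV. (y $ i - x $ i) * (y $ i - x $ i) = 0"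
      by (subst (asm) sum_nonneg_eq_0_iff) auto
    then show ?thesis by (simp add: vec_eq_iff)
  qed
  have "axis i 1 \<in> (Td :: (real ^ 'n) set)" for i
    by (auto simp: Td_def axis_def)
  then have "axis undefined 1 = x" by (rule eq)
  moreover have "0 = x" by (rule eq) (rule zero_in_Td)
  ultimately have "(axis undefined 1 :: real ^ 'n) $ undefined = 0" by (metis zero_index)
  then show False by simp
qed

lemma low_kernel_diag_lower_bound: "\<exists>\<kappa>>0. \<forall>x\<in>Td. low_kernel x x \<ge> \<kappa>"
proof -
  have "continuous_on Td (\<lambda>x. low_kernel x x)"
    unfolding low_kernel_diag
    by (intro continuous_on_sum continuous_on_mult continuous_on_const continuous_on_power P_cont)
  moreover have "(Td :: (real ^ 'n) set) \<noteq> {}" using zero_in_Td by blast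
  ultimately obtain x where "\<forall>y\<in>Td. low_kernel x x \<le> low_kernel y y"
    using continuous_attains_inf[OF compact_Td] by blast
  then show ?thesis using low_kernel_diag_pos[of x] by blast
qed

end

context simplex_weighted
begin

text \<open>The fooling function is the normalised representer of the quadrature error in the subspace of degrees
at most 2, for the smaller weights \<open>a * g j\<close>. For these weights the kernel is non-negative, so only the
diagonal terms of its double sum over the points are kept.\<close>

lemma wce_lower_bound:
  assumes m: "m \<ge> 1" and n: "n \<ge> 1" and t: "\<And>i. i \<in> {1..n} \<Longrightarrow> t i \<in> domain m"
    and a: "0 < a" "a \<le> 1"
    and nonneg: "\<And>j x y. j \<in> {1..m} \<Longrightarrow> x \<in> Td \<Longrightarrow> y \<in> Td \<Longrightarrow> 1 + a * g j * low_kernel x y \<ge> 0"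
    and \<kappa>: "\<kappa> \<ge> 0" "\<And>x. x \<in> Td \<Longrightarrow> low_kernel x x \<ge> \<kappa>"
  shows "(\<Prod>j=1..m. 1 + a * g j * \<kappa>) / real n - 1 \<le> (wce P r g m n t)\<^sup>2"
proof -
  define BA where "BA = inv_weight_prod CARD('n) r (\<lambda>j. a * g j) m"
  have BA_pos: "BA l > 0" for l
    unfolding BA_def by (rule inv_weight_prod_pos) (use a g_pos in auto)
  have BA_zero_degs: "BA (zero_degs m) = 1" by (simp add: BA_def inv_weight_prod_zero_degs)
  \<comment> \<open>Passing from the weights \<open>a * g j\<close> to \<open>g j\<close> does not increase the norm.\<close>
  have BP_BA: "Bprod CARD('n) r g m l * BA l \<le> 1" for l
  proof -
    have "inv_weight CARD('n) r (a * g j) (l j) \<le> inv_weight CARD('n) r (g j) (l j)" if "j \<in> {1..m}" for j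
      using a g_pos[OF that] decay_nonneg[of "CARD('n)" r "l j"]
      by (auto simp: inv_weight_def mult_left_le_one_le intro!: mult_right_mono)
    then have "BA l \<le> inv_weight_prod CARD('n) r g m l"
      unfolding BA_def inv_weight_prod_def
      by (intro prod_mono conjI less_imp_le[OF inv_weight_pos] mult_pos_pos a g_pos) auto
    then have "Bprod CARD('n) r g m l * BA l
        \<le> Bprod CARD('n) r g m l * inv_weight_prod CARD('n) r g m l"
        by (intro mult_left_mono less_imp_le[OF weight_pos_at])
    then show ?thesis by (simp add: weight_mult_inv_at)
  qed
  \<comment> \<open>The squared error of the points in the truncated space; the test function built below has the error \<open>sqrt E2\<close>.\<close>
  define E2 where "E2 = (\<Sum>l\<in>degs m 2 - {zero_degs m}. \<Sum>k\<in>basis_idx CARD('n) m l. BA l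
      * (point_sum n t l k / real n)\<^sup>2)"
  have E2_nn: "E2 \<ge> 0"
    unfolding E2_def by (intro sum_nonneg mult_nonneg_nonneg less_imp_le[OF BA_pos]) auto
  \<comment> \<open>The product kernel of the truncated space with the smaller weights.\<close>
  have kernel: "(\<Sum>l\<in>degs m 2. \<Sum>k\<in>basis_idx CARD('n) m l. BA l * (phi m l k x * phi m l k y))
      = (\<Prod>j=1..m. 1 + a * g j * low_kernel (x j) (y j))"
    for x y
  proof -
    have "(\<Sum>l\<in>degs m 2. \<Sum>k\<in>basis_idx CARD('n) m l. BA l * (phi m l k x * phi m l k y)) =
        (\<Sum>l\<in>degs m 2. \<Sum>k\<in>basis_idx CARD('n) m l. \<Prod>j=1..m. inv_weight CARD('n) r (a * g j) (l j)
            * (P (l j) (k j) (x j) * P (l j) (k j) (y j)))"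
      by (simp add: BA_def inv_weight_prod_def phi_def prod.distrib)
    also have "\<dots> = (\<Prod>j=1..m. \<Sum>l\<le>2. \<Sum>k=1..rdim CARD('n) l. inv_weight CARD('n) r (a * g j) l * (P l k (x j)
        * P l k (y j)))"
      by (rule sum_degs_basis_idx_prod)
    also have "\<dots> = (\<Prod>j=1..m. 1 + a * g j * low_kernel (x j) (y j))"
    proof (rule prod.cong[OF refl])
      fix j
      have split: "(\<Sum>l\<le>2. F l) = F 0 + (\<Sum>l=1..2. F l)" for F :: "nat \<Rightarrow> real"
        by (simp add: atMost_atLeast0 sum.atLeast_Suc_atMost One_nat_def)
      have "(\<Sum>l\<le>2. \<Sum>k=1..rdim CARD('n) l. inv_weight CARD('n) r (a * g j) l * (P l k (x j) * P l k (y j))) =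
          (\<Sum>l\<le>2. inv_weight CARD('n) r (a * g j) l * Pker P l (x j) (y j))"
        by (simp add: Pker_def sum_distrib_left)
      also have "\<dots> = 1 + (\<Sum>l=1..2. inv_weight CARD('n) r (a * g j) l * Pker P l (x j) (y j))"
        unfolding split by (simp add: inv_weight_def Pker_0)
      also have "(\<Sum>l=1..2. inv_weight CARD('n) r (a * g j) l * Pker P l (x j) (y j))
          = a * g j * low_kernel (x j) (y j)"
        unfolding low_kernel_def sum_distrib_left by (intro sum.cong refl) (auto simp: inv_weight_def)
      finally show "(\<Sum>l\<le>2. \<Sum>k=1..rdim CARD('n) l. inv_weight CARD('n) r (a * g j) l * (P l k (x j)
          * P l k (y j))) =
          1 + a * g j * low_kernel (x j) (y j)" .
    qed
    finally show ?thesis .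
  qed
  have tTd: "t s j \<in> Td" if "s \<in> {1..n}" "j \<in> {1..m}" for s j
    using t[OF that(1)] that(2) by (auto simp: domain_def PiE_def Pi_def)
  have "(\<Sum>l\<in>degs m 2. \<Sum>k\<in>basis_idx CARD('n) m l. BA l * (point_sum n t l k)\<^sup>2) =
      (\<Sum>l\<in>degs m 2. \<Sum>k\<in>basis_idx CARD('n) m l. \<Sum>s=1..n. \<Sum>s'=1..n. BA l * (phi m l k (t s)
          * phi m l k (t s')))"
  proof -
    have "(point_sum n t l k)\<^sup>2 = (\<Sum>s=1..n. \<Sum>s'=1..n. phi m l k (t s) * phi m l k (t s'))" for l k
      by (simp only: point_sum_def power2_eq_square sum_product)
    then show ?thesis by (simp only: sum_distrib_left)
  qed
  also have "\<dots> = (\<Sum>l\<in>degs m 2. \<Sum>s=1..n. \<Sum>k\<in>basis_idx CARD('n) m l. \<Sum>s'=1..n. BA l * (phi m l k (t s)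
      * phi m l k (t s')))"
    by (rule sum.cong[OF refl], rule sum.swap)
  also have "\<dots> = (\<Sum>s=1..n. \<Sum>l\<in>degs m 2. \<Sum>k\<in>basis_idx CARD('n) m l. \<Sum>s'=1..n. BA l * (phi m l k (t s)
      * phi m l k (t s')))"
    by (rule sum.swap)
  also have "\<dots> = (\<Sum>s=1..n. \<Sum>l\<in>degs m 2. \<Sum>s'=1..n. \<Sum>k\<in>basis_idx CARD('n) m l. BA l * (phi m l k (t s)
      * phi m l k (t s')))"
    by (rule sum.cong[OF refl], rule sum.cong[OF refl], rule sum.swap)
  also have "\<dots> = (\<Sum>s=1..n. \<Sum>s'=1..n. \<Sum>l\<in>degs m 2. \<Sum>k\<in>basis_idx CARD('n) m l. BA l * (phi m l k (t s)
      * phi m l k (t s')))"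
    by (rule sum.cong[OF refl], rule sum.swap)
  also have "\<dots> = (\<Sum>s=1..n. \<Sum>s'=1..n. \<Prod>j=1..m. 1 + a * g j * low_kernel (t s j) (t s' j))"
    by (simp only: kernel)
  finally have quad: "(\<Sum>l\<in>degs m 2. \<Sum>k\<in>basis_idx CARD('n) m l. BA l * (point_sum n t l k)\<^sup>2) =
      (\<Sum>s=1..n. \<Sum>s'=1..n. \<Prod>j=1..m. 1 + a * g j * low_kernel (t s j) (t s' j))" .
  \<comment> \<open>All terms of the inner sum are non-negative; only the one with \<open>s' = s\<close> is kept.\<close>
  have diag: "(\<Prod>j=1..m. 1 + a * g j * \<kappa>) \<le> (\<Sum>s'=1..n. \<Prod>j=1..m. 1 + a * g j * low_kernel (t s j) (t s' j))"
    if s: "s \<in> {1..n}" for s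
  proof -
    have "(\<Prod>j=1..m. 1 + a * g j * \<kappa>) \<le> (\<Prod>j=1..m. 1 + a * g j * low_kernel (t s j) (t s j))"
      using a \<kappa>(1)
      by (intro prod_mono conjI add_left_mono mult_left_mono \<kappa> tTd s add_nonneg_nonneg mult_nonneg_nonneg
          less_imp_le[OF g_pos]) auto
    also have "\<dots> \<le> (\<Sum>s'=1..n. \<Prod>j=1..m. 1 + a * g j * low_kernel (t s j) (t s' j))"
      by (rule member_le_sum[OF s]) (auto intro!: prod_nonneg nonneg tTd s)
    finally show ?thesis .
  qed
  have "real n * (\<Prod>j=1..m. 1 + a * g j * \<kappa>) = (\<Sum>s=1..n. \<Prod>j=1..m. 1 + a * g j * \<kappa>)" by simp
  also have "\<dots> \<le> (\<Sum>l\<in>degs m 2. \<Sum>k\<in>basis_idx CARD('n) m l. BA l * (point_sum n t l k)\<^sup>2)"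
    unfolding quad by (rule sum_mono) (rule diag)
  also have "\<dots> = (real n)\<^sup>2 * (E2 + 1)"
  proof -
    have "(\<Sum>l\<in>degs m 2. \<Sum>k\<in>basis_idx CARD('n) m l. BA l * (point_sum n t l k)\<^sup>2) =
        (\<Sum>k\<in>basis_idx CARD('n) m (zero_degs m). BA (zero_degs m) * (point_sum n t (zero_degs m) k)\<^sup>2) +
            (\<Sum>l\<in>degs m 2 - {zero_degs m}. \<Sum>k\<in>basis_idx CARD('n) m l. BA l * (point_sum n t l k)\<^sup>2)"
      by (rule sum.remove) auto
    also have "(\<Sum>k\<in>basis_idx CARD('n) m (zero_degs m). BA (zero_degs m)
        * (point_sum n t (zero_degs m) k)\<^sup>2) = (real n)\<^sup>2"
      by (simp add: K_zero_degs point_sum_def phi_zero_degs_one_idx BA_zero_degs)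
    also have "(\<Sum>l\<in>degs m 2 - {zero_degs m}. \<Sum>k\<in>basis_idx CARD('n) m l. BA l * (point_sum n t l k)\<^sup>2)
        = (real n)\<^sup>2 * E2"
      unfolding E2_def sum_distrib_left using n by (intro sum.cong refl) (simp add: power_divide)
    finally show ?thesis by (simp add: algebra_simps)
  qed
  finally have "(\<Prod>j=1..m. 1 + a * g j * \<kappa>) \<le> real n * (E2 + 1)"
    using n by (simp add: power2_eq_square)
  then have main: "(\<Prod>j=1..m. 1 + a * g j * \<kappa>) / real n - 1 \<le> E2"
    using n by (simp add: field_simps)
  show ?thesis
  proof (cases "E2 = 0")
    case True
    then show ?thesis using main by (smt (verit) zero_le_power2)
  next
    case False
    define E where "E = sqrt E2"
    have E: "E > 0" "E\<^sup>2 = E2" using False E2_nn by (auto simp: E_def)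
    \<comment> \<open>Fourier coefficients of the representer of the error, divided by its norm \<open>E\<close>.\<close>
    define q where "q = (\<lambda>l k. if l = zero_degs m then 0 else BA l * (point_sum n t l k / real n) / E)"
    let ?f = "finite_expansion 2 q"
    have fH: "?f \<in> Hm P r g m" by (rule finite_expansion_in_Hm[OF m])
    have "(\<Sum>l\<in>degs m 2. \<Sum>k\<in>basis_idx CARD('n) m l. Bprod CARD('n) r g m l * (q l k)\<^sup>2) =
        (\<Sum>l\<in>degs m 2 - {zero_degs m}. \<Sum>k\<in>basis_idx CARD('n) m l. Bprod CARD('n) r g m l * (q l k)\<^sup>2)"
      by (subst sum.remove[of _ "zero_degs m"]) (auto simp: q_def)
    also have "\<dots> \<le> (\<Sum>l\<in>degs m 2 - {zero_degs m}. \<Sum>k\<in>basis_idx CARD('n) m l. BA l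
        * (point_sum n t l k / real n)\<^sup>2 / E2)"
    proof (intro sum_mono)
      fix l k assume l: "l \<in> degs m 2 - {zero_degs m}"
      have "Bprod CARD('n) r g m l * (q l k)\<^sup>2
          = (Bprod CARD('n) r g m l * BA l) * (BA l * (point_sum n t l k / real n)\<^sup>2 / E2)"
        using l by (simp add: q_def power_mult_distrib power_divide E(2)[symmetric] power2_eq_square mult_ac)
      also have "\<dots> \<le> 1 * (BA l * (point_sum n t l k / real n)\<^sup>2 / E2)"
        by (intro mult_right_mono BP_BA divide_nonneg_nonneg mult_nonneg_nonneg less_imp_le[OF BA_pos]
            E2_nn) auto
      finally show "Bprod CARD('n) r g m l * (q l k)\<^sup>2 \<le> BA l * (point_sum n t l k / real n)\<^sup>2 / E2" by simp
    qed
    also have "\<dots> = 1"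
      unfolding sum_divide_distrib[symmetric] E2_def[symmetric] using False by simp
    finally have fn: "norm_H P r g m ?f \<le> 1" by (simp add: norm_finite_expansion)
    have "integ m ?f = 0"
      using acoef_finite_expansion[of "zero_degs m" one_idx 2 q]
          by (simp add: acoef_zero_degs K_zero_degs q_def)
    moreover have "qmc n t ?f = E"
    proof -
      have "(\<Sum>s=1..n. ?f (t s)) = (\<Sum>l\<in>degs m 2. \<Sum>s=1..n. \<Sum>k\<in>basis_idx CARD('n) m l. q l k * phi m l k (t s))"
        unfolding finite_expansion_def by (rule sum.swap)
      also have "\<dots> = (\<Sum>l\<in>degs m 2. \<Sum>k\<in>basis_idx CARD('n) m l. \<Sum>s=1..n. q l k * phi m l k (t s))"
        by (rule sum.cong[OF refl], rule sum.swap)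
      also have "\<dots> = (\<Sum>l\<in>degs m 2. \<Sum>k\<in>basis_idx CARD('n) m l. q l k * point_sum n t l k)"
        by (simp add: point_sum_def sum_distrib_left)
      also have "\<dots> = (\<Sum>l\<in>degs m 2 - {zero_degs m}. \<Sum>k\<in>basis_idx CARD('n) m l. q l k * point_sum n t l k)"
        by (subst sum.remove[of _ "zero_degs m"]) (auto simp: q_def)
      also have "\<dots> = (\<Sum>l\<in>degs m 2 - {zero_degs m}. \<Sum>k\<in>basis_idx CARD('n) m l. (BA l
          * (point_sum n t l k / real n)\<^sup>2) * (real n / E))"
        using n E(1) by (intro sum.cong refl) (auto simp: q_def power2_eq_square field_simps)
      also have "\<dots> = E2 * (real n / E)"
        by (simp only: sum_distrib_right[symmetric] E2_def)
      finally have "(\<Sum>s=1..n. ?f (t s)) = E2 * (real n / E)" .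
      then show ?thesis using n E by (simp add: qmc_def power2_eq_square flip: E(2))
    qed
    ultimately have "E \<le> wce P r g m n t"
      using wce_ge[where n = n and t = t, OF n t fH fn] E(1) by simp
    then have "E2 \<le> (wce P r g m n t)\<^sup>2"
      using E power_mono[of E "wce P r g m n t" 2] by simp
    then show ?thesis using main by simp
  qed
qed

text \<open>The rule without points has error equal to the initial error, so it is excluded by \<open>\<epsilon> < 1\<close>; for
\<open>n \<ge> 1\<close> the squared error is at most 1.\<close>

lemma admissible_lower_bound:
  assumes m: "m \<ge> 1" and t: "\<And>i. i \<in> {1..n} \<Longrightarrow> t i \<in> domain m"
    and eps: "0 < \<epsilon>" "\<epsilon> < 1" and adm: "wce P r g m n t \<le> \<epsilon> * init_error P r g m"
    and a: "0 < a" "a \<le> 1"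
    and nonneg: "\<And>j x y. j \<in> {1..m} \<Longrightarrow> x \<in> Td \<Longrightarrow> y \<in> Td \<Longrightarrow> 1 + a * g j * low_kernel x y \<ge> 0"
    and \<kappa>: "\<kappa> \<ge> 0" "\<And>x. x \<in> Td \<Longrightarrow> low_kernel x x \<ge> \<kappa>"
  shows "(\<Prod>j=1..m. 1 + a * g j * \<kappa>) / 2 \<le> real n"
proof -
  have "n \<noteq> 0"
  proof
    assume "n = 0"
    then show False using adm eps by (simp add: wce_0 init_error_eq_1[OF m])
  qed
  then have n: "n \<ge> 1" by simp
  have "0 \<le> \<bar>integ m (\<lambda>x :: nat \<Rightarrow> real ^ 'n. 1) - qmc n t (\<lambda>x. 1)\<bar>" by simp
  also have "\<dots> \<le> wce P r g m n t"
    by (rule wce_ge[OF n t]) (use one_in_unit_ball[OF m] in auto)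
  finally have "(wce P r g m n t)\<^sup>2 \<le> 1\<^sup>2"
    using adm eps by (intro power_mono) (auto simp: init_error_eq_1[OF m])
  then have "(\<Prod>j=1..m. 1 + a * g j * \<kappa>) / real n - 1 \<le> 1"
    using wce_lower_bound[where n = n and t = t and a = a and \<kappa> = \<kappa>, OF m n t a nonneg \<kappa>] by simp
  then show ?thesis using n by (simp add: field_simps)
qed

end

section \<open>Tractability from two-sided product bounds\<close>

text \<open>For a real sequence the finitely many terms not governed by the limes superior are bounded anyway.\<close>

lemma limsup_less_PInf_iff_bounded:
  fixes f :: "nat \<Rightarrow> real"
  shows "limsup (\<lambda>m. ereal (f m)) < \<infinity> \<longleftrightarrow> (\<exists>B. \<forall>m\<ge>1. f m \<le> B)"
proof
  assume "limsup (\<lambda>m. ereal (f m)) < \<infinity>"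
  then obtain C where "limsup (\<lambda>m. ereal (f m)) < ereal C"
    by (metis ereal_dense2)
  then have "\<forall>\<^sub>F m in sequentially. ereal (f m) < ereal C" by (rule Limsup_lessD)
  then obtain m0 where m0: "\<And>m. m \<ge> m0 \<Longrightarrow> f m < C" by (auto simp: eventually_sequentially)
  have "f m \<le> max C (Max (f ` {..m0}))" for m
  proof (cases "m \<ge> m0")
    case True then show ?thesis using m0[OF True] by simp
  next
    case False
    then have "f m \<le> Max (f ` {..m0})" by (intro Max_ge) auto
    then show ?thesis by simp
  qed
  then show "\<exists>B. \<forall>m\<ge>1. f m \<le> B" by blast
next
  assume "\<exists>B. \<forall>m\<ge>1. f m \<le> B"
  then obtain B where B: "\<And>m. m \<ge> 1 \<Longrightarrow> f m \<le> B" by blast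
  have "limsup (\<lambda>m. ereal (f m)) \<le> ereal B"
    by (rule Limsup_bounded) (auto simp: eventually_sequentially intro!: exI[of _ 1] B)
  then show "limsup (\<lambda>m. ereal (f m)) < \<infinity>" by (rule le_less_trans) simp
qed

text \<open>The limit \<open>1 / \<epsilon> + m \<rightarrow> \<infinity>\<close> in the definition of weak tractability.\<close>

abbreviation joint_filter :: "(real \<times> nat) filter" where
  "joint_filter \<equiv> inf (filtercomap (\<lambda>(\<epsilon>, m). 1 / \<epsilon> + real m) at_top) (principal ({0<..<1} \<times> {1..}))"

lemma eventually_joint_filter:
  "eventually Q joint_filter \<longleftrightarrow> (\<exists>X. \<forall>\<epsilon> m. 0 < \<epsilon> \<longrightarrow> \<epsilon> < 1 \<longrightarrow> 1 \<le> m \<longrightarrow> X \<le> 1 / \<epsilon> + real m \<longrightarrow> Q (\<epsilon>, m))"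
  unfolding eventually_inf_principal eventually_filtercomap_at_top_linorder
  by (auto simp: case_prod_beta)

text \<open>From here on only the growth of the complexity matters, not its origin: it lies between two products
in the weights, one of which carries the factor \<open>1 / \<epsilon>\<^sup>2\<close>.\<close>

locale product_bounded_complexity =
  fixes N :: "real \<Rightarrow> nat \<Rightarrow> nat" and \<gamma> :: "nat \<Rightarrow> nat \<Rightarrow> real" and c \<eta> G :: real
  assumes \<gamma>_pos: "\<And>m j. 1 \<le> j \<Longrightarrow> j \<le> m \<Longrightarrow> \<gamma> m j > 0"
    and \<gamma>_le: "\<And>m j. 1 \<le> j \<Longrightarrow> j \<le> m \<Longrightarrow> \<gamma> m j \<le> G"
    and c_nonneg: "c \<ge> 0" and \<eta>_pos: "\<eta> > 0"
    and lower: "\<And>m \<epsilon>. m \<ge> 1 \<Longrightarrow> 0 < \<epsilon> \<Longrightarrow> \<epsilon> < 1 \<Longrightarrow> (\<Prod>j=1..m. 1 + \<eta> * \<gamma> m j) / 2 \<le> real (N \<epsilon> m)"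
    and upper: "\<And>m \<epsilon>. m \<ge> 1 \<Longrightarrow> 0 < \<epsilon> \<Longrightarrow> \<epsilon> < 1 \<Longrightarrow> real (N \<epsilon> m) \<le> (\<Prod>j=1..m. 1 + \<gamma> m j * c) / \<epsilon>\<^sup>2"
begin

definition \<sigma> :: "nat \<Rightarrow> real" where "\<sigma> m = (\<Sum>j=1..m. \<gamma> m j)"

lemma \<sigma>_nonneg: "\<sigma> m \<ge> 0"
  unfolding \<sigma>_def by (rule sum_nonneg) (use \<gamma>_pos in \<open>auto intro: less_imp_le\<close>)

lemma G_pos: "G > 0"
  using \<gamma>_pos[of 1 1] \<gamma>_le[of 1 1] by simp

definition \<theta> :: real where "\<theta> = \<eta> / (1 + \<eta> * G)"

lemma \<theta>_pos: "\<theta> > 0"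
  using \<eta>_pos G_pos by (simp add: \<theta>_def add_pos_pos)

text \<open>Boundedness of the weights enters here: on \<open>[0, \<eta> G]\<close> the logarithm satisfies
\<open>ln (1 + u) \<ge> u / (1 + u) \<ge> u / (1 + \<eta> G)\<close>.\<close>

lemma exp_lower:
  assumes "m \<ge> 1" "0 < \<epsilon>" "\<epsilon> < 1"
  shows "exp (\<theta> * \<sigma> m) / 2 \<le> real (N \<epsilon> m)"
proof -
  have "exp (\<theta> * \<gamma> m j) \<le> 1 + \<eta> * \<gamma> m j" if j: "j \<in> {1..m}" for j
  proof -
    have g: "0 < \<gamma> m j" "\<gamma> m j \<le> G" using \<gamma>_pos \<gamma>_le j by auto
    define u where "u = \<eta> * \<gamma> m j"
    have u: "0 < u" "u \<le> \<eta> * G" using g \<eta>_pos by (auto simp: u_def)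
    have "\<theta> * \<gamma> m j = u / (1 + \<eta> * G)" by (simp add: \<theta>_def u_def)
    also have "\<dots> \<le> u / (1 + u)" using u by (intro divide_left_mono) auto
    also have "\<dots> = - (1 / (1 + u) - 1)" using u by (simp add: field_simps)
    also have "\<dots> \<le> - ln (1 / (1 + u))"
      using ln_le_minus_one[of "1 / (1 + u)"] u by simp
    also have "\<dots> = ln (1 + u)" using u by (simp add: ln_div)
    finally have "exp (\<theta> * \<gamma> m j) \<le> exp (ln (1 + u))" by (simp only: exp_le_cancel_iff)
    also have "\<dots> = 1 + u" using u by (intro exp_ln) simp
    finally show ?thesis by (simp only: u_def)
  qed
  then have "(\<Prod>j=1..m. exp (\<theta> * \<gamma> m j)) \<le> (\<Prod>j=1..m. 1 + \<eta> * \<gamma> m j)"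
    by (intro prod_mono) auto
  then show ?thesis
    using lower[OF assms] by (simp add: \<sigma>_def sum_distrib_left exp_sum)
qed

lemma exp_upper:
  assumes "m \<ge> 1" "0 < \<epsilon>" "\<epsilon> < 1"
  shows "real (N \<epsilon> m) \<le> exp (c * \<sigma> m) / \<epsilon>\<^sup>2"
proof -
  have "(\<Prod>j=1..m. 1 + \<gamma> m j * c) \<le> (\<Prod>j=1..m. exp (c * \<gamma> m j))"
  proof (intro prod_mono conjI)
    fix j assume j: "j \<in> {1..m}"
    then show "0 \<le> 1 + \<gamma> m j * c"
      using \<gamma>_pos[of j m] c_nonneg by (intro add_nonneg_nonneg mult_nonneg_nonneg) auto
    show "1 + \<gamma> m j * c \<le> exp (c * \<gamma> m j)"
      using exp_ge_add_one_self[of "c * \<gamma> m j"] by (simp add: mult.commute)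
  qed
  also have "\<dots> = exp (c * \<sigma> m)" by (simp add: \<sigma>_def sum_distrib_left exp_sum)
  finally show ?thesis
    using upper[OF assms] divide_right_mono[of _ _ "\<epsilon>\<^sup>2"] by (meson order_trans zero_le_power2)
qed

text \<open>A single accuracy, \<open>\<epsilon> = 1/2\<close>, suffices for the necessary conditions.\<close>

lemma \<sigma>_log_bound_of_tract_bound:
  assumes tb: "tract_bound N C p q" and q: "q \<ge> 0"
  obtains K where "\<And>m. m \<ge> 1 \<Longrightarrow> \<sigma> m \<le> K + q / \<theta> * ln (real m)"
proof -
  have "\<sigma> m \<le> ln (max 1 (2 * C * (1/2) powr (- p))) / \<theta> + q / \<theta> * ln (real m)" if m: "m \<ge> 1" for m
  proof -
    define A where "A = max 1 (2 * C * (1/2) powr (- p))"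
    have "exp (\<theta> * \<sigma> m) / 2 \<le> real (N (1/2) m)" by (rule exp_lower[OF m]) auto
    also have "\<dots> \<le> C * (1/2) powr (- p) * real m powr q"
      using tb m unfolding tract_bound_def by auto
    finally have "exp (\<theta> * \<sigma> m) \<le> (2 * C * (1/2) powr (- p)) * real m powr q" by simp
    also have "\<dots> \<le> A * real m powr q" unfolding A_def by (intro mult_right_mono) auto
    finally have "ln (exp (\<theta> * \<sigma> m)) \<le> ln (A * real m powr q)"
      by (intro ln_mono) auto
    also have "\<dots> = ln A + q * ln (real m)"
      using m by (subst ln_mult) (auto simp: A_def ln_powr)
    finally have "\<theta> * \<sigma> m \<le> ln A + q * ln (real m)" by simp
    then have "\<sigma> m \<le> (ln A + q * ln (real m)) / \<theta>" using \<theta>_pos by (simp add: pos_le_divide_eq mult.commute)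
    then show ?thesis by (simp add: A_def add_divide_distrib)
  qed
  then show ?thesis by (rule that)
qed

lemma tract_bound_of_\<sigma>_bound:
  assumes "\<And>m. m \<ge> 1 \<Longrightarrow> c * \<sigma> m \<le> K + q * ln (real m)"
  shows "tract_bound N (exp K) 2 q"
  unfolding tract_bound_def
proof (intro allI impI ballI)
  fix m :: nat and \<epsilon> :: real assume m: "1 \<le> m" and e: "\<epsilon> \<in> {0<..<1}"
  have "real (N \<epsilon> m) \<le> exp (c * \<sigma> m) / \<epsilon>\<^sup>2" using exp_upper m e by auto
  also have "\<dots> \<le> exp (K + q * ln (real m)) / \<epsilon>\<^sup>2" by (intro divide_right_mono) (use assms[OF m] in auto)
  also have "\<dots> = exp K * \<epsilon> powr (- 2) * real m powr q"
    using m e by (simp add: exp_add powr_def[of "real m"] powr_minus divide_inverse powr_numeral)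
  finally show "real (N \<epsilon> m) \<le> exp K * \<epsilon> powr - 2 * real m powr q" .
qed

lemma strong_iff:
  "strongly_poly_tractable N \<longleftrightarrow> limsup (\<lambda>m. ereal (\<sigma> m)) < \<infinity>"
proof
  assume "strongly_poly_tractable N"
  then obtain C p where "tract_bound N C p 0" by (auto simp: strongly_poly_tractable_def)
  from \<sigma>_log_bound_of_tract_bound[OF this] obtain K where "\<And>m. m \<ge> 1 \<Longrightarrow> \<sigma> m \<le> K" by auto
  then show "limsup (\<lambda>m. ereal (\<sigma> m)) < \<infinity>" unfolding limsup_less_PInf_iff_bounded by blast
next
  assume "limsup (\<lambda>m. ereal (\<sigma> m)) < \<infinity>"
  then obtain B where B: "\<And>m. m \<ge> 1 \<Longrightarrow> \<sigma> m \<le> B" unfolding limsup_less_PInf_iff_bounded by blast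
  have "tract_bound N (exp (c * B)) 2 0"
    by (rule tract_bound_of_\<sigma>_bound) (use B c_nonneg in \<open>auto intro!: mult_left_mono\<close>)
  then show "strongly_poly_tractable N"
    unfolding strongly_poly_tractable_def by (intro exI[of _ "exp (c * B)"] conjI exI[of _ 2]) auto
qed

lemma strong_exponent:
  assumes "limsup (\<lambda>m. ereal (\<sigma> m)) < \<infinity>"
  shows "strong_eps_exponent N \<le> 2"
proof -
  obtain B where B: "\<And>m. m \<ge> 1 \<Longrightarrow> \<sigma> m \<le> B" using assms unfolding limsup_less_PInf_iff_bounded by blast
  have "tract_bound N (exp (c * B)) 2 0"
    by (rule tract_bound_of_\<sigma>_bound) (use B c_nonneg in \<open>auto intro!: mult_left_mono\<close>)
  then have "2 \<in> {p. p \<ge> 0 \<and> (\<exists>C\<ge>0. tract_bound N C p 0)}"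
    by (auto intro!: exI[of _ "exp (c * B)"])
  then show ?thesis
    unfolding strong_eps_exponent_def by (rule cInf_lower) (auto intro!: bdd_belowI[of _ 0])
qed

text \<open>Any \<open>b\<close> above the limes superior gives the exponent \<open>c
    * b\<close>. The constant \<open>K\<close> has to absorb the step from
\<open>ln (m + 1)\<close> to \<open>ln m\<close> and the finitely many small \<open>m\<close>.\<close>

lemma tract_bound_of_limsup:
  assumes b: "limsup (\<lambda>m. ereal (\<sigma> m / ln (real m + 1))) < ereal b"
  shows "\<exists>K. tract_bound N (exp K) 2 (c * b)"
proof -
  have "\<forall>\<^sub>F m in sequentially. ereal (\<sigma> m / ln (real m + 1)) < ereal b"
    using b by (rule Limsup_lessD)
  then obtain m0 where m0: "\<And>m. m \<ge> m0 \<Longrightarrow> \<sigma> m / ln (real m + 1) < b" by (auto simp: eventually_sequentially)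
  have b_nonneg: "b \<ge> 0"
  proof -
    have "0 \<le> \<sigma> (max m0 1) / ln (real (max m0 1) + 1)"
      using \<sigma>_nonneg by (intro divide_nonneg_nonneg ln_ge_zero) auto
    also have "\<dots> < b" by (rule m0) simp
    finally show ?thesis by simp
  qed
  define K where "K = c * (b * ln 2) + (\<Sum>m\<le>m0. c * \<sigma> m)"
  have S_nn: "(\<Sum>m\<le>m0. c * \<sigma> m) \<ge> 0"
    by (intro sum_nonneg mult_nonneg_nonneg c_nonneg \<sigma>_nonneg)
  have "c * \<sigma> m \<le> K + c * b * ln (real m)" if m: "m \<ge> 1" for m
  proof (cases "m \<ge> m0")
    case True
    have "ln (real m + 1) \<le> ln (2 * real m)" using m by (intro ln_mono) auto
    also have "\<dots> = ln 2 + ln (real m)" using m by (simp add: ln_mult)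
    finally have l: "ln (real m + 1) \<le> ln 2 + ln (real m)" .
    have "ln (real m + 1) > 0" using m by (intro ln_gt_zero) auto
    then have "\<sigma> m \<le> b * ln (real m + 1)" using m0[OF True] by (simp add: pos_divide_less_eq)
    also have "\<dots> \<le> b * (ln 2 + ln (real m))" by (intro mult_left_mono l b_nonneg)
    finally have "c * \<sigma> m \<le> c * (b * (ln 2 + ln (real m)))" by (intro mult_left_mono c_nonneg)
    then show ?thesis using S_nn unfolding K_def by (simp add: algebra_simps)
  next
    case False
    have "c * \<sigma> m \<le> (\<Sum>m\<le>m0. c * \<sigma> m)"
      by (rule member_le_sum) (use False in \<open>auto intro!: mult_nonneg_nonneg c_nonneg \<sigma>_nonneg\<close>)
    moreover have "c * (b * ln 2) \<ge> 0" "c * b * ln (real m) \<ge> 0"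
      using m by (auto intro!: mult_nonneg_nonneg c_nonneg b_nonneg)
    ultimately show ?thesis unfolding K_def by linarith
  qed
  then show ?thesis using tract_bound_of_\<sigma>_bound by blast
qed

lemma limsup_nonneg: "limsup (\<lambda>m. ereal (\<sigma> m / ln (real m + 1))) \<ge> 0"
proof -
  have "0 \<le> liminf (\<lambda>m. ereal (\<sigma> m / ln (real m + 1)))"
    by (rule Liminf_bounded) (auto intro!: always_eventually divide_nonneg_nonneg \<sigma>_nonneg)
  also have "\<dots> \<le> limsup (\<lambda>m. ereal (\<sigma> m / ln (real m + 1)))"
    by (rule Liminf_le_Limsup) simp
  finally show ?thesis .
qed

lemma poly_iff:
  "poly_tractable N \<longleftrightarrow> limsup (\<lambda>m. ereal (\<sigma> m / ln (real m + 1))) < \<infinity>"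
proof
  assume "poly_tractable N"
  then obtain C p q where q: "q \<ge> 0" "tract_bound N C p q" by (auto simp: poly_tractable_def)
  from \<sigma>_log_bound_of_tract_bound[OF q(2,1)] obtain K where
    K: "\<And>m. m \<ge> 1 \<Longrightarrow> \<sigma> m \<le> K + q / \<theta> * ln (real m)" by blast
  have "\<sigma> m / ln (real m + 1) \<le> \<bar>K\<bar> / ln 2 + q / \<theta>" if m: "m \<ge> 1" for m
  proof -
    have l2: "ln 2 \<le> ln (real m + 1)" using m by (intro ln_mono) auto
    have lpos: "ln (real m + 1) > 0" using m by (intro ln_gt_zero) auto
    have "\<sigma> m \<le> \<bar>K\<bar> + q / \<theta> * ln (real m)" using K[OF m] by linarith
    also have "\<bar>K\<bar> \<le> \<bar>K\<bar> / ln 2 * ln (real m + 1)"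
      using l2 by (simp add: field_simps mult_left_mono)
    also have "q / \<theta> * ln (real m) \<le> q / \<theta> * ln (real m + 1)"
      using m q \<theta>_pos by (intro mult_left_mono) auto
    finally have "\<sigma> m \<le> (\<bar>K\<bar> / ln 2 + q / \<theta>) * ln (real m + 1)" by (simp add: distrib_right)
    then show ?thesis using lpos by (simp add: pos_divide_le_eq)
  qed
  then show "limsup (\<lambda>m. ereal (\<sigma> m / ln (real m + 1))) < \<infinity>"
    unfolding limsup_less_PInf_iff_bounded by blast
next
  assume *: "limsup (\<lambda>m. ereal (\<sigma> m / ln (real m + 1))) < \<infinity>"
  then obtain b where b: "limsup (\<lambda>m. ereal (\<sigma> m / ln (real m + 1))) < ereal b"
    by (metis ereal_dense2)
  then have "b \<ge> 0" using limsup_nonneg by (metis ereal_less_eq(5) less_imp_le order_trans)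
  with tract_bound_of_limsup[OF b] c_nonneg show "poly_tractable N"
    unfolding poly_tractable_def by (meson exp_ge_zero mult_nonneg_nonneg zero_le_numeral)
qed

lemma poly_exponents:
  assumes fin: "limsup (\<lambda>m. ereal (\<sigma> m / ln (real m + 1))) < \<infinity>"
  shows "eps_exponent N \<le> 2"
    and "ereal (m_exponent N) \<le> ereal c * limsup (\<lambda>m. ereal (\<sigma> m / ln (real m + 1)))"
proof -
  obtain \<beta> where \<beta>: "limsup (\<lambda>m. ereal (\<sigma> m / ln (real m + 1))) = ereal \<beta>" "\<beta> \<ge> 0"
    using fin limsup_nonneg
    by (cases "limsup (\<lambda>m. ereal (\<sigma> m / ln (real m + 1)))") auto
  have tb: "\<exists>K. tract_bound N (exp K) 2 (c * (\<beta> + e))" if "e > 0" for e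
    by (rule tract_bound_of_limsup) (use \<beta> that in simp)
  have nn: "c * (\<beta> + e) \<ge> 0" if "e > 0" for e
    using \<beta> c_nonneg that by simp
  have "2 \<in> {p. p \<ge> 0 \<and> (\<exists>C\<ge>0. \<exists>q\<ge>0. tract_bound N C p q)}"
    using tb[of 1] nn[of 1] by (auto intro: exp_ge_zero)
  then show "eps_exponent N \<le> 2"
    unfolding eps_exponent_def by (rule cInf_lower) (auto intro!: bdd_belowI[of _ 0])
  have m_le: "m_exponent N \<le> c * (\<beta> + e)" if e: "e > 0" for e
  proof -
    have "c * (\<beta> + e) \<in> {q. q \<ge> 0 \<and> (\<exists>C\<ge>0. \<exists>p\<ge>0. tract_bound N C p q)}"
      using tb[OF e] nn[OF e] by (metis (mono_tags, lifting) exp_ge_zero mem_Collect_eq zero_le_numeral)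
    then show ?thesis
      unfolding m_exponent_def by (rule cInf_lower) (auto intro!: bdd_belowI[of _ 0])
  qed
  have "m_exponent N \<le> c * \<beta> + e" if e: "e > 0" for e
  proof -
    \<comment> \<open>Division by \<open>c + 1\<close> instead of \<open>c\<close>, since \<open>c\<close> may be zero.\<close>
    have "m_exponent N \<le> c * (\<beta> + e / (c + 1))" using e c_nonneg by (intro m_le) auto
    also have "\<dots> \<le> c * \<beta> + e" using e c_nonneg by (simp add: field_simps)
    finally show ?thesis .
  qed
  then have "m_exponent N \<le> c * \<beta>" by (rule field_le_epsilon)
  then show "ereal (m_exponent N) \<le> ereal c * limsup (\<lambda>m. ereal (\<sigma> m / ln (real m + 1)))"
    by (simp add: \<beta>)
qed

text \<open>One direction fixes \<open>\<epsilon> = 1/2\<close>. In the other, \<open>ln N\<close> is at most \<open>c \<sigma>(m) + 2 ln (1 / \<epsilon>)\<close>; the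
second term is negligible against \<open>1 / \<epsilon> + m\<close>, and so is the first, by assumption for large \<open>m\<close> and
because it is bounded for the others.\<close>

lemma weak_iff:
  "weakly_tractable N \<longleftrightarrow> (\<lambda>m. \<sigma> m / real m) \<longlonglongrightarrow> 0"
proof
  assume "weakly_tractable N"
  then have lim: "((\<lambda>(\<epsilon>, m). ln (real (N \<epsilon> m)) / (1 / \<epsilon> + real m)) \<longlongrightarrow> 0) joint_filter"
    by (simp add: weakly_tractable_def)
  have "filterlim (\<lambda>m. (1/2 :: real, m)) joint_filter sequentially"
    unfolding filterlim_iff eventually_joint_filter
  proof (intro allI impI)
    fix Q :: "real \<times> nat \<Rightarrow> bool"
    assume "\<exists>X. \<forall>\<epsilon> m. 0 < \<epsilon> \<longrightarrow> \<epsilon> < 1 \<longrightarrow> 1 \<le> m \<longrightarrow> X \<le> 1 / \<epsilon> + real m \<longrightarrow> Q (\<epsilon>, m)"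
    then obtain X where X: "\<And>\<epsilon> m. 0 < \<epsilon> \<Longrightarrow> \<epsilon> < 1 \<Longrightarrow> 1 \<le> m \<Longrightarrow> X \<le> 1 / \<epsilon> + real m \<Longrightarrow> Q (\<epsilon>, m)" by blast
    have "Q (1/2, m)" if "m \<ge> max 1 (nat \<lceil>X\<rceil>)" for m
      using that real_nat_ceiling_ge[of X] by (intro X) auto
    then show "\<forall>\<^sub>F m in sequentially. Q (1/2, m)" unfolding eventually_sequentially by blast
  qed
  from filterlim_compose[OF lim this]
  have lim2: "(\<lambda>m. ln (real (N (1/2) m)) / (2 + real m)) \<longlonglongrightarrow> 0" by simp
  have "(\<lambda>m. (ln (real (N (1/2) m)) / (2 + real m) * ((2 + real m) / real m) + ln 2 / real m) / \<theta>) \<longlonglongrightarrow> (0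
      * 1 + 0) / \<theta>"
  proof (rule tendsto_divide[OF tendsto_add[OF tendsto_mult[OF lim2]] tendsto_const])
    show "(\<lambda>m. (2 + real m) / real m) \<longlonglongrightarrow> 1" by real_asymp
    show "(\<lambda>m. ln 2 / real m) \<longlonglongrightarrow> 0" by real_asymp
    show "\<theta> \<noteq> 0" using \<theta>_pos by simp
  qed
  then have lim3: "(\<lambda>m. (ln (real (N (1/2) m)) / (2 + real m) * ((2 + real m) / real m)
      + ln 2 / real m) / \<theta>) \<longlonglongrightarrow> 0"
    by simp
  have "\<sigma> m / real m \<le> (ln (real (N (1/2) m)) / (2 + real m) * ((2 + real m) / real m) + ln 2 / real m) / \<theta>"
    if m: "m \<ge> 1" for m
  proof -
    have "exp (\<theta> * \<sigma> m) / 2 \<le> real (N (1/2) m)" by (rule exp_lower[OF m]) auto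
    then have "ln (exp (\<theta> * \<sigma> m) / 2) \<le> ln (real (N (1/2) m))" by (intro ln_mono) auto
    then have "\<theta> * \<sigma> m \<le> ln (real (N (1/2) m)) + ln 2" by (simp add: ln_div)
    then have "\<sigma> m \<le> (ln (real (N (1/2) m)) + ln 2) / \<theta>"
        using \<theta>_pos by (simp add: pos_le_divide_eq mult.commute)
    then have "\<sigma> m / real m \<le> (ln (real (N (1/2) m)) + ln 2) / \<theta> / real m" by (rule divide_right_mono) simp
    also have "\<dots> = (ln (real (N (1/2) m)) / (2 + real m) * ((2 + real m) / real m) + ln 2 / real m) / \<theta>"
    proof -
      have "x / y * (y / z) = x / z" if "y \<noteq> 0" for x y z :: real
        using that by simp
      moreover have "2 + real m \<noteq> 0" by linarith
      ultimately have "ln (real (N (1/2) m)) / (2 + real m) * ((2 + real m) / real m)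
          = ln (real (N (1/2) m)) / real m"
        by blast
      then show ?thesis by (simp add: add_divide_distrib mult.commute)
    qed
    finally show ?thesis .
  qed
  then show "(\<lambda>m. \<sigma> m / real m) \<longlonglongrightarrow> 0"
    by (intro tendsto_sandwich[OF _ _ tendsto_const lim3])
       (auto simp: eventually_sequentially intro!: exI[of _ 1] divide_nonneg_nonneg \<sigma>_nonneg)
next
  assume lim: "(\<lambda>m. \<sigma> m / real m) \<longlonglongrightarrow> 0"
  have "((\<lambda>(\<epsilon>, m). ln (real (N \<epsilon> m)) / (1 / \<epsilon> + real m)) \<longlongrightarrow> 0) joint_filter"
  proof (rule tendstoI)
    fix e :: real assume e: "e > 0"
    \<comment> \<open>The term \<open>c \<sigma>(m)\<close> will contribute at most \<open>e / 4\<close> and the remaining terms less than \<open>e / 2\<close>.\<close>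
    define \<delta> where "\<delta> = e / (4 * (c + 1))"
    have \<delta>: "\<delta> > 0" "c * \<delta> \<le> e / 4" using e c_nonneg by (auto simp: \<delta>_def field_simps)
    obtain m0 where m0: "\<And>m. m \<ge> m0 \<Longrightarrow> \<sigma> m / real m < \<delta>"
      using order_tendstoD(2)[OF lim \<delta>(1)] by (auto simp: eventually_sequentially)
    define B where "B = (\<Sum>m\<le>m0. c * \<sigma> m)"
    have B_nn: "B \<ge> 0" unfolding B_def by (intro sum_nonneg mult_nonneg_nonneg c_nonneg \<sigma>_nonneg)
    have "\<forall>\<^sub>F s in at_top. 2 * ln s / s + B / s < e / 2"
    proof -
      have "((\<lambda>s. 2 * ln s / s + B / s) \<longlongrightarrow> 0) at_top" by real_asymp
      from order_tendstoD(2)[OF this, of "e / 2"] e show ?thesis by simp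
    qed
    then obtain X where X: "\<And>s. s \<ge> X \<Longrightarrow> 2 * ln s / s + B / s < e / 2"
      by (auto simp: eventually_at_top_linorder)
    have "dist (ln (real (N \<epsilon> m)) / (1 / \<epsilon> + real m)) 0 < e"
      if eps: "0 < \<epsilon>" "\<epsilon> < 1" and m: "1 \<le> m" and s: "X \<le> 1 / \<epsilon> + real m" for \<epsilon> m
    proof -
      define s where "s = 1 / \<epsilon> + real m"
      have "1 / \<epsilon> > 0" "real m \<ge> 1" using eps m by auto
      then have s1: "s \<ge> 1" "s \<ge> real m" "s \<ge> 1 / \<epsilon>" unfolding s_def by linarith+
      have N1: "real (N \<epsilon> m) \<ge> 1"
      proof -
        have "0 < exp (\<theta> * \<sigma> m) / 2" by simp
        also have "\<dots> \<le> real (N \<epsilon> m)" by (rule exp_lower[OF m eps])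
        finally show ?thesis by simp
      qed
      have "ln (real (N \<epsilon> m)) \<le> ln (exp (c * \<sigma> m) / \<epsilon>\<^sup>2)"
        using N1 by (intro ln_mono exp_upper m eps) auto
      also have "\<dots> = c * \<sigma> m + 2 * ln (1 / \<epsilon>)"
        using eps by (simp add: ln_div ln_realpow)
      also have "ln (1 / \<epsilon>) \<le> ln s" using s1 eps by (intro ln_mono) auto
      also have "c * \<sigma> m \<le> c * \<delta> * s + B"
      proof (cases "m \<ge> m0")
        case True
        have "\<sigma> m \<le> \<delta> * real m" using m0[OF True] m by (simp add: pos_divide_less_eq less_imp_le)
        also have "\<dots> \<le> \<delta> * s" using \<delta> s1 by (intro mult_left_mono) auto
        finally have "c * \<sigma> m \<le> c * (\<delta> * s)" by (intro mult_left_mono c_nonneg)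
        then show ?thesis using B_nn by (simp add: mult.assoc)
      next
        case False
        have "c * \<sigma> m \<le> B" unfolding B_def
          by (rule member_le_sum) (use False in \<open>auto intro!: mult_nonneg_nonneg c_nonneg \<sigma>_nonneg\<close>)
        moreover have "c * \<delta> * s \<ge> 0" using c_nonneg \<delta> s1 by (intro mult_nonneg_nonneg) auto
        ultimately show ?thesis by linarith
      qed
      finally have "ln (real (N \<epsilon> m)) \<le> c * \<delta> * s + B + 2 * ln s" by simp
      then have "ln (real (N \<epsilon> m)) / s \<le> (c * \<delta> * s + B + 2 * ln s) / s"
        using s1 by (intro divide_right_mono) auto
      also have "\<dots> = c * \<delta> + (2 * ln s / s + B / s)" using s1 by (simp add: field_simps)
      also have "\<dots> < e" using \<delta>(2) X[of s] s e unfolding s_def by linarith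
      finally have "ln (real (N \<epsilon> m)) / s < e" .
      moreover have "ln (real (N \<epsilon> m)) / s \<ge> 0" using N1 s1 by (intro divide_nonneg_nonneg ln_ge_zero) auto
      ultimately have "\<bar>ln (real (N \<epsilon> m)) / s\<bar> < e" by (simp only: abs_of_nonneg)
      then show ?thesis by (simp only: s_def dist_real_def diff_0_right)
    qed
    then show "\<forall>\<^sub>F x in joint_filter. dist (case x of (\<epsilon>, m) \<Rightarrow> ln (real (N \<epsilon> m)) / (1 / \<epsilon> + real m)) 0 < e"
      unfolding eventually_joint_filter by auto
  qed
  then show "weakly_tractable N" by (simp add: weakly_tractable_def)
qed

end

theorem theorem1:
  fixes P :: "nat \<Rightarrow> nat \<Rightarrow> real ^ 'n \<Rightarrow> real"
    and M r :: real
    and \<gamma> :: "nat \<Rightarrow> nat \<Rightarrow> real"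
    and \<beta> :: ereal
  assumes basis: "orthonormal_bases P"
    and M: "\<And>l x y. l \<ge> 1 \<Longrightarrow> x \<in> Td \<Longrightarrow> y \<in> Td \<Longrightarrow>
              Pker P l x y \<le> M * real l ^ (2 * CARD('n))"
    and r: "r > real CARD('n) + 1"
    and pos: "\<And>m j. 1 \<le> j \<Longrightarrow> j \<le> m \<Longrightarrow> \<gamma> m j > 0"
    and bounded: "bdd_above {\<gamma> m j | m j. 1 \<le> j \<and> j \<le> m}"
    and \<beta>: "\<beta> = limsup (\<lambda>m. ereal ((\<Sum>j=1..m. \<gamma> m j) / ln (real m + 1)))"
  shows "(strongly_poly_tractable (n_min P r \<gamma>)
            \<longleftrightarrow> limsup (\<lambda>m. ereal (\<Sum>j=1..m. \<gamma> m j)) < \<infinity>)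
       \<and> (limsup (\<lambda>m. ereal (\<Sum>j=1..m. \<gamma> m j)) < \<infinity>
            \<longrightarrow> strong_eps_exponent (n_min P r \<gamma>) \<le> 2)
       \<and> (poly_tractable (n_min P r \<gamma>) \<longleftrightarrow> \<beta> < \<infinity>)
       \<and> (\<beta> < \<infinity> \<longrightarrow> eps_exponent (n_min P r \<gamma>) \<le> 2
            \<and> ereal (m_exponent (n_min P r \<gamma>)) \<le> ereal (cdr CARD('n) r M) * \<beta>)
       \<and> (weakly_tractable (n_min P r \<gamma>)
            \<longleftrightarrow> (\<lambda>m. (\<Sum>j=1..m. \<gamma> m j) / real m) \<longlonglongrightarrow> 0)"
proof -
  interpret space: simplex_space P M r
    by unfold_locales (fact basis, erule (2) M, fact r)
  let ?c = "cdr CARD('n) r M"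
  obtain G where G: "\<And>m j. 1 \<le> j \<Longrightarrow> j \<le> m \<Longrightarrow> \<gamma> m j \<le> G"
    using bounded unfolding bdd_above_def by blast
  have "G > 0" using pos[of 1 1] G[of 1 1] by simp
  obtain \<kappa> where \<kappa>: "\<kappa> > 0" "\<And>x. x \<in> Td \<Longrightarrow> space.low_kernel x x \<ge> \<kappa>"
    using space.low_kernel_diag_lower_bound by blast
  \<comment> \<open>With this scaling \<open>a \<gamma> |low_kernel|\<close> is at most 1, which makes the scaled kernel non-negative.\<close>
  define a where "a = 1 / (1 + G * ?c)"
  have "G * ?c \<ge> 0" using \<open>G > 0\<close> space.cdr_nonneg by simp
  then have a: "0 < a" "a \<le> 1" by (auto simp: a_def)
  have kernel_nonneg: "1 + a * \<gamma> m j * space.low_kernel x y \<ge> 0"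
    if "1 \<le> j" "j \<le> m" "x \<in> Td" "y \<in> Td" for m j x y
  proof -
    have "\<bar>a * \<gamma> m j * space.low_kernel x y\<bar> = a * (\<gamma> m j * \<bar>space.low_kernel x y\<bar>)"
      using a pos[OF that(1,2)] by (simp add: abs_mult)
    also have "\<dots> \<le> a * (G * ?c)"
      using a pos[OF that(1,2)] G[OF that(1,2)] \<open>G > 0\<close> space.abs_low_kernel_le[OF that(3,4)]
      by (intro mult_left_mono mult_mono) auto
    also have "\<dots> \<le> 1" using \<open>G * ?c \<ge> 0\<close> by (simp add: a_def)
    finally show ?thesis by linarith
  qed
  interpret N: product_bounded_complexity "n_min P r \<gamma>" \<gamma> ?c "a * \<kappa>" G
  proof
    fix m :: nat and \<epsilon> :: real assume m: "m \<ge> 1" and eps: "0 < \<epsilon>" "\<epsilon> < 1"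
    interpret W: simplex_weighted P M r "\<gamma> m" m
      by unfold_locales (use pos in auto)
    let ?adm = "\<lambda>n. \<exists>t. (\<forall>i\<in>{1..n}. t i \<in> domain m) \<and> wce P r (\<gamma> m) m n t \<le> \<epsilon> * init_error P r (\<gamma> m) m"
    obtain n where n: "?adm n" "real n \<le> W.trace_bound / \<epsilon>\<^sup>2" using W.exists_admissible[OF m eps] by blast
    have "n_min P r \<gamma> \<epsilon> m \<le> n" unfolding n_min_def by (rule Least_le) (rule n(1))
    then show "real (n_min P r \<gamma> \<epsilon> m) \<le> (\<Prod>j=1..m. 1 + \<gamma> m j * ?c) / \<epsilon>\<^sup>2"
      using n(2) by (simp add: W.trace_bound_def)
    have "?adm (n_min P r \<gamma> \<epsilon> m)" unfolding n_min_def by (rule LeastI[where P = ?adm]) (rule n(1))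
    then obtain t where t: "\<forall>i\<in>{1..n_min P r \<gamma> \<epsilon> m}. t i \<in> domain m"
      "wce P r (\<gamma> m) m (n_min P r \<gamma> \<epsilon> m) t \<le> \<epsilon> * init_error P r (\<gamma> m) m" by blast
    have "(\<Prod>j=1..m. 1 + a * \<gamma> m j * \<kappa>) / 2 \<le> real (n_min P r \<gamma> \<epsilon> m)"
      by (rule W.admissible_lower_bound[OF m _ eps t(2) a])
         (use t(1) kernel_nonneg \<kappa> in \<open>auto intro: less_imp_le\<close>)
    then show "(\<Prod>j=1..m. 1 + a * \<kappa> * \<gamma> m j) / 2 \<le> real (n_min P r \<gamma> \<epsilon> m)"
      by (simp add: mult_ac)
  qed (use pos G space.cdr_nonneg a \<kappa> in auto)
  show ?thesis
    unfolding \<beta>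
    using N.strong_iff N.strong_exponent N.poly_iff N.poly_exponents N.weak_iff
    unfolding N.\<sigma>_def by blast
qed

end
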